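(* Let $\theta\in[0,1)$ be either $\theta=0$ or an irrational number with finite Diophantine approximation exponent $\gamma$; if $\theta=0$ set $\gamma=1$. Let $\psi:\mathbb{N}\to(0,\infty)$ be a positive decreasing function such that the limit $\tau=\lambda(\psi)$ exists and \[\tau>\frac{2+\gamma^2+\sqrt{(2+\gamma^2)^2-4}}{2}.\] Put $\beta:=\gamma^{-2}(\tau-1)^2$ (the hypothesis implies $\beta>\tau$). Then $\dim_F \mathrm{Exact}(\psi,\theta)>0$; more precisely \[\dim_F \mathrm{Exact}(\psi,\theta)\ \ge\ \frac{2(\beta-\tau)}{\tau(\beta-1)}.\]
   Context: For a function $\psi:\mathbb{N}\to(0,\infty)$, $\lambda(\psi):=-\lim_{q\to\infty}\frac{\log\psi(q)}{\log q}$ (assumed to exist). The Diophantine approximation exponent of an irrational $\theta$ is the infimum of all $\gamma$ such that $|\theta-p/q|\le q^{-\gamma}$ has only finitely many integer solutions $(p,q)$. For $\theta\in[0,1)$, $\mathrm{Exact}(\psi,\theta)$ is the set of real $x$ such that (i) $|x-\frac{r-\theta}{q}|\le\psi(q)$ for infinitely many pairs $(r,q)$ of relatively prime integers, and (ii) for every $c>0$, $|x-\frac{r-\theta}{q}|\le\psi(q)-c\psi(q)$ holds for only finitely many pairs $(r,q)$ of relatively prime integers. Fourier transform: $\hat\mu(\xi)=\int e^{-2\pi i x\xi}\,d\mu(x)$. For $E\subset\mathbb{R}$, the Fourier dimension $\dim_F E$ is the supremum of $s\in[0,1]$ such that there exists a nonzero finite positive Borel measure $\mu$ with compact support contained in $E$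 and a constant $C$ with $|\hat\mu(\xi)|\le C(1+|\xi|)^{-s/2}$ for all $\xi\in\mathbb{R}$. *)

theory Defs
  imports "HOL-Analysis.Analysis"
begin

definition lambda_exp :: "(nat \<Rightarrow> real) \<Rightarrow> real \<Rightarrow> bool" where
  "lambda_exp \<psi> \<tau> \<longleftrightarrow> ((\<lambda>q. - ln (\<psi> q) / ln (real q)) \<longlongrightarrow> \<tau>) sequentially"

definition dioph_exponent :: "real \<Rightarrow> ereal" where
  "dioph_exponent \<theta> = Inf {ereal g | g. finite {(p :: int, q :: int).
       q > 0 \<and> \<bar>\<theta> - real_of_int p / real_of_int q\<bar> \<le> real_of_int q powr (- g)}}"

definition Exact :: "(nat \<Rightarrow> real) \<Rightarrow> real \<Rightarrow> real set" where
  "Exact \<psi> \<theta> = {x. infinite {(r :: int, q :: nat). q > 0 \<and> coprime r (int q) \<and>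
          \<bar>x - (real_of_int r - \<theta>) / real q\<bar> \<le> \<psi> q}
     \<and> (\<forall>c > 0. finite {(r :: int, q :: nat). q > 0 \<and> coprime r (int q) \<and>
          \<bar>x - (real_of_int r - \<theta>) / real q\<bar> \<le> \<psi> q - c * \<psi> q})}"

definition fourier_transform :: "real measure \<Rightarrow> real \<Rightarrow> complex" where
  "fourier_transform \<mu> \<xi> = integral\<^sup>L \<mu> (\<lambda>x. exp (- 2 * pi * \<i> * complex_of_real (x * \<xi>)))"

text \<open>Admissible exponents s for the Fourier dimension of E: a nonzero finite positive Borel
  measure with compact support contained in E whose Fourier transform decays like
  (1+|xi|)^(-s/2).  "Compact support contained in E" is expressed as: some compact K \<subseteq> E
  carries all of the mass (the closed support is then a compact subset of K).\<close>
definition fourier_admissible :: "real set \<Rightarrow> real \<Rightarrow> bool" where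
  "fourier_admissible E s \<longleftrightarrow> s \<in> {0..1} \<and>
     (\<exists>\<mu> :: real measure. sets \<mu> = sets borel \<and> finite_measure \<mu> \<and> emeasure \<mu> (space \<mu>) \<noteq> 0 \<and>
        (\<exists>K. compact K \<and> K \<subseteq> E \<and> emeasure \<mu> (UNIV - K) = 0) \<and>
        (\<exists>C. \<forall>\<xi>. norm (fourier_transform \<mu> \<xi>) \<le> C * (1 + \<bar>\<xi>\<bar>) powr (- s / 2)))"

definition fourier_dim :: "real set \<Rightarrow> real" where
  "fourier_dim E = Sup (insert 0 {s. fourier_admissible E s})"

end

theory Submission
  imports Defs "HOL-Probability.Probability" "HOL-Number_Theory.Prime_Powers" "HOL-Real_Asymp.Real_Asymp"
begin

text \<open>
  Put \<open>M\<^sub>k\<^sub>+\<^sub>1 = M\<^sub>k\<^sup>b\<close> with \<open>b\<close> slightly below \<open>\<beta>\<close>. At scale \<open>M\<^sub>k\<close> take the average \<open>F\<^sub>k\<close> over the primes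
  \<open>q\<close> with \<open>M\<^sub>k\<^bsup>1-\<epsilon>\<^esup> \<le> q \<le> M\<^sub>k\<close> of \<open>1/q\<close>-periodic bumps that live where \<open>x - (r - \<theta>)/q\<close> is just below
  \<open>\<psi>(q)\<close>. The Fourier coefficient of \<open>F\<^sub>k\<close> at \<open>l \<noteq> 0\<close> only sees the primes dividing \<open>l\<close>, so it is about
  \<open>1/M\<^sub>k\<close> up to frequency \<open>M\<^sub>k\<^sup>\<tau>\<close> and small beyond. If \<open>f\<^sub>k\<close> is a fixed bump times \<open>F\<^sub>0 \<cdots> F\<^sub>k\<^sub>-\<^sub>1\<close>, then the
  \<open>l\<^sup>1\<close> norm of its transform along translates of \<open>\<int>\<close> is at most about the product of the \<open>M\<^sub>i\<^bsup>\<tau>-1\<^esup>\<close> with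
  \<open>i < k\<close>, that is \<open>M\<^sub>k\<^bsup>(\<tau>-1)/(\<beta>-1)\<^esup>\<close>. Hence passing from \<open>f\<^sub>k\<close> to \<open>f\<^sub>k\<^sub>+\<^sub>1\<close> changes the transform by at most
  about \<open>M\<^sub>k\<^bsup>-1+(\<tau>-1)/(\<beta>-1)\<^esup>\<close> at frequencies up to \<open>M\<^sub>k\<^sup>\<tau>\<close>, which is decay with exponent
  \<open>(\<beta>-\<tau>)/(\<tau>(\<beta>-1))\<close>; a weak limit of the \<open>f\<^sub>k\<close> inherits it.

  No mass has to be removed to make the approximation exact. Distinct points \<open>(r - \<theta>)/q\<close> and
  \<open>(r' - \<theta>)/q'\<close> with \<open>q \<le> q'\<close> are at distance at least about \<open>q'\<^bsup>-\<gamma>\<^esup>/q\<close>, and for \<open>b < \<beta>\<close> this rules out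
  every competitor with denominator between two consecutive prescribed ones.
\<close>

section \<open>Fourier transforms and absolutely convergent Fourier series\<close>

text \<open>Since F is 1-periodic, the transform of f F at \<xi> is the sum of c_l times that of f
  at \<xi> - l, over integers l. One step therefore changes the transform by at most the largest
  |c_l|, l nonzero, times the l^1 norm of FT f on \<xi> + Z, whatever the smoothness of f. That norm
  is multiplied per step by at most the l^1 norm of c, about M^(\<tau>-1). Asking a bound
  M^\<Lambda> to reproduce itself at M^b gives \<Lambda> = (\<tau>-1)/(b-1), and decay of order
  \<sigma> up to frequency M^\<tau> needs \<Lambda> + \<tau>\<sigma> < 1: for b close to \<beta>
  this is the claimed exponent. Beyond M^\<tau> a second invariant, a bound on \<xi>^2 |FT f|, takes
  over. Prime denominators serve twice: few of them divide a given l, and a numerator with 0 < r < q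
  is coprime to q. The starting bump, supported in [1/4, 3/4], confines r to that range. Logarithms,
  constants and the spread of q are all paid by powers M^\<epsilon>, possible because \<sigma> is
  strictly below the target; the target itself is reached only in the supremum.\<close>

definition ee :: "real \<Rightarrow> complex" where
  "ee x = cis (2 * pi * x)"

lemma ee_add: "ee (x + y) = ee x * ee y"
  by (simp add: ee_def cis_mult ring_distribs)

lemma norm_ee [simp]: "norm (ee x) = 1"
  by (simp add: ee_def)

lemma ee_0 [simp]: "ee 0 = 1"
  by (simp add: ee_def)

lemma ee_of_int [simp]: "ee (of_int n) = 1"
  by (simp add: ee_def cis_multiple_2pi)

lemma continuous_on_ee [continuous_intros]:
  "continuous_on S f \<Longrightarrow> continuous_on S (\<lambda>x. ee (f x))"
  unfolding ee_def cis_conv_exp by (intro continuous_intros)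

lemma borel_measurable_ee [measurable]: "ee \<in> borel_measurable borel"
  by (intro borel_measurable_continuous_onI continuous_intros)

lemma ee_has_vector_derivative:
  "((\<lambda>x. ee (a * x)) has_vector_derivative (2 * pi * \<i> * a) * ee (a * x)) (at x within S)"
  unfolding ee_def cis_conv_exp
  by (auto intro!: derivative_eq_intros has_vector_derivative_real_field simp: scaleR_conv_of_real)

definition FT :: "(real \<Rightarrow> complex) \<Rightarrow> real \<Rightarrow> complex" where
  "FT f \<xi> = (\<integral>x. f x * ee (- (x * \<xi>)) \<partial>lborel)"

lemma integrable_mult_ee:
  assumes "integrable lborel (f :: real \<Rightarrow> complex)"
  shows "integrable lborel (\<lambda>x. f x * ee (x * a))"
proof (rule Bochner_Integration.integrable_bound[OF assms])
  have [measurable]: "f \<in> borel_measurable borel"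
    using assms by auto
  show "(\<lambda>x. f x * ee (x * a)) \<in> borel_measurable lborel" by measurable
qed (simp add: norm_mult)

lemma integrable_mult_bounded:
  assumes "integrable lborel (f :: real \<Rightarrow> complex)" "F \<in> borel_measurable borel"
    and "\<And>x. norm (F x) \<le> B"
  shows "integrable lborel (\<lambda>x. f x * F x)"
proof (rule Bochner_Integration.integrable_bound[where f = "\<lambda>x. B *\<^sub>R f x"])
  show "integrable lborel (\<lambda>x. B *\<^sub>R f x)" using assms by auto
  have [measurable]: "f \<in> borel_measurable borel" "F \<in> borel_measurable borel"
    using assms by auto
  show "(\<lambda>x. f x * F x) \<in> borel_measurable lborel" by measurable
  have "B \<ge> 0" using norm_ge_zero order_trans assms(3) by blast
  then have "norm (f x * F x) \<le> norm (B *\<^sub>R f x)" for x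
    using mult_left_mono[OF assms(3)[of x], of "norm (f x)"]
    by (simp add: norm_mult mult.commute)
  then show "AE x in lborel. norm (f x * F x) \<le> norm (B *\<^sub>R f x)" by simp
qed

lemma norm_FT_le:
  assumes "integrable lborel f"
  shows "norm (FT f \<xi>) \<le> (\<integral>x. norm (f x) \<partial>lborel)"
proof -
  have "norm (FT f \<xi>) \<le> (\<integral>x. norm (f x * ee (- (x * \<xi>))) \<partial>lborel)"
    unfolding FT_def by (rule integral_norm_bound)
  then show ?thesis by (simp add: norm_mult)
qed

text \<open>The partial sums converge uniformly (Weierstrass test), so they may be integrated term
  by term against f. Multiplication by F thus becomes a discrete convolution with c on the Fourier
  side.\<close>

lemma FT_mult_has_sum:
  fixes c :: "int \<Rightarrow> complex" and f F :: "real \<Rightarrow> complex" and \<xi> :: real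
  assumes f: "integrable lborel f"
    and c: "(\<lambda>l. norm (c l)) summable_on UNIV"
    and F: "\<And>x. ((\<lambda>l. c l * ee (of_int l * x)) has_sum F x) UNIV"
  shows "continuous_on UNIV F"
    and "integrable lborel (\<lambda>x. f x * F x)"
    and "((\<lambda>l. c l * FT f (\<xi> - of_int l)) has_sum FT (\<lambda>x. f x * F x) \<xi>) UNIV"
proof -
  have lim: "uniform_limit UNIV (\<lambda>X x. \<Sum>l\<in>X. c l * ee (of_int l * x)) F (finite_subsets_at_top UNIV)"
    by (rule Weierstrass_m_test_general'[where M = "\<lambda>l. norm (c l)"]) (use c F in \<open>auto simp: norm_mult\<close>)
  show cont: "continuous_on UNIV F"
    by (rule uniform_limit_theorem[OF _ lim]) (auto intro!: always_eventually continuous_intros)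
  have Fb: "norm (F x) \<le> (\<Sum>\<^sub>\<infinity>l. norm (c l))" for x
  proof -
    have "F x = (\<Sum>\<^sub>\<infinity>l. c l * ee (of_int l * x))"
      using F[of x] by (simp add: infsumI)
    also have "norm \<dots> \<le> (\<Sum>\<^sub>\<infinity>l. norm (c l * ee (of_int l * x)))"
      by (rule norm_infsum_bound) (use c in \<open>auto simp: norm_mult\<close>)
    finally show ?thesis by (simp add: norm_mult)
  qed
  have Fm [measurable]: "F \<in> borel_measurable borel"
    using cont by (rule borel_measurable_continuous_onI)
  have fm [measurable]: "f \<in> borel_measurable borel"
    using f by auto
  show int: "integrable lborel (\<lambda>x. f x * F x)"
    using integrable_mult_bounded[OF f Fm Fb] .
  define N where "N = (\<integral>x. norm (f x) \<partial>lborel)"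
  have N0: "N \<ge> 0" unfolding N_def by simp
  show "((\<lambda>l. c l * FT f (\<xi> - of_int l)) has_sum FT (\<lambda>x. f x * F x) \<xi>) UNIV"
    unfolding has_sum_def tendsto_iff
  proof (intro allI impI)
    fix e :: real assume e: "e > 0"
    \<comment> \<open>The summand 1 keeps the quotient meaningful for N = 0 and makes d * N strictly
      smaller than e.\<close>
    define d where "d = e / (N + 1)"
    have d: "d > 0" "d * N < e" using e N0 by (auto simp: d_def field_simps)
    from uniform_limitD[OF lim d(1)]
    show "\<forall>\<^sub>F X in finite_subsets_at_top UNIV.
        dist (\<Sum>l\<in>X. c l * FT f (\<xi> - of_int l)) (FT (\<lambda>x. f x * F x) \<xi>) < e"
    proof eventually_elim
      case (elim X)
      let ?G = "\<lambda>x. F x - (\<Sum>l\<in>X. c l * ee (of_int l * x))"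
      have G: "norm (?G x) \<le> d" for x
        using elim[rule_format, of x] by (simp add: dist_norm norm_minus_commute)
      have i: "integrable lborel (\<lambda>x. c l * (f x * ee (x * (of_int l - \<xi>))))" for l
        using integrable_mult_ee[OF f, of "l - \<xi>"] by auto
      have iG: "integrable lborel (\<lambda>x. f x * ?G x)"
        by (rule integrable_mult_bounded[OF f _ G]) measurable
      have "(\<Sum>l\<in>X. c l * FT f (\<xi> - of_int l)) = (\<Sum>l\<in>X. \<integral>x. c l * (f x * ee (x * (of_int l - \<xi>))) \<partial>lborel)"
        by (simp add: FT_def algebra_simps)
      also have "\<dots> = (\<integral>x. (\<Sum>l\<in>X. c l * (f x * ee (x * (of_int l - \<xi>)))) \<partial>lborel)"
        by (rule Bochner_Integration.integral_sum[symmetric]) (rule i)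
      finally have S: "(\<Sum>l\<in>X. c l * FT f (\<xi> - of_int l)) = \<dots>" .
      have "FT (\<lambda>x. f x * F x) \<xi> - (\<Sum>l\<in>X. c l * FT f (\<xi> - of_int l))
          = (\<integral>x. f x * F x * ee (x * (- \<xi>)) - (\<Sum>l\<in>X. c l * (f x * ee (x * (of_int l - \<xi>)))) \<partial>lborel)"
        unfolding S unfolding FT_def
        by (subst Bochner_Integration.integral_diff)
           (use i integrable_mult_ee[OF int, of "-\<xi>"] in \<open>auto\<close>)
      also have "\<dots> = FT (\<lambda>x. f x * ?G x) \<xi>"
        unfolding FT_def
      proof (rule arg_cong[where f = "integral\<^sup>L lborel"], rule ext)
        fix x :: real
        have "ee (x * (of_int l - \<xi>)) = ee (of_int l * x) * ee (- (x * \<xi>))" for l :: int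
          by (simp add: ee_add[symmetric] algebra_simps)
        then show "f x * F x * ee (x * - \<xi>) - (\<Sum>l\<in>X. c l * (f x * ee (x * (of_int l - \<xi>)))) =
            f x * ?G x * ee (- (x * \<xi>))"
          by (simp add: algebra_simps sum_distrib_left)
      qed
      also have "norm \<dots> \<le> (\<integral>x. norm (f x * ?G x) \<partial>lborel)"
        by (rule norm_FT_le[OF iG])
      also have "\<dots> \<le> (\<integral>x. d * norm (f x) \<partial>lborel)"
      proof (rule integral_mono)
        show "integrable lborel (\<lambda>x. norm (f x * ?G x))"
          using iG by (rule integrable_norm)
        show "integrable lborel (\<lambda>x. d * norm (f x))" using f by auto
        show "norm (f x * ?G x) \<le> d * norm (f x)" for x
          using mult_left_mono[OF G[of x] norm_ge_zero[of "f x"]]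
          by (simp add: norm_mult mult.commute[of d])
      qed
      also have "\<dots> = d * N" by (simp add: N_def)
      also have "\<dots> < e" by (rule d)
      finally show ?case by (simp add: dist_norm norm_minus_commute)
    qed
  qed
qed

text \<open>Each term is compared with an increment of arctan over one integer step. By the mean
  value theorem the increment is w / (1 + z^2) with z within w \<le> 1 of u, and 1 + z^2 \<le> 3 (1
  + u^2). The telescoping sum is at most pi, and 3 pi \<le> 10. The bound is uniform in
  \<xi>.\<close>

lemma sum_inverse_quadratic_le:
  fixes S :: "int set" and w \<xi> :: real
  assumes w: "0 < w" "w \<le> 1" and S: "finite S"
  shows "(\<Sum>l\<in>S. 1 / (1 + (w * (\<xi> - of_int l))\<^sup>2)) \<le> 10 / w"
proof -
  define a where "a l = arctan (w * (of_int l - \<xi>))" for l :: int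
  have step: "1 / (1 + (w * (\<xi> - of_int l))\<^sup>2) \<le> 3 / w * (a (l + 1) - a l)" for l :: int
  proof -
    define u where "u = w * (of_int l - \<xi>)"
    have u1: "w * (of_int (l + 1) - \<xi>) = u + w" by (simp add: u_def algebra_simps)
    have "\<exists>z. u < z \<and> z < u + w \<and> arctan (u + w) - arctan u = (u + w - u) * inverse (1 + z\<^sup>2)"
      by (rule MVT2) (use w DERIV_arctan in auto)
    then obtain z where z: "u < z" "z < u + w" "arctan (u + w) - arctan u = w * inverse (1 + z\<^sup>2)"
      by auto
    have "\<bar>z\<bar> \<le> \<bar>u\<bar> + 1" using z w by linarith
    then have "z\<^sup>2 \<le> (\<bar>u\<bar> + 1)\<^sup>2" by (metis abs_ge_zero power2_abs power_mono)
    also have "\<dots> = u\<^sup>2 + 2 * \<bar>u\<bar> + 1" by (simp add: power2_eq_square algebra_simps)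
    also have "\<dots> \<le> 3 * u\<^sup>2 + 2"
    proof -
      have "2 * \<bar>u\<bar> \<le> u\<^sup>2 + 1"
        using zero_le_power2[of "\<bar>u\<bar> - 1"] by (simp add: power2_diff)
      then show ?thesis using zero_le_power2[of u] by linarith
    qed
    finally have "1 + z\<^sup>2 \<le> 3 * (1 + u\<^sup>2)" by simp
    moreover have "1 + z\<^sup>2 > 0" "1 + u\<^sup>2 > 0" by (auto simp: add_pos_nonneg)
    ultimately have "1 / (1 + u\<^sup>2) \<le> 3 * inverse (1 + z\<^sup>2)"
      by (simp add: field_simps)
    also have "\<dots> = 3 / w * (a (l + 1) - a l)"
      unfolding a_def u1 using z(3) w by (simp add: u_def)
    finally show ?thesis
      by (simp add: u_def power2_eq_square algebra_simps)
  qed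
  obtain n :: nat where n: "S \<subseteq> {- int n..<int n}"
  proof -
    define b where "b = Max (insert 0 (abs ` S))"
    have b: "\<bar>l\<bar> \<le> b" if "l \<in> S" for l
      unfolding b_def using S that by (intro Max_ge) auto
    then have "S \<subseteq> {- int (nat (b + 1))..<int (nat (b + 1))}" by force
    then show ?thesis using that by blast
  qed
  have tele: "(\<Sum>l\<in>{- int n..<int n}. a (l + 1) - a l) = a (int n) - a (- int n)" for n
  proof (induction n)
    case (Suc n)
    have "{- int (Suc n)..<int (Suc n)} = insert (- int (Suc n)) (insert (int n) {- int n..<int n})"
      by auto
    then show ?case using Suc by (simp add: add.commute)
  qed simp
  have "(\<Sum>l\<in>S. 1 / (1 + (w * (\<xi> - of_int l))\<^sup>2)) \<le> (\<Sum>l\<in>{- int n..<int n}. 1 / (1 + (w * (\<xi> - of_int l))\<^sup>2))"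
    by (rule sum_mono2) (use n in \<open>auto\<close>)
  also have "\<dots> \<le> (\<Sum>l\<in>{- int n..<int n}. 3 / w * (a (l + 1) - a l))"
    by (rule sum_mono) (rule step)
  also have "\<dots> = 3 / w * (a (int n) - a (- int n))"
    by (simp only: sum_distrib_left[symmetric] tele)
  also have "\<dots> \<le> 3 / w * pi"
    using arctan_bounded[of "w * (of_int (int n) - \<xi>)"] arctan_bounded[of "w * (of_int (- int n) - \<xi>)"] w
    unfolding a_def by (intro mult_left_mono) auto
  also have "\<dots> \<le> 10 / w"
    using pi_less_4 w pi_approx by (simp add: field_simps)
  finally show ?thesis .
qed

section \<open>Periodic bumps\<close>

text \<open>The raised cosine (Hann) window. It has integral 1, and it vanishes together with its
  derivative at both ends, which gives cubic decay of its transform.\<close>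

definition bump :: "real \<Rightarrow> real" where
  "bump x = indicator {-1..1} x * ((1 + cos (pi * x)) / 2)"

lemma bump_nonneg: "bump x \<ge> 0"
  unfolding bump_def by (auto simp: indicator_def intro: add_nonneg_nonneg) (smt (verit) cos_ge_minus_one)

lemma bump_le_1: "bump x \<le> 1"
  unfolding bump_def by (auto simp: indicator_def)

lemma bump_eq_0: "\<bar>x\<bar> \<ge> 1 \<Longrightarrow> bump x = 0"
proof -
  assume "\<bar>x\<bar> \<ge> 1"
  moreover have "cos (pi * x) = -1" if "\<bar>x\<bar> = 1"
    using that by (auto simp: abs_if split: if_splits)
  ultimately show ?thesis by (cases "\<bar>x\<bar> = 1") (auto simp: bump_def indicator_def)
qed

lemma borel_measurable_bump [measurable]: "bump \<in> borel_measurable borel"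
  unfolding bump_def by measurable

lemma integrable_bump_scaled:
  assumes "v > 0"
  shows "integrable lborel (\<lambda>x. complex_of_real (bump ((x - x0) / v) / v))"
proof (rule Bochner_Integration.integrable_bound[where f = "\<lambda>x. indicator {x0 - v..x0 + v} x *\<^sub>R (1 / v)"])
  show "integrable lborel (\<lambda>x. indicator {x0 - v..x0 + v} x *\<^sub>R (1 / v))"
    by (intro integrable_scaleR_left integrable_real_indicator) (auto simp: emeasure_lborel_Icc_eq)
  have "norm (complex_of_real (bump ((x - x0) / v) / v)) \<le> norm (indicator {x0 - v..x0 + v} x *\<^sub>R (1 / v))" for x
  proof (cases "x \<in> {x0 - v..x0 + v}")
    case True
    then show ?thesis using bump_nonneg[of "(x - x0)/v"] bump_le_1[of "(x - x0)/v"] assms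
      unfolding norm_of_real by (auto simp: divide_right_mono)
  next
    case False
    then have "\<bar>(x - x0) / v\<bar> \<ge> 1" using assms by (auto simp: field_simps abs_if)
    then show ?thesis by (simp add: bump_eq_0)
  qed
  then show "AE x in lborel. norm (complex_of_real (bump ((x - x0) / v) / v)) \<le> norm (indicator {x0 - v..x0 + v} x *\<^sub>R (1 / v))"
    by simp
qed measurable

text \<open>Integrating by parts twice and using that \<open>bump'' = \<pi>\<^sup>2 (1/2 - bump)\<close> inside the support
  expresses the transform of the bump through that of an interval.\<close>

lemma FT_bump_le: "norm (FT (\<lambda>x. bump x) t) \<le> 8 / (1 + \<bar>t\<bar>) ^ 3"
proof -
  define b where "b x = (1 + cos (pi * x)) / 2" for x
  have b_eq: "bump x = indicator {-1..1} x * b x" for x by (simp add: bump_def b_def)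
  define I where "I = FT (\<lambda>x. bump x) t"
  have I: "I = (\<integral>x. indicator {-1..1} x *\<^sub>R (b x * ee (- t * x)) \<partial>lborel)"
    unfolding I_def FT_def by (simp add: b_eq scaleR_conv_of_real algebra_simps)
  have ib: "integrable lborel (\<lambda>x. indicator {-1..1} x *\<^sub>R (b x * ee (- t * x)))"
    unfolding b_def by (rule borel_integrable_compact) (auto intro!: continuous_intros)
  have i1: "integrable lborel (\<lambda>x. indicator {-1..1} x *\<^sub>R (ee (- t * x)))"
    by (rule borel_integrable_compact) (auto intro!: continuous_intros)
  have I1: "norm I \<le> 1"
  proof -
    have "norm I \<le> (\<integral>x. norm (complex_of_real (bump x)) \<partial>lborel)"
      unfolding I_def using integrable_bump_scaled[of 1 0] by (intro norm_FT_le) simp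
    also have "\<dots> = (\<integral>x. indicator {-1..1} x *\<^sub>R b x \<partial>lborel)"
    proof (rule arg_cong[where f = "integral\<^sup>L lborel"], rule ext)
      show "norm (complex_of_real (bump x)) = indicator {-1..1} x *\<^sub>R b x" for x
        using bump_nonneg[of x] unfolding norm_of_real by (simp add: b_eq)
    qed
    also have "\<dots> = (1 + sin (pi * 1) / pi) / 2 - (-1 + sin (pi * (-1)) / pi) / 2"
      unfolding b_def
      by (rule integral_FTC_Icc) (auto intro!: derivative_eq_intros continuous_intros
            simp flip: has_real_derivative_iff_has_vector_derivative)
    finally show ?thesis by simp
  qed
  show ?thesis
  \<comment> \<open>For small t the trivial bound by the integral suffices, because 8 / (1 + 1)^3 =
    1.\<close>
  proof (cases "\<bar>t\<bar> \<le> 1")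
    case True
    have "(1 + \<bar>t\<bar>) ^ 3 \<le> 2 ^ 3" using True by (intro power_mono) auto
    then have "1 \<le> 8 / (1 + \<bar>t\<bar>) ^ 3" by (simp add: field_simps)
    with I1 show ?thesis unfolding I_def by linarith
  next
    case False
    define T where "T = 2 * pi * t"
    define J where "J = (\<integral>x. indicator {-1..1} x *\<^sub>R ee (- t * x) \<partial>lborel)"
    have T: "\<bar>T\<bar> > 2 * pi" "T \<noteq> 0" using False by (auto simp: T_def abs_mult)
    have "J = ee (- t * 1) / (- \<i> * T) - ee (- t * (-1)) / (- \<i> * T)"
      unfolding J_def
    proof (rule integral_FTC_Icc)
      fix x :: real
      have "((\<lambda>x. ee (- t * x) / (- \<i> * T)) has_vector_derivative
          ((2 * pi * \<i> * (- t)) * ee (- t * x)) / (- \<i> * T)) (at x within {-1..1})"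
        using ee_has_vector_derivative[of "-t" x "{-1..1}"]
        by (intro has_vector_derivative_divide) auto
      also have "(2 * pi * \<i> * (- t)) * ee (- t * x) / (- \<i> * T) = ee (- t * x)"
        using T False by (simp add: T_def field_simps)
      finally show "((\<lambda>x. ee (- t * x) / (- \<i> * T)) has_vector_derivative ee (- t * x)) (at x within {-1..1})" .
    qed (auto intro!: continuous_intros)
    also have "norm \<dots> \<le> 1 / \<bar>T\<bar> + 1 / \<bar>T\<bar>"
      by (rule order_trans[OF norm_triangle_ineq4]) (simp add: norm_divide norm_mult)
    finally have J: "norm J \<le> 2 / \<bar>T\<bar>" by simp
    \<comment> \<open>The boundary term of two integrations by parts, namely ee times (b' + i T b).
      It vanishes at both ends, where b and b' are 0.\<close>
    define H where "H x = ee (- t * x) * (- (pi / 2) * sin (pi * x) + \<i> * T * b x)" for x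
    have "(\<integral>x. indicator {-1..1} x *\<^sub>R ((T\<^sup>2 - pi\<^sup>2) * (b x * ee (- t * x)) + pi\<^sup>2 / 2 * ee (- t * x)) \<partial>lborel) = H 1 - H (-1)"
    proof (rule integral_FTC_Icc)
      fix x :: real
      have db: "(b has_real_derivative (- (pi / 2) * sin (pi * x))) (at x within {-1..1})"
        unfolding b_def by (auto intro!: derivative_eq_intros)
      have "((\<lambda>x. - (pi / 2) * sin (pi * x)) has_real_derivative (- (pi\<^sup>2 / 2) * cos (pi * x))) (at x within {-1..1})"
        by (auto intro!: derivative_eq_intros simp: power2_eq_square)
      then have d1: "((\<lambda>x. complex_of_real (- (pi / 2) * sin (pi * x))) has_vector_derivative complex_of_real (- (pi\<^sup>2 / 2) * cos (pi * x))) (at x within {-1..1})"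
        by (intro has_vector_derivative_of_real) (simp add: has_real_derivative_iff_has_vector_derivative)
      have d2: "((\<lambda>x. complex_of_real (b x)) has_vector_derivative complex_of_real (- (pi / 2) * sin (pi * x))) (at x within {-1..1})"
        using db by (intro has_vector_derivative_of_real) (simp add: has_real_derivative_iff_has_vector_derivative)
      have "(H has_vector_derivative
          (ee (- t * x) * (complex_of_real (- (pi\<^sup>2 / 2) * cos (pi * x)) + \<i> * T * complex_of_real (- (pi / 2) * sin (pi * x)))
          + (2 * pi * \<i> * complex_of_real (- t)) * ee (- t * x) * (complex_of_real (- (pi / 2) * sin (pi * x)) + \<i> * T * b x))) (at x within {-1..1})"
        unfolding H_def
        by (intro has_vector_derivative_mult has_vector_derivative_add d1 has_vector_derivative_mult_right d2 ee_has_vector_derivative)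
      also have "(ee (- t * x) * (complex_of_real (- (pi\<^sup>2 / 2) * cos (pi * x)) + \<i> * T * complex_of_real (- (pi / 2) * sin (pi * x)))
          + (2 * pi * \<i> * complex_of_real (- t)) * ee (- t * x) * (complex_of_real (- (pi / 2) * sin (pi * x)) + \<i> * T * b x))
         = (T\<^sup>2 - pi\<^sup>2) * (b x * ee (- t * x)) + pi\<^sup>2 / 2 * ee (- t * x)"
        by (simp add: T_def b_def field_simps power2_eq_square)
      finally show "(H has_vector_derivative (T\<^sup>2 - pi\<^sup>2) * (b x * ee (- t * x)) + pi\<^sup>2 / 2 * ee (- t * x)) (at x within {-1..1})" .
    qed (auto intro!: continuous_intros simp: b_def)
    also have "H 1 - H (-1) = 0" by (simp add: H_def b_def)
    also have "(\<integral>x. indicator {-1..1} x *\<^sub>R ((T\<^sup>2 - pi\<^sup>2) * (b x * ee (- t * x)) + pi\<^sup>2 / 2 * ee (- t * x)) \<partial>lborel)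
       = (\<integral>x. (T\<^sup>2 - pi\<^sup>2) * (indicator {-1..1} x *\<^sub>R (b x * ee (- t * x))) + pi\<^sup>2 / 2 * (indicator {-1..1} x *\<^sub>R ee (- t * x)) \<partial>lborel)"
      by (rule arg_cong[where f = "integral\<^sup>L lborel"]) (auto simp: scaleR_conv_of_real algebra_simps)
    also have "\<dots> = (T\<^sup>2 - pi\<^sup>2) * I + pi\<^sup>2 / 2 * J"
      unfolding I J_def
      by (subst Bochner_Integration.integral_add[OF integrable_mult_right[OF ib] integrable_mult_right[OF i1]])
         (simp only: integral_mult_right_zero)
    finally have eq: "complex_of_real (T\<^sup>2 - pi\<^sup>2) * I = - (complex_of_real (pi\<^sup>2 / 2) * J)"
      by (simp add: algebra_simps eq_neg_iff_add_eq_0)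
    have Tsq: "T\<^sup>2 \<ge> 4 * pi\<^sup>2"
      using power_mono[of "2 * pi" "\<bar>T\<bar>" 2] T(1) by (simp add: power_mult_distrib)
    \<comment> \<open>The range |t| > 1 keeps T away from the resonance T = pi, where the identity
      above gives no information on I.\<close>
    have T2: "T\<^sup>2 - pi\<^sup>2 \<ge> T\<^sup>2 / 2" using Tsq zero_le_power2[of pi] by linarith
    have "T\<^sup>2 / 2 * norm I \<le> (T\<^sup>2 - pi\<^sup>2) * norm I"
      using T2 by (intro mult_right_mono) auto
    also have "\<dots> = norm (complex_of_real (T\<^sup>2 - pi\<^sup>2) * I)"
      using T2 zero_le_power2[of T] unfolding norm_mult norm_of_real by linarith
    also have "\<dots> = pi\<^sup>2 / 2 * norm J"
      unfolding eq by (simp add: norm_mult norm_divide norm_power)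
    also have "\<dots> \<le> pi\<^sup>2 / 2 * (2 / \<bar>T\<bar>)" by (intro mult_left_mono J) auto
    finally have "T\<^sup>2 / 2 * norm I \<le> pi\<^sup>2 / \<bar>T\<bar>" by simp
    then have "norm I * \<bar>T\<bar> ^ 3 \<le> 2 * pi\<^sup>2"
      using T(2) by (simp add: field_simps power2_eq_square power3_eq_cube)
    then have "norm I * (8 * pi ^ 3 * \<bar>t\<bar> ^ 3) \<le> 2 * pi\<^sup>2"
      by (simp add: T_def abs_mult power_mult_distrib)
    then have "pi\<^sup>2 * (norm I * (8 * pi * \<bar>t\<bar> ^ 3)) \<le> pi\<^sup>2 * 2"
      by (simp add: power2_eq_square power3_eq_cube algebra_simps)
    then have A: "norm I * (8 * pi * \<bar>t\<bar> ^ 3) \<le> 2" by simp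
    have "(1 + \<bar>t\<bar>) ^ 3 \<le> (2 * \<bar>t\<bar>) ^ 3" using False by (intro power_mono) auto
    then have "norm I * (1 + \<bar>t\<bar>) ^ 3 \<le> norm I * (8 * \<bar>t\<bar> ^ 3)"
      by (intro mult_left_mono) (auto simp: power_mult_distrib)
    also have "\<dots> \<le> norm I * (8 * pi * \<bar>t\<bar> ^ 3)"
      using pi_ge_two mult_right_mono[of 1 pi "\<bar>t\<bar> ^ 3"] by (intro mult_left_mono) auto
    finally have "norm I * (1 + \<bar>t\<bar>) ^ 3 \<le> 8" using A by linarith
    moreover have "(1 + \<bar>t\<bar>) ^ 3 > 0" by (intro zero_less_power) auto
    ultimately show ?thesis by (simp add: I_def field_simps)
  qed
qed

lemma FT_bump_0: "FT (\<lambda>x. bump x) 0 = 1"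
proof -
  have "FT (\<lambda>x. bump x) 0 = (\<integral>x. complex_of_real (bump x) \<partial>lborel)" by (simp add: FT_def)
  also have "\<dots> = complex_of_real (\<integral>x. bump x \<partial>lborel)"
    by (rule integral_complex_of_real)
  also have "(\<integral>x. bump x \<partial>lborel) = (\<integral>x. indicator {-1..1} x *\<^sub>R ((1 + cos (pi * x)) / 2) \<partial>lborel)"
    by (simp add: bump_def)
  also have "\<dots> = (1 + sin (pi * 1) / pi) / 2 - (-1 + sin (pi * (-1)) / pi) / 2"
    by (rule integral_FTC_Icc) (auto intro!: derivative_eq_intros continuous_intros
          simp flip: has_real_derivative_iff_has_vector_derivative)
  finally show ?thesis by simp
qed

lemma FT_bump_scaled:
  assumes "v > 0"
  shows "FT (\<lambda>x. complex_of_real (bump ((x - x0) / v) / v)) \<xi> = ee (- (x0 * \<xi>)) * FT (\<lambda>x. bump x) (v * \<xi>)"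
proof -
  have "FT (\<lambda>x. complex_of_real (bump ((x - x0) / v) / v)) \<xi>
     = \<bar>v\<bar> *\<^sub>R (\<integral>x. complex_of_real (bump ((x0 + v * x - x0) / v) / v) * ee (- ((x0 + v * x) * \<xi>)) \<partial>lborel)"
    unfolding FT_def by (rule lborel_integral_real_affine) (use assms in auto)
  also have "\<dots> = (\<integral>x. \<bar>v\<bar> *\<^sub>R (complex_of_real (bump ((x0 + v * x - x0) / v) / v) * ee (- ((x0 + v * x) * \<xi>))) \<partial>lborel)"
    by simp
  also have "\<dots> = (\<integral>x. ee (- (x0 * \<xi>)) * (complex_of_real (bump x) * ee (- (x * (v * \<xi>)))) \<partial>lborel)"
  proof (rule arg_cong[where f = "integral\<^sup>L lborel"], rule ext)
    fix x
    have "ee (- ((x0 + v * x) * \<xi>)) = ee (- (x0 * \<xi>)) * ee (- (x * (v * \<xi>)))"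
      by (simp add: ee_add[symmetric] algebra_simps)
    then show "\<bar>v\<bar> *\<^sub>R (complex_of_real (bump ((x0 + v * x - x0) / v) / v) * ee (- ((x0 + v * x) * \<xi>)))
      = ee (- (x0 * \<xi>)) * (complex_of_real (bump x) * ee (- (x * (v * \<xi>))))"
      using assms by (simp add: scaleR_conv_of_real)
  qed
  finally show ?thesis by (simp add: FT_def)
qed

text \<open>Lebesgue's argument: powers of \<open>1 + cos (2 \<pi> (x - x0)) - cos (2 \<pi> \<delta>)\<close> are trigonometric
  polynomials concentrating near \<open>x0\<close>.\<close>

lemma continuous_fourier_coeffs_zero:
  fixes h :: "real \<Rightarrow> complex"
  assumes h: "continuous_on {0..1} h"
    and zero: "\<And>j::int. integral {0..1} (\<lambda>x. h x * ee (of_int j * x)) = 0"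
    and x0: "0 < x0" "x0 < 1"
  shows "h x0 = 0"
proof (rule ccontr)
  assume h0: "h x0 \<noteq> 0"
  \<comment> \<open>Rotating h by the conjugate of h x0 makes the value at x0 the positive number |h
    x0|^2, so a real-valued argument applies.\<close>
  define u where "u x = Re (cnj (h x0) * h x)" for x
  have contu: "continuous_on {0..1} u"
    unfolding u_def by (intro continuous_intros h)
  define a where "a = u x0"
  have a: "a > 0" using h0 by (simp add: a_def u_def complex_neq_0 power2_eq_square)
  obtain \<delta>0 where \<delta>0: "\<delta>0 > 0" "\<And>x. x \<in> {0..1} \<Longrightarrow> dist x x0 < \<delta>0 \<Longrightarrow> dist (u x) (u x0) < a / 2"
    using contu x0 a unfolding continuous_on_iff by (metis atLeastAtMost_iff half_gt_zero less_imp_le)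
  define \<delta> where "\<delta> = min (min (\<delta>0 / 2) (1/4)) (min x0 (1 - x0))"
  have \<delta>: "\<delta> > 0" "\<delta> < \<delta>0" "\<delta> \<le> 1/4" "\<delta> \<le> x0" "\<delta> \<le> 1 - x0"
    using \<delta>0(1) x0 by (auto simp: \<delta>_def min_def)
  define T where "T x = 1 + cos (2 * pi * (x - x0)) - cos (2 * pi * \<delta>)" for x
  \<comment> \<open>T has only the frequencies 0, 1 and -1, so the vanishing of all coefficients
    passes from h T^n to h T^(n+1).\<close>
  have Tee: "complex_of_real (T x) = complex_of_real (1 - cos (2 * pi * \<delta>)) + ee (- x0) / 2 * ee x + ee x0 / 2 * ee (- x)" for x
  proof -
    have "ee (- x0) * ee x = cis (2 * pi * (x - x0))" "ee x0 * ee (- x) = cis (- (2 * pi * (x - x0)))"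
      by (simp_all add: ee_def cis_mult algebra_simps)
    then show ?thesis by (simp add: T_def complex_eq_iff)
  qed
  have contT: "continuous_on S T" for S unfolding T_def by (intro continuous_intros)
  have int: "(\<lambda>x. h x * of_real (T x) ^ n * ee (of_int j * x)) integrable_on {0..1}" for n and j :: int
    by (intro integrable_continuous_interval continuous_intros h contT)
  have zeroT: "integral {0..1} (\<lambda>x. h x * of_real (T x) ^ n * ee (of_int j * x)) = 0" for n and j :: int
  proof (induction n arbitrary: j)
    case 0
    then show ?case using zero by simp
  next
    case (Suc n)
    let ?g = "\<lambda>j::int. \<lambda>x. h x * of_real (T x) ^ n * ee (of_int j * x)"
    have "h x * of_real (T x) ^ Suc n * ee (of_int j * x)
        = complex_of_real (1 - cos (2 * pi * \<delta>)) * ?g j x + ee (- x0) / 2 * ?g (j + 1) x + ee x0 / 2 * ?g (j - 1) x" for x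
    proof -
      have 1: "ee (of_int (j + 1) * x) = ee x * ee (of_int j * x)" "ee (of_int (j - 1) * x) = ee (- x) * ee (of_int j * x)"
        by (simp_all add: ee_add[symmetric] algebra_simps)
      show ?thesis unfolding 1 power_Suc
        by (subst Tee) (simp add: algebra_simps)
    qed
    moreover have z: "(?g j has_integral 0) {0..1}" for j
      using int[of n j] Suc[of j] by (simp add: has_integral_integrable_integral)
    have "((\<lambda>x. complex_of_real (1 - cos (2 * pi * \<delta>)) * ?g j x + ee (- x0) / 2 * ?g (j + 1) x + ee x0 / 2 * ?g (j - 1) x)
       has_integral (complex_of_real (1 - cos (2 * pi * \<delta>)) * 0 + ee (- x0) / 2 * 0 + ee x0 / 2 * 0)) {0..1}"
      by (intro has_integral_add has_integral_mult_right z)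
    ultimately show ?case by (simp add: integral_unique)
  qed
  have uT0: "((\<lambda>x. u x * T x ^ n) has_integral 0) {0..1}" for n
  proof -
    have "((\<lambda>x. h x * of_real (T x) ^ n) has_integral 0) {0..1}"
      using zeroT[of n 0] int[of n 0] by (auto simp: has_integral_integrable_integral)
    then have "((\<lambda>x. cnj (h x0) * (h x * of_real (T x) ^ n)) has_integral (cnj (h x0) * 0)) {0..1}"
      by (rule has_integral_mult_right)
    then have "((\<lambda>x. Re (cnj (h x0) * (h x * of_real (T x) ^ n))) has_integral Re (cnj (h x0) * 0)) {0..1}"
      by (rule has_integral_Re)
    moreover have "Re (cnj (h x0) * (h x * of_real (T x) ^ n)) = u x * T x ^ n" for x
    proof -
      have "cnj (h x0) * (h x * of_real (T x) ^ n) = (cnj (h x0) * h x) * complex_of_real (T x ^ n)" by simp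
      then show ?thesis unfolding u_def by (simp only: Re_complex_of_real times_complex.sel Im_complex_of_real)
    qed
    ultimately show ?thesis by simp
  qed
  obtain B where B: "\<And>x. x \<in> {0..1} \<Longrightarrow> \<bar>u x\<bar> \<le> B" "B \<ge> 0"
  proof -
    have "compact (u ` {0..1})" by (intro compact_continuous_image contu) auto
    then obtain B where "\<forall>y\<in>u ` {0..1}. norm y \<le> B" using compact_imp_bounded bounded_iff by blast
    then show ?thesis using that[of "\<bar>B\<bar>"] by force
  qed
  \<comment> \<open>The excess of T over 1 on the inner half of the neighbourhood; outside the
    neighbourhood |T| \<le> 1.\<close>
  define \<kappa> where "\<kappa> = cos (pi * \<delta>) - cos (2 * pi * \<delta>)"
  have \<kappa>: "\<kappa> > 0" unfolding \<kappa>_def using \<delta> by (auto intro!: cos_monotone_0_pi)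
  have cmono: "cos (2 * pi * y) \<le> cos (2 * pi * z)" if "\<bar>z\<bar> \<le> \<bar>y\<bar>" "\<bar>y\<bar> \<le> 1/2" for y z
  proof -
    have "cos (2 * pi * \<bar>y\<bar>) \<le> cos (2 * pi * \<bar>z\<bar>)" using that by (intro cos_monotone_0_pi_le) auto
    then show ?thesis using cos_abs_real[of "2 * pi * y"] cos_abs_real[of "2 * pi * z"] by (simp add: abs_mult)
  qed
  have T1: "T x \<ge> 1" if "\<bar>x - x0\<bar> \<le> \<delta>" for x
    using cmono[of "x - x0" \<delta>] that \<delta> by (simp add: T_def)
  have T2: "T x \<ge> 1 + \<kappa>" if "\<bar>x - x0\<bar> \<le> \<delta> / 2" for x
    using cmono[of "x - x0" "\<delta> / 2"] that \<delta> by (simp add: T_def \<kappa>_def)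
  have T3: "\<bar>T x\<bar> \<le> 1" if "\<bar>x - x0\<bar> \<ge> \<delta>" "x \<in> {0..1}" for x
  proof -
    have le: "\<bar>x - x0\<bar> \<le> 1 - \<delta>" using that \<delta> by auto
    have "cos (2 * pi * (x - x0)) \<le> cos (2 * pi * \<delta>)"
    proof (cases "\<bar>x - x0\<bar> \<le> 1/2")
      case True
      then show ?thesis using that \<delta> by (intro cmono) auto
    next
      case False
      have "cos (2 * pi * (x - x0)) = cos (2 * pi * \<bar>x - x0\<bar>)"
        using cos_abs_real[of "2 * pi * (x - x0)"] by (simp add: abs_mult)
      also have "\<dots> = cos (2 * pi - 2 * pi * \<bar>x - x0\<bar>)" by (simp add: cos_diff)
      also have "\<dots> = cos (2 * pi * (1 - \<bar>x - x0\<bar>))" by (simp add: algebra_simps)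
      also have "\<dots> \<le> cos (2 * pi * \<delta>)" using False le \<delta> by (intro cmono) auto
      finally show ?thesis .
    qed
    moreover have "cos (2 * pi * (x - x0)) \<ge> -1" "cos (2 * pi * \<delta>) \<le> 1" by auto
    ultimately show ?thesis unfolding T_def abs_le_iff by (smt (verit))
  qed
  \<comment> \<open>On the inner interval of length \<delta> the integrand u T^n is at least a/2 (1
    + \<kappa>)^n, on the rest of the neighbourhood it is nonnegative, and elsewhere it is at least
    -B. Its integral is 0, which fails for large n.\<close>
  have key: "a / 2 * (1 + \<kappa>) ^ n * \<delta> - B \<le> 0" for n
  proof -
    let ?I = "{x0 - \<delta>/2..x0 + \<delta>/2}"
    have sub: "?I \<subseteq> {0..1}" using \<delta> by auto
    have "((\<lambda>x. a / 2 * (1 + \<kappa>) ^ n) has_integral (a / 2 * (1 + \<kappa>) ^ n * \<delta>)) ?I"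
      using \<delta> has_integral_const_real[of "a / 2 * (1 + \<kappa>) ^ n" "x0 - \<delta>/2" "x0 + \<delta>/2"] by (simp add: mult.commute)
    then have "((\<lambda>x. if x \<in> ?I then a / 2 * (1 + \<kappa>) ^ n else 0) has_integral (a / 2 * (1 + \<kappa>) ^ n * \<delta>)) {0..1}"
      using sub by (subst has_integral_restrict) auto
    moreover have "((\<lambda>x. B) has_integral B) {0..1::real}"
      using has_integral_const_real[of B 0 1] by simp
    ultimately have "((\<lambda>x. (if x \<in> ?I then a / 2 * (1 + \<kappa>) ^ n else 0) - B) has_integral (a / 2 * (1 + \<kappa>) ^ n * \<delta> - B)) {0..1}"
      by (rule has_integral_diff)
    then show ?thesis
    proof (rule has_integral_le[OF _ uT0[of n]])
      fix x :: real assume x: "x \<in> {0..1}"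
      have near: "u x \<ge> a / 2" if "\<bar>x - x0\<bar> \<le> \<delta>"
      proof -
        have "dist (u x) (u x0) < a / 2" using that x \<delta> by (intro \<delta>0(2)) (auto simp: dist_real_def)
        then show ?thesis unfolding a_def[symmetric] dist_real_def by linarith
      qed
      show "(if x \<in> ?I then a / 2 * (1 + \<kappa>) ^ n else 0) - B \<le> u x * T x ^ n"
      proof (cases "\<bar>x - x0\<bar> \<le> \<delta>")
        case True
        have "0 \<le> u x * T x ^ n" using near[OF True] T1[OF True] a by (intro mult_nonneg_nonneg) auto
        moreover have "a / 2 * (1 + \<kappa>) ^ n \<le> u x * T x ^ n" if "x \<in> ?I"
        proof (rule mult_mono)
          have "\<bar>x - x0\<bar> \<le> \<delta> / 2" using that unfolding atLeastAtMost_iff by linarith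
          from T2[OF this] show "(1 + \<kappa>) ^ n \<le> T x ^ n" using \<kappa> by (intro power_mono) auto
        qed (use near[OF True] a \<kappa> in auto)
        ultimately show ?thesis using B(2) by (smt (verit))
      next
        case False
        have "\<bar>u x * T x ^ n\<bar> \<le> B * 1 ^ n"
          unfolding abs_mult power_abs
        proof (intro mult_mono power_mono)
          show "\<bar>T x\<bar> \<le> 1" using T3[of x] x False by linarith
        qed (use B x in \<open>simp_all\<close>)
        moreover have "x \<notin> ?I" using False \<delta>(1) unfolding atLeastAtMost_iff by linarith
        ultimately show ?thesis by (simp add: abs_le_iff del: atLeastAtMost_iff)
      qed
    qed
  qed
  obtain n where n: "(1 + \<kappa>) ^ n > 2 * B / (a * \<delta>)"
    using real_arch_pow[of "1 + \<kappa>" "2 * B / (a * \<delta>)"] \<kappa> by (metis less_add_same_cancel1)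
  then have "2 * B < (1 + \<kappa>) ^ n * (a * \<delta>)"
    using a \<delta>(1) by (simp add: pos_divide_less_eq)
  also have "\<dots> = 2 * (a / 2 * (1 + \<kappa>) ^ n * \<delta>)" by simp
  finally show False using key[of n] by linarith
qed

section \<open>Fourier series of the periodised bump\<close>

lemma summable_on_inverse_quadratic:
  fixes w :: real
  assumes "0 < w" "w \<le> 1"
  shows "(\<lambda>l::int. 1 / (1 + (w * of_int l)\<^sup>2)) summable_on UNIV"
proof (rule nonneg_bdd_above_summable_on)
  show "bdd_above (sum (\<lambda>l::int. 1 / (1 + (w * of_int l)\<^sup>2)) ` {F. F \<subseteq> UNIV \<and> finite F})"
    using sum_inverse_quadratic_le[OF assms, of _ 0] by (intro bdd_aboveI[of _ "10 / w"]) (auto simp: power_mult_distrib)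
qed auto

lemma cubic_le_quadratic:
  fixes x :: real
  shows "8 / (1 + \<bar>x\<bar>) ^ 3 \<le> 8 * (1 / (1 + x\<^sup>2))"
proof -
  have "1 + x\<^sup>2 \<le> (1 + \<bar>x\<bar>)\<^sup>2" by (simp add: power2_sum)
  also have "\<dots> \<le> (1 + \<bar>x\<bar>) ^ 3" by (intro power_increasing) auto
  finally have "1 + x\<^sup>2 \<le> (1 + \<bar>x\<bar>) ^ 3" .
  moreover have "1 + x\<^sup>2 > 0" by (simp add: add_pos_nonneg)
  ultimately show ?thesis by (simp add: frac_le)
qed

text \<open>The coefficients are the values at integers of the transform of one bump. Being centred
  at 1/2 with v < 1/2, the bump stays inside (0, 1), so it does not meet the jumps of
  \<open>frac\<close>. Cubic decay makes the series converge absolutely, and uniqueness of Fourier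
  coefficients identifies its sum with the bump.\<close>

lemma periodic_bump_fourier:
  assumes v: "0 < v" "v < 1/2"
  obtains p :: "int \<Rightarrow> complex" where "p 0 = 1" "\<And>j. norm (p j) \<le> 8 / (1 + \<bar>v * of_int j\<bar>) ^ 3"
    "\<And>y. ((\<lambda>j. p j * ee (of_int j * y)) has_sum of_real (bump ((frac y - 1/2) / v) / v)) UNIV"
proof -
  define b where "b x = bump ((x - 1/2) / v) / v" for x
  define p where "p j = FT (\<lambda>x. b x) (of_int j)" for j :: int
  have p_eq: "p j = ee (- (1/2 * of_int j)) * FT (\<lambda>x. bump x) (v * of_int j)" for j
    unfolding p_def b_def using v by (intro FT_bump_scaled) auto
  have pb: "norm (p j) \<le> 8 / (1 + \<bar>v * of_int j\<bar>) ^ 3" for j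
    unfolding p_eq using FT_bump_le[of "v * of_int j"] by (simp add: norm_mult)
  have psum: "(\<lambda>j. norm (p j)) summable_on UNIV"
  proof (rule Infinite_Sum.abs_summable_on_comparison_test')
    show "(\<lambda>j::int. 8 * (1 / (1 + (v * of_int j)\<^sup>2))) summable_on UNIV"
      using summable_on_inverse_quadratic[of v] v by (intro summable_on_cmult_right) auto
    show "norm (p j) \<le> 8 * (1 / (1 + (v * of_int j)\<^sup>2))" for j
      using pb[of j] cubic_le_quadratic[of "v * of_int j"] by (rule order_trans)
  qed
  define S where "S y = (\<Sum>\<^sub>\<infinity>j. p j * ee (of_int j * y))" for y
  have S: "((\<lambda>j. p j * ee (of_int j * y)) has_sum S y) UNIV" for y
    unfolding S_def
  proof (rule has_sum_infsum, rule abs_summable_summable)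
    show "(\<lambda>j. norm (p j * ee (of_int j * y))) summable_on UNIV"
      using psum by (simp add: norm_mult)
  qed
  define f :: "real \<Rightarrow> complex" where "f x = of_real (indicator {0..1} x)" for x
  have f: "integrable lborel f" unfolding f_def
    by (intro integrable_of_real integrable_real_indicator) auto
  note FS = FT_mult_has_sum[OF f psum S]
  \<comment> \<open>Orthogonality of the characters over one period, with f the indicator of
    [0, 1].\<close>
  have FTf: "FT f (of_int m) = (if m = 0 then 1 else 0)" for m :: int
  proof (cases "m = 0")
    case True
    have "f x * ee (- (x * 0)) = indicator {0..1} x *\<^sub>R (1::complex)" for x
      by (simp add: f_def scaleR_conv_of_real)
    then have "FT f 0 = (\<integral>x. indicator {0..1} x *\<^sub>R (1::complex) \<partial>(lborel :: real measure))"
      by (simp only: FT_def)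
    also have "\<dots> = complex_of_real 1 - complex_of_real 0"
    proof (rule integral_FTC_Icc[where F = complex_of_real])
      show "(complex_of_real has_vector_derivative 1) (at x within {0..1})" for x
        using has_vector_derivative_of_real[OF DERIV_ident[of "at x within {0..1}"]] by simp
    qed auto
    finally show ?thesis using True by simp
  next
    case False
    have "FT f (of_int m) = (\<integral>x. indicator {0..1} x *\<^sub>R ee (- of_int m * x) \<partial>lborel)"
      by (simp add: FT_def f_def scaleR_conv_of_real algebra_simps)
    also have "\<dots> = ee (- of_int m * 1) / (2 * pi * \<i> * (- of_int m)) - ee (- of_int m * 0) / (2 * pi * \<i> * (- of_int m))"
    proof (rule integral_FTC_Icc[where F = "\<lambda>x. ee (- of_int m * x) / (2 * pi * \<i> * (- of_int m))"])
      fix x :: real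
      have "((\<lambda>x. ee (- of_int m * x) / (2 * pi * \<i> * (- of_int m))) has_vector_derivative
          ((2 * pi * \<i> * complex_of_real (- of_int m)) * ee (- of_int m * x)) / (2 * pi * \<i> * (- of_int m))) (at x within {0..1})"
        by (intro has_vector_derivative_divide ee_has_vector_derivative)
      then show "((\<lambda>x. ee (- of_int m * x) / (2 * pi * \<i> * (- of_int m))) has_vector_derivative ee (- of_int m * x)) (at x within {0..1})"
        using False by simp
    qed (auto intro!: continuous_intros)
    also have "ee (- of_int m * 1) = 1" using ee_of_int[of "-m"] by simp
    finally show ?thesis using False by simp
  qed
  have FTS: "FT (\<lambda>x. f x * S x) (of_int m) = p m" for m :: int
  proof -
    have "((\<lambda>l. p l * FT f (of_int m - of_int l)) has_sum p m) UNIV \<longleftrightarrow> ((\<lambda>l. p l) has_sum p m) {m}"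
    proof (rule has_sum_cong_neutral)
      fix l assume l: "l \<in> UNIV - {m}"
      show "p l * FT f (of_int m - of_int l) = 0"
        using FTf[of "m - l"] l by (simp del: of_int_diff add: of_int_diff[symmetric])
    next
      fix l assume l: "l \<in> UNIV \<inter> {m}"
      show "p l * FT f (of_int m - of_int l) = p l"
        using FTf[of "m - l"] l by (simp del: of_int_diff add: of_int_diff[symmetric])
    qed simp
    then have "((\<lambda>l. p l * FT f (of_int m - of_int l)) has_sum p m) UNIV"
      by (simp add: has_sum_finite_iff)
    then show ?thesis using FS(3)[of "of_int m"] has_sum_unique by blast
  qed
  have contb: "continuous_on {0..1} b"
  proof -
    have "continuous_on {0..1} (\<lambda>x. (if \<bar>(x - 1/2) / v\<bar> \<le> 1 then (1 + cos (pi * ((x - 1/2) / v))) / 2 else 0) / v)"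
    proof -
      have "continuous_on ({x\<in>{0..1}. \<bar>(x - 1/2) / v\<bar> \<le> 1} \<union> {x\<in>{0..1}. \<bar>(x - 1/2) / v\<bar> \<ge> 1})
         (\<lambda>x. if \<bar>(x - 1/2) / v\<bar> \<le> 1 then (1 + cos (pi * ((x - 1/2) / v))) / 2 else (0::real))"
      proof (rule continuous_on_cases)
        show "closed {x\<in>{0..1}. \<bar>(x - 1/2) / v\<bar> \<le> 1}" "closed {x\<in>{0..1}. \<bar>(x - 1/2) / v\<bar> \<ge> 1}"
          using v by (auto intro!: closed_Collect_conj closed_Collect_le continuous_intros simp: atLeastAtMost_def atLeast_def atMost_def Collect_conj_eq simp del: abs_divide)
        show "\<forall>x. x \<in> {x\<in>{0..1}. \<bar>(x - 1/2) / v\<bar> \<le> 1} \<and> \<not> \<bar>(x - 1/2) / v\<bar> \<le> 1 \<or>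
          x \<in> {x\<in>{0..1}. \<bar>(x - 1/2) / v\<bar> \<ge> 1} \<and> \<bar>(x - 1/2) / v\<bar> \<le> 1 \<longrightarrow> (1 + cos (pi * ((x - 1/2) / v))) / 2 = 0"
        proof (intro allI impI)
          fix x assume "x \<in> {x\<in>{0..1}. \<bar>(x - 1/2) / v\<bar> \<le> 1} \<and> \<not> \<bar>(x - 1/2) / v\<bar> \<le> 1 \<or>
            x \<in> {x\<in>{0..1}. \<bar>(x - 1/2) / v\<bar> \<ge> 1} \<and> \<bar>(x - 1/2) / v\<bar> \<le> 1"
          then have "(x - 1/2) / v = 1 \<or> (x - 1/2) / v = -1" by (smt (verit) mem_Collect_eq)
          then show "(1 + cos (pi * ((x - 1/2) / v))) / 2 = 0" by (elim disjE) (simp_all only:, simp_all)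
        qed
      qed (use v in \<open>auto intro!: continuous_intros\<close>)
      moreover have "{x\<in>{0..1}. \<bar>(x - 1/2) / v\<bar> \<le> 1} \<union> {x\<in>{0..1}. \<bar>(x - 1/2) / v\<bar> \<ge> 1} = {0..1}" by auto
      ultimately show ?thesis using v by (auto intro!: continuous_intros simp del: abs_divide)
    qed
    moreover have "b x = (if \<bar>(x - 1/2) / v\<bar> \<le> 1 then (1 + cos (pi * ((x - 1/2) / v))) / 2 else 0) / v" for x
      unfolding b_def bump_def abs_le_iff by (auto simp: indicator_def)
    ultimately show ?thesis by presburger
  qed
  have b_out: "b x = 0" if "x \<notin> {0<..<1}" for x
  proof -
    have "\<bar>(x - 1/2) / v\<bar> \<ge> 1" using that v by (auto simp: field_simps abs_if)
    then show ?thesis unfolding b_def by (simp add: bump_eq_0)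
  qed
  have contS: "continuous_on A S" for A using FS(1) continuous_on_subset by blast
  have eq: "S x = b x" if x: "0 < x" "x < 1" for x
  proof -
    have "S x - of_real (b x) = 0"
    proof (rule continuous_fourier_coeffs_zero[where h = "\<lambda>x. S x - of_real (b x)" and ?x0.0 = x])
      show "continuous_on {0..1} (\<lambda>x. S x - of_real (b x))"
        by (intro continuous_intros contS contb)
      fix j :: int
      have cg: "continuous_on {0..1} (\<lambda>x. (S x - of_real (b x)) * ee (of_int j * x))"
        by (intro continuous_intros contS contb)
      have "integral {0..1} (\<lambda>x. (S x - of_real (b x)) * ee (of_int j * x))
         = (\<integral>x. indicator {0..1} x *\<^sub>R ((S x - of_real (b x)) * ee (of_int j * x)) \<partial>lborel)"
      proof -
        have i: "set_integrable lborel {0..1} (\<lambda>x. (S x - of_real (b x)) * ee (of_int j * x))"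
          unfolding set_integrable_def by (rule borel_integrable_compact[OF _ cg]) auto
        show ?thesis using set_borel_integral_eq_integral(2)[OF i] by (simp add: set_lebesgue_integral_def)
      qed
      also have "\<dots> = (\<integral>x. (f x * S x) * ee (- (x * of_int (- j))) - of_real (b x) * ee (- (x * of_int (- j))) \<partial>lborel)"
      proof (rule arg_cong[where f = "integral\<^sup>L lborel"], rule ext)
        fix x :: real
        show "indicator {0..1} x *\<^sub>R ((S x - of_real (b x)) * ee (of_int j * x)) =
          (f x * S x) * ee (- (x * of_int (- j))) - of_real (b x) * ee (- (x * of_int (- j)))"
          using b_out[of x] by (cases "x \<in> {0..1}") (auto simp: f_def algebra_simps)
      qed
      also have "\<dots> = FT (\<lambda>x. f x * S x) (of_int (- j)) - FT (\<lambda>x. of_real (b x)) (of_int (- j))"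
        unfolding FT_def
        using integrable_mult_ee[OF FS(2), of "of_int j"]
          integrable_mult_ee[OF integrable_bump_scaled[OF v(1), of "1/2"], of "of_int j"]
        by (intro Bochner_Integration.integral_diff) (simp_all only: b_def of_int_minus mult_minus_right minus_minus)
      also have "\<dots> = 0" using FTS[of "-j"] unfolding p_def by simp
      finally show "integral {0..1} (\<lambda>x. (S x - of_real (b x)) * ee (of_int j * x)) = 0" .
    qed (use x in auto)
    then show ?thesis by simp
  qed
  \<comment> \<open>Uniqueness was shown only in the open interval; the endpoint follows by
    continuity.\<close>
  have S0: "S 0 = 0"
  proof -
    have cl: "closure {0<..<1::real} = {0..1}" by (rule closure_greaterThanLessThan) simp
    have "continuous_on (closure {0<..<1}) (\<lambda>x. S x - of_real (b x))"
      unfolding cl by (intro continuous_intros contS contb)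
    then have "S 0 - of_real (b 0) = 0"
    proof (rule continuous_constant_on_closure)
      show "S x - of_real (b x) = 0" if "x \<in> {0<..<1}" for x using eq[of x] that by simp
      show "0 \<in> closure {0<..<1::real}" unfolding cl by simp
    qed
    then show ?thesis using b_out[of 0] by simp
  qed
  have "S y = of_real (bump ((frac y - 1/2) / v) / v)" for y
  proof -
    have "ee (of_int j * y) = ee (of_int j * frac y)" for j :: int
    proof -
      have "of_int j * y = of_int j * frac y + of_int (j * \<lfloor>y\<rfloor>)" by (simp add: frac_def algebra_simps)
      then show ?thesis by (simp only: ee_add ee_of_int mult_1_right)
    qed
    then have "S y = S (frac y)" by (simp add: S_def)
    also have "\<dots> = of_real (b (frac y))"
    proof (cases "frac y = 0")
      case True
      show ?thesis unfolding True using S0 b_out[of 0] by simp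
    next
      case False
      then have "0 < frac y" using frac_ge_0[of y] by linarith
      then show ?thesis using eq frac_lt_1 by blast
    qed
    finally show ?thesis by (simp add: b_def)
  qed
  note S_eq = this
  show ?thesis
  proof (rule that)
    show "p 0 = 1" using p_eq[of 0] FT_bump_0 by simp
    show "norm (p j) \<le> 8 / (1 + \<bar>v * of_int j\<bar>) ^ 3" for j by (rule pb)
    show "((\<lambda>j. p j * ee (of_int j * y)) has_sum of_real (bump ((frac y - 1/2) / v) / v)) UNIV" for y
      using S[of y] unfolding S_eq .
  qed
qed

section \<open>Primes\<close>

text \<open>Write each logarithm as the sum of the von Mangoldt function over divisors; d divides n
  div d of the integers up to n. Terms with d > n vanish, so the range may be any N \<ge> n, and the
  expansions of n! and (2n)! can be subtracted term by term.\<close>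

lemma ln_fact_eq_sum_mangoldt:
  "ln (fact n :: real) = (\<Sum>d\<in>{1..N}. mangoldt d * real (n div d))" if "n \<le> N" for N
  using that
proof (induction n)
  case (Suc n)
  have "ln (fact (Suc n) :: real) = ln (real (Suc n)) + ln (fact n)"
    by (simp add: ln_mult del: of_nat_Suc)
  also have "ln (real (Suc n)) = (\<Sum>d | d dvd Suc n. mangoldt d)"
    using mangoldt_sum[of "Suc n", where ?'a = real] by simp
  also have "\<dots> = (\<Sum>d\<in>{1..N}. if d dvd Suc n then mangoldt d else 0)"
  proof (rule sum.mono_neutral_cong_left)
    show "{d. d dvd Suc n} \<subseteq> {1..N}"
    proof
      fix d assume "d \<in> {d. d dvd Suc n}"
      then have "d \<le> Suc n" "d \<noteq> 0" using dvd_imp_le[of d "Suc n"] by (auto intro!: Nat.gr0I)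
      then show "d \<in> {1..N}" using Suc.prems by auto
    qed
  qed auto
  also have "ln (fact n :: real) = (\<Sum>d\<in>{1..N}. mangoldt d * real (n div d))"
    using Suc by simp
  finally show ?case
    unfolding sum.distrib[symmetric]
    by (auto intro!: sum.cong simp: div_Suc dvd_eq_mod_eq_0 algebra_simps)
qed auto

text \<open>A prime p contributes ln p for each power p^k \<le> N, and there are at most ln N / ln p
  such powers, so each prime contributes at most ln N.\<close>

lemma sum_mangoldt_le:
  "(\<Sum>d\<in>{1..N}. mangoldt d :: real) \<le> real (card {p. prime p \<and> p \<le> N}) * ln (real N)" for N :: nat
proof (cases "N = 0")
  case False
  define A where "A p = {k. k > 0 \<and> p ^ k \<le> N}" for p :: nat
  have finA: "finite (A p)" "real (card (A p)) * ln (real p) \<le> ln (real N)" if "prime p" for p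
  proof -
    have p: "p > 1" using that prime_gt_1_nat by blast
    have le: "real k * ln (real p) \<le> ln (real N)" if "k \<in> A p" for k
    proof -
      have "real p ^ k \<le> real N" using that by (simp add: A_def flip: of_nat_power)
      then have "ln (real p ^ k) \<le> ln (real N)" using p False by (subst ln_le_cancel_iff) auto
      then show ?thesis using p by (simp add: ln_realpow)
    qed
    define m where "m = nat \<lfloor>ln (real N) / ln (real p)\<rfloor>"
    have "A p \<subseteq> {1..m}"
    proof
      fix k assume k: "k \<in> A p"
      have "real k \<le> ln (real N) / ln (real p)" using le[OF k] p by (simp add: field_simps)
      then have "int k \<le> \<lfloor>ln (real N) / ln (real p)\<rfloor>" by (simp add: le_floor_iff)
      then show "k \<in> {1..m}" using k by (auto simp: m_def A_def)
    qed
    then show "finite (A p)" and c: "real (card (A p)) * ln (real p) \<le> ln (real N)"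
    proof -
      assume s: "A p \<subseteq> {1..m}"
      show "finite (A p)" using s finite_subset by blast
      have "card (A p) \<le> m" using card_mono[OF _ s] by simp
      then have "real (card (A p)) \<le> real m" by simp
      also have "real m \<le> ln (real N) / ln (real p)"
        unfolding m_def using p False by (simp add: of_nat_nat)
      finally show "real (card (A p)) * ln (real p) \<le> ln (real N)" using p by (simp add: field_simps)
    qed
  qed
  let ?P = "{p. prime p \<and> p \<le> N}"
  have finP: "finite ?P" by (rule finite_subset[of _ "{..N}"]) auto
  have "(\<Sum>d\<in>{1..N}. mangoldt d :: real) = (\<Sum>d\<in>(\<lambda>(p,k). p ^ k) ` (SIGMA p:?P. A p). mangoldt d)"
  proof (rule sum.mono_neutral_right)
    show "(\<lambda>(p, k). p ^ k) ` (SIGMA p:?P. A p) \<subseteq> {1..N}"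
      using prime_gt_0_nat by (auto simp: A_def Suc_le_eq)
    show "\<forall>i\<in>{1..N} - (\<lambda>(p, k). p ^ k) ` (SIGMA p:?P. A p). mangoldt i = (0::real)"
    proof
      fix d assume d: "d \<in> {1..N} - (\<lambda>(p, k). p ^ k) ` (SIGMA p:?P. A p)"
      show "mangoldt d = (0::real)"
      proof (rule ccontr)
        assume "mangoldt d \<noteq> (0::real)"
        then have "primepow d" by (auto simp: mangoldt_def split: if_splits)
        then obtain p k where pk: "prime p" "k > 0" "d = p ^ k" by (auto simp: primepow_def)
        have "p \<le> p ^ k" using pk prime_gt_0_nat[OF pk(1)] self_le_power[of p k] by auto
        then have "(p, k) \<in> (SIGMA p:?P. A p)" using pk d by (auto simp: A_def)
        then show False using d pk by force
      qed
    qed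
  qed auto
  \<comment> \<open>Summing over the image of (p, k) is at most summing over the pairs because the
    terms are nonnegative.\<close>
  also have "\<dots> \<le> (\<Sum>(p,k)\<in>(SIGMA p:?P. A p). mangoldt (p ^ k))"
    using finP finA by (intro order_trans[OF sum_image_le]) (auto simp: mangoldt_nonneg case_prod_unfold o_def)
  also have "\<dots> = (\<Sum>p\<in>?P. \<Sum>k\<in>A p. mangoldt (p ^ k))"
    using finP finA by (subst sum.Sigma) auto
  also have "\<dots> = (\<Sum>p\<in>?P. real (card (A p)) * ln (real p))"
    by (intro sum.cong refl) (auto simp: A_def)
  also have "\<dots> \<le> (\<Sum>p\<in>?P. ln (real N))"
    using finA by (intro sum_mono) auto
  finally show ?thesis by simp
qed auto

text \<open>Chebyshev: the von Mangoldt expansion of the central binomial coefficient has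
  coefficients \<open>2n div d - 2 (n div d) \<le> 1\<close>.\<close>

lemma card_primes_lower_bound:
  fixes n :: nat
  assumes n: "n > 0"
  shows "real (card {p. prime p \<and> p \<le> 2 * n}) * ln (real (2 * n)) \<ge> real n * ln 4 - ln (2 * real n)"
proof -
  have "ln (4 ^ n / (2 * real n)) \<le> ln (real ((2*n) choose n))"
    using central_binomial_lower_bound[OF n] n by (subst ln_le_cancel_iff) auto
  then have "real n * ln 4 - ln (2 * real n) \<le> ln (real ((2*n) choose n))"
    using n by (simp add: ln_div ln_realpow)
  also have "real ((2*n) choose n) = fact (2 * n) / (fact n * fact n)"
    using binomial_fact[of n "2 * n", where ?'a = real] by (simp add: mult_2)
  also have "ln \<dots> = ln (fact (2 * n)) - 2 * ln (fact n)"
    by (simp add: ln_div ln_mult)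
  also have "\<dots> = (\<Sum>d\<in>{1..2*n}. mangoldt d * real (2 * n div d)) - 2 * (\<Sum>d\<in>{1..2*n}. mangoldt d * real (n div d))"
    using ln_fact_eq_sum_mangoldt[of "2*n" "2*n"] ln_fact_eq_sum_mangoldt[of n "2*n"] by simp
  also have "\<dots> = (\<Sum>d\<in>{1..2*n}. mangoldt d * (real (2 * n div d) - 2 * real (n div d)))"
    by (simp add: sum_distrib_left sum_subtractf algebra_simps)
  also have "\<dots> \<le> (\<Sum>d\<in>{1..2*n}. mangoldt d * 1)"
  proof (intro sum_mono mult_left_mono mangoldt_nonneg)
    fix d assume d: "d \<in> {1..2*n}"
    have "2 * n div d \<le> 2 * (n div d) + 1"
    proof -
      have "2 * n = d * (2 * (n div d)) + 2 * (n mod d)"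
        by (metis mult.left_commute mult_div_mod_eq distrib_left)
      then have "2 * n div d = 2 * (n div d) + 2 * (n mod d) div d" using d by simp
      moreover have "2 * (n mod d) div d < 2" using d by (auto simp: div_less_iff_less_mult)
      ultimately show ?thesis by linarith
    qed
    then have "real (2 * n div d) \<le> real (2 * (n div d) + 1)" using of_nat_le_iff by blast
    then show "real (2 * n div d) - 2 * real (n div d) \<le> 1" by simp
  qed
  also have "\<dots> \<le> real (card {p. prime p \<and> p \<le> 2 * n}) * ln (real (2 * n))"
    using sum_mangoldt_le[of "2*n"] by simp
  finally show ?thesis .
qed

text \<open>There are at least of the order of M / ln M primes up to M, while only about
  M^(1-\<epsilon>) integers lie below the lower cutoff. Losing a power M^\<epsilon> against the true
  count is affordable later.\<close>

lemma eventually_many_primes: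
  fixes \<epsilon> :: real
  assumes \<epsilon>: "0 < \<epsilon>" "\<epsilon> < 1"
  shows "\<forall>\<^sub>F M in at_top. real (card {p. prime p \<and> M powr (1 - \<epsilon>) \<le> real p \<and> real p \<le> M}) \<ge> M powr (1 - \<epsilon>)"
proof -
  have "\<forall>\<^sub>F M::real in at_top. (M/2 - 1) * ln 4 - ln M \<ge> (2 * M powr (1 - \<epsilon>) + 1) * ln M"
    using \<epsilon> by real_asymp
  then show ?thesis
    using eventually_ge_at_top[of 4]
  proof eventually_elim
    case (elim M)
    define n where "n = nat \<lfloor>M / 2\<rfloor>"
    have n: "real n \<le> M / 2" "real n > M / 2 - 1" "n > 0" using elim unfolding n_def by linarith+
    let ?P = "{p. prime p \<and> p \<le> 2 * n}"
    let ?Q = "{p. prime p \<and> M powr (1 - \<epsilon>) \<le> real p \<and> real p \<le> M}"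
    let ?R = "{..nat \<lfloor>M powr (1 - \<epsilon>)\<rfloor>}"
    have finP: "finite ?P" by (rule finite_subset[of _ "{..2*n}"]) auto
    have finQ: "finite ?Q"
      by (rule finite_subset[of _ "{..nat \<lfloor>M\<rfloor>}"]) (auto simp: le_nat_floor)
    \<comment> \<open>Below the cutoff all integers are counted, which is still negligible.\<close>
    have "?P \<subseteq> ?Q \<union> ?R"
    proof
      fix p assume p: "p \<in> ?P"
      then have "real p \<le> real (2 * n)" by (simp only: of_nat_le_iff mem_Collect_eq)
      then have "real p \<le> M" using n by simp
      then show "p \<in> ?Q \<union> ?R" using p by (cases "M powr (1 - \<epsilon>) \<le> real p") (auto simp: le_nat_floor)
    qed
    then have "card ?P \<le> card (?Q \<union> ?R)" using finQ by (intro card_mono) auto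
    also have "\<dots> \<le> card ?Q + card ?R" by (rule card_Un_le)
    finally have "real (card ?P) \<le> real (card ?Q) + real (card ?R)" by linarith
    also have "real (card ?R) \<le> M powr (1 - \<epsilon>) + 1" by simp
    finally have c1: "real (card ?P) \<le> real (card ?Q) + M powr (1 - \<epsilon>) + 1" by simp
    have "(2 * M powr (1 - \<epsilon>) + 1) * ln M \<le> (M/2 - 1) * ln 4 - ln M" by (rule elim)
    also have "\<dots> \<le> real n * ln 4 - ln (2 * real n)"
      using n elim by (intro diff_mono mult_right_mono) auto
    also have "\<dots> \<le> real (card ?P) * ln (real (2 * n))" using card_primes_lower_bound[OF n(3)] .
    also have "\<dots> \<le> real (card ?P) * ln M" using n elim by (intro mult_left_mono) auto
    finally have "2 * M powr (1 - \<epsilon>) + 1 \<le> real (card ?P)" using elim by simp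
    then show ?case using c1 by linarith
  qed
qed

text \<open>The product of distinct primes dividing l again divides l, so it is at most |l|, while
  each factor is at least a.\<close>

lemma card_prime_divisors_le:
  fixes P :: "nat set" and l :: int
  assumes P: "finite P" "\<And>p. p \<in> P \<Longrightarrow> prime p" "\<And>p. p \<in> P \<Longrightarrow> a \<le> real p" and a: "a > 1" and l: "l \<noteq> 0"
  shows "real (card {p \<in> P. int p dvd l}) * ln a \<le> ln \<bar>real_of_int l\<bar>"
proof -
  let ?D = "{p \<in> P. int p dvd l}"
  have fin: "finite ?D" using P by auto
  have "D \<subseteq> ?D \<Longrightarrow> (\<Prod>p\<in>D. int p) dvd l" if "finite D" for D
    using that
  proof (induction D rule: finite_induct)
    case (insert p D)
    have "coprime (int p) (\<Prod>q\<in>D. int q)"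
      using insert P(2) by (intro prod_coprime_right) (auto intro!: primes_coprime)
    then show ?case using insert by (auto intro!: divides_mult)
  qed auto
  from this[OF fin] have "(\<Prod>p\<in>?D. int p) dvd l" by simp
  then have "\<bar>\<Prod>p\<in>?D. int p\<bar> \<le> \<bar>l\<bar>" using l by (intro dvd_imp_le_int)
  then have "real_of_int \<bar>\<Prod>p\<in>?D. int p\<bar> \<le> real_of_int \<bar>l\<bar>" by (simp only: of_int_le_iff)
  then have le: "(\<Prod>p\<in>?D. real p) \<le> \<bar>real_of_int l\<bar>" by (simp add: abs_prod)
  have "a ^ card ?D = (\<Prod>p\<in>?D. a)" by simp
  also have "\<dots> \<le> (\<Prod>p\<in>?D. real p)" using P a by (intro prod_mono) auto
  also note le
  finally have "ln (a ^ card ?D) \<le> ln \<bar>real_of_int l\<bar>" using a l by (subst ln_le_cancel_iff) auto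
  then show ?thesis using a by (simp add: ln_realpow)
qed

section \<open>One scale of the construction\<close>

text \<open>A bounds the l^1 norm of c, D its nonzero coefficients, and D / w^2 the quantities l^2
  |c_l|. The first conclusion is Young's inequality, the second pairs the maximum of c with the l^1
  norm of the transform, and the last two split the weight \<xi>^2 between c and f. All are proved
  for finite partial sums and pass to the limit.\<close>

lemma fourier_step:
  fixes f F :: "real \<Rightarrow> complex" and c :: "int \<Rightarrow> complex" and w D L C :: real
  assumes f: "integrable lborel f"
    and c: "(\<lambda>l. norm (c l)) summable_on UNIV"
    and F: "\<And>x. ((\<lambda>l. c l * ee (of_int l * x)) has_sum F x) UNIV"
    and c0: "c 0 = 1"
    and cD: "\<And>l. l \<noteq> 0 \<Longrightarrow> norm (c l) \<le> D / (1 + (w * of_int l)\<^sup>2)"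
    and w: "0 < w" "w \<le> 1" and D: "D \<ge> 0"
    and L: "\<And>\<xi> S. finite S \<Longrightarrow> (\<Sum>l\<in>S. norm (FT f (\<xi> - of_int l))) \<le> L"
    and C: "\<And>\<xi>. \<xi>\<^sup>2 * norm (FT f \<xi>) \<le> C"
  defines "g \<equiv> (\<lambda>x. f x * F x)" and "A \<equiv> 1 + 10 * D / w"
  shows "finite S \<Longrightarrow> (\<Sum>l\<in>S. norm (FT g (\<xi> - of_int l))) \<le> A * L"
    and "norm (FT g \<xi> - FT f \<xi>) \<le> D * L"
    and "\<xi>\<^sup>2 * norm (FT g \<xi>) \<le> 2 * D / w\<^sup>2 * L + 2 * A * C"
    and "\<xi>\<^sup>2 * norm (FT g \<xi> - FT f \<xi>) \<le> 2 * D / w\<^sup>2 * L + 2 * A * C"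
proof -
  note hs = FT_mult_has_sum(3)[OF f c F, folded g_def]
  have lim: "((\<lambda>X. \<Sum>l\<in>X. c l * FT f (\<xi> - of_int l)) \<longlongrightarrow> FT g \<xi>) (finite_subsets_at_top UNIV)" for \<xi>
    using hs[of \<xi>] by (simp add: has_sum_def)
  have fin: "\<forall>\<^sub>F X in finite_subsets_at_top UNIV. finite (X :: int set) \<and> 0 \<in> X"
    by (auto simp: eventually_finite_subsets_at_top intro!: exI[of _ "{0}"])
  \<comment> \<open>As c 0 = 1, the term l = 0 is FT f itself, so the change is the sum over l
    \<noteq> 0.\<close>
  have limd: "((\<lambda>X. \<Sum>l\<in>X - {0}. c l * FT f (\<xi> - of_int l)) \<longlongrightarrow> FT g \<xi> - FT f \<xi>) (finite_subsets_at_top UNIV)" for \<xi>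
  proof -
    have "((\<lambda>X. (\<Sum>l\<in>X. c l * FT f (\<xi> - of_int l)) - FT f \<xi>) \<longlongrightarrow> FT g \<xi> - FT f \<xi>) (finite_subsets_at_top UNIV)"
      by (intro tendsto_diff lim tendsto_const)
    moreover have "\<forall>\<^sub>F X in finite_subsets_at_top UNIV.
        (\<Sum>l\<in>X. c l * FT f (\<xi> - of_int l)) - FT f \<xi> = (\<Sum>l\<in>X - {0}. c l * FT f (\<xi> - of_int l))"
      using fin by eventually_elim (simp add: sum_diff1 c0)
    ultimately show ?thesis by (rule Lim_transform_eventually)
  qed
  have L0: "L \<ge> 0" using L[of "{}"] by simp
  have C0: "C \<ge> 0" using C[of 0] by simp
  have sumc: "(\<Sum>l\<in>X. norm (c l)) \<le> A" if X: "finite X" for X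
  proof -
    have "norm (c l) \<le> (if l = 0 then 1 else 0) + D * (1 / (1 + (w * (0 - of_int l))\<^sup>2))" for l
      using c0 cD[of l] D by (auto simp: power_mult_distrib)
    then have "(\<Sum>l\<in>X. norm (c l)) \<le> (\<Sum>l\<in>X. (if l = 0 then 1 else 0) + D * (1 / (1 + (w * (0 - of_int l))\<^sup>2)))"
      by (intro sum_mono)
    also have "\<dots> = (\<Sum>l\<in>X. if l = 0 then 1 else 0) + D * (\<Sum>l\<in>X. 1 / (1 + (w * (0 - of_int l))\<^sup>2))"
      by (simp add: sum.distrib sum_distrib_left)
    also have "\<dots> \<le> 1 + D * (10 / w)"
      using sum_inverse_quadratic_le[OF w X, of 0] D X
      by (intro add_mono mult_left_mono) (auto simp: sum.delta)
    finally show ?thesis by (simp add: A_def mult.commute)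
  qed
  have A0: "A \<ge> 0" using sumc[of "{}"] by simp
  have cl2: "norm (c l) * (of_int l)\<^sup>2 \<le> D / w\<^sup>2" for l
  proof (cases "l = 0")
    case False
    have pos: "1 + (w * of_int l)\<^sup>2 > 0" by (simp add: add_pos_nonneg)
    have "norm (c l) * (of_int l)\<^sup>2 \<le> D / (1 + (w * of_int l)\<^sup>2) * (of_int l)\<^sup>2"
      using cD[OF False] by (intro mult_right_mono) auto
    also have "\<dots> = D * ((of_int l)\<^sup>2 / (1 + (w * of_int l)\<^sup>2))" by simp
    also have "\<dots> \<le> D * (1 / w\<^sup>2)"
      using D w pos by (intro mult_left_mono) (auto simp: field_simps power_mult_distrib)
    finally show ?thesis by simp
  qed (use D in auto)
  have quad: "\<xi>\<^sup>2 * norm (\<Sum>l\<in>X. c l * FT f (\<xi> - of_int l)) \<le> 2 * D / w\<^sup>2 * L + 2 * A * C" if X: "finite X" for X \<xi>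
  proof -
    have "\<xi>\<^sup>2 * norm (\<Sum>l\<in>X. c l * FT f (\<xi> - of_int l)) \<le> \<xi>\<^sup>2 * (\<Sum>l\<in>X. norm (c l) * norm (FT f (\<xi> - of_int l)))"
      by (intro mult_left_mono sum_norm_le) (auto simp: norm_mult)
    also have "\<dots> = (\<Sum>l\<in>X. \<xi>\<^sup>2 * (norm (c l) * norm (FT f (\<xi> - of_int l))))" by (simp add: sum_distrib_left)
    also have "\<dots> \<le> (\<Sum>l\<in>X. 2 * D / w\<^sup>2 * norm (FT f (\<xi> - of_int l)) + 2 * C * norm (c l))"
    proof (rule sum_mono)
      fix l
      let ?n = "norm (FT f (\<xi> - of_int l))"
      \<comment> \<open>The part l^2 is absorbed by the decay of c, the part (\<xi> - l)^2 by the
        bound C for f.\<close>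
      have "\<xi>\<^sup>2 \<le> 2 * (of_int l)\<^sup>2 + 2 * (\<xi> - of_int l)\<^sup>2"
        using zero_le_power2[of "\<xi> - 2 * of_int l"] by (simp add: power2_eq_square algebra_simps)
      then have "\<xi>\<^sup>2 * (norm (c l) * ?n) \<le> (2 * (of_int l)\<^sup>2 + 2 * (\<xi> - of_int l)\<^sup>2) * (norm (c l) * ?n)"
        by (intro mult_right_mono) auto
      also have "\<dots> = 2 * (norm (c l) * (of_int l)\<^sup>2) * ?n + 2 * ((\<xi> - of_int l)\<^sup>2 * ?n) * norm (c l)"
        by (simp add: algebra_simps)
      also have "\<dots> \<le> 2 * (D / w\<^sup>2) * ?n + 2 * C * norm (c l)"
        by (intro add_mono mult_right_mono mult_left_mono cl2 C) auto
      finally show "\<xi>\<^sup>2 * (norm (c l) * ?n) \<le> 2 * D / w\<^sup>2 * ?n + 2 * C * norm (c l)" by simp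
    qed
    also have "\<dots> = 2 * D / w\<^sup>2 * (\<Sum>l\<in>X. norm (FT f (\<xi> - of_int l))) + 2 * C * (\<Sum>l\<in>X. norm (c l))"
      by (simp add: sum.distrib sum_distrib_left)
    also have "\<dots> \<le> 2 * D / w\<^sup>2 * L + 2 * C * A"
      using X D C0 by (intro add_mono mult_left_mono L sumc) auto
    finally show ?thesis by (simp add: algebra_simps)
  qed
  show "norm (FT g \<xi> - FT f \<xi>) \<le> D * L"
  proof (rule tendsto_upperbound[OF tendsto_norm[OF limd]])
    show "\<forall>\<^sub>F X in finite_subsets_at_top UNIV. norm (\<Sum>l\<in>X - {0}. c l * FT f (\<xi> - of_int l)) \<le> D * L"
      using fin
    proof eventually_elim
      case (elim X)
      have cD': "norm (c l) \<le> D" if "l \<noteq> 0" for l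
      proof -
        have "D / (1 + (w * of_int l)\<^sup>2) \<le> D / 1" using D by (intro divide_left_mono) (auto simp: add_pos_nonneg)
        then show ?thesis using cD[OF that] by simp
      qed
      have "norm (\<Sum>l\<in>X - {0}. c l * FT f (\<xi> - of_int l)) \<le> (\<Sum>l\<in>X - {0}. D * norm (FT f (\<xi> - of_int l)))"
        using cD' by (intro sum_norm_le) (auto simp: norm_mult intro!: mult_right_mono)
      also have "\<dots> = D * (\<Sum>l\<in>X - {0}. norm (FT f (\<xi> - of_int l)))" by (simp add: sum_distrib_left)
      also have "\<dots> \<le> D * L" using D elim by (intro mult_left_mono L) auto
      finally show ?case .
    qed
  qed simp
  show "\<xi>\<^sup>2 * norm (FT g \<xi>) \<le> 2 * D / w\<^sup>2 * L + 2 * A * C"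
  proof (rule tendsto_upperbound[OF tendsto_mult_left[OF tendsto_norm[OF lim]]])
    show "\<forall>\<^sub>F X in finite_subsets_at_top UNIV. \<xi>\<^sup>2 * norm (\<Sum>l\<in>X. c l * FT f (\<xi> - of_int l)) \<le> 2 * D / w\<^sup>2 * L + 2 * A * C"
      using fin by eventually_elim (rule quad, simp)
  qed simp
  show "\<xi>\<^sup>2 * norm (FT g \<xi> - FT f \<xi>) \<le> 2 * D / w\<^sup>2 * L + 2 * A * C"
  proof (rule tendsto_upperbound[OF tendsto_mult_left[OF tendsto_norm[OF limd]]])
    show "\<forall>\<^sub>F X in finite_subsets_at_top UNIV. \<xi>\<^sup>2 * norm (\<Sum>l\<in>X - {0}. c l * FT f (\<xi> - of_int l)) \<le> 2 * D / w\<^sup>2 * L + 2 * A * C"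
      using fin by eventually_elim (rule quad, simp)
  qed simp
  show "(\<Sum>l\<in>S. norm (FT g (\<xi> - of_int l))) \<le> A * L" if S: "finite S"
  proof (rule tendsto_upperbound)
    show "((\<lambda>X. \<Sum>m\<in>S. norm (\<Sum>l\<in>X. c l * FT f (\<xi> - of_int m - of_int l))) \<longlongrightarrow> (\<Sum>l\<in>S. norm (FT g (\<xi> - of_int l)))) (finite_subsets_at_top UNIV)"
      by (intro tendsto_sum tendsto_norm lim)
    show "\<forall>\<^sub>F X in finite_subsets_at_top UNIV. (\<Sum>m\<in>S. norm (\<Sum>l\<in>X. c l * FT f (\<xi> - of_int m - of_int l))) \<le> A * L"
      using fin
    proof eventually_elim
      case (elim X)
      have "(\<Sum>m\<in>S. norm (\<Sum>l\<in>X. c l * FT f (\<xi> - of_int m - of_int l)))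
          \<le> (\<Sum>m\<in>S. \<Sum>l\<in>X. norm (c l) * norm (FT f (\<xi> - of_int l - of_int m)))"
        by (intro sum_mono sum_norm_le) (auto simp: norm_mult algebra_simps)
      also have "\<dots> = (\<Sum>l\<in>X. norm (c l) * (\<Sum>m\<in>S. norm (FT f (\<xi> - of_int l - of_int m))))"
        by (subst sum.swap) (simp add: sum_distrib_left)
      also have "\<dots> \<le> (\<Sum>l\<in>X. norm (c l) * L)"
        using S by (intro sum_mono mult_left_mono L) auto
      also have "\<dots> = (\<Sum>l\<in>X. norm (c l)) * L" by (simp add: sum_distrib_right)
      also have "\<dots> \<le> A * L" using elim L0 by (intro mult_right_mono sumc) auto
      finally show ?case .
    qed
  qed simp
qed

section \<open>Averaging periodic bumps over primes\<close>

lemma has_sum_sum_finite: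
  fixes f :: "'a \<Rightarrow> 'b \<Rightarrow> 'c :: {topological_comm_monoid_add}"
  assumes "finite I" "\<And>i. i \<in> I \<Longrightarrow> (f i has_sum s i) A"
  shows "((\<lambda>x. \<Sum>i\<in>I. f i x) has_sum (\<Sum>i\<in>I. s i)) A"
  using assms by (induction I rule: finite_induct) (auto intro!: has_sum_add has_sum_0)

text \<open>Composition with q x + \<alpha> moves frequency j to q j, and the shift contributes only
  phases of modulus 1.\<close>

lemma has_sum_multiples:
  fixes p :: "int \<Rightarrow> complex"
  assumes q: "q > 0" and p: "((\<lambda>j. p j * ee (of_int j * (of_int q * x + \<alpha>))) has_sum s) UNIV"
  shows "((\<lambda>l. (if q dvd l then p (l div q) * ee (of_int (l div q) * \<alpha>) else 0) * ee (of_int l * x)) has_sum s) UNIV"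
proof -
  let ?h = "\<lambda>l. (if q dvd l then p (l div q) * ee (of_int (l div q) * \<alpha>) else 0) * ee (of_int l * x)"
  have "(?h has_sum s) UNIV \<longleftrightarrow> (?h has_sum s) ((\<lambda>j. q * j) ` UNIV)"
    by (rule has_sum_cong_neutral) (auto elim!: dvdE)
  also have "\<dots> \<longleftrightarrow> ((?h \<circ> (\<lambda>j. q * j)) has_sum s) UNIV"
    by (rule has_sum_reindex) (use q in \<open>auto simp: inj_on_def\<close>)
  also have "?h \<circ> (\<lambda>j. q * j) = (\<lambda>j. p j * ee (of_int j * (of_int q * x + \<alpha>)))"
    using q by (auto simp: fun_eq_iff ee_add[symmetric] algebra_simps)
  finally show ?thesis using p by simp
qed

lemma eventually_ge_powr:
  fixes a C :: real
  assumes "a > 0"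
  shows "\<forall>\<^sub>F M in at_top. C \<le> M powr a"
proof -
  have "filterlim (\<lambda>M::real. M powr a) at_top at_top" using assms by real_asymp
  then show ?thesis by (simp add: filterlim_at_top)
qed

lemma eventually_powr_less:
  fixes a C :: real
  assumes "a < 0" "C > 0"
  shows "\<forall>\<^sub>F M in at_top. M powr a < C"
proof -
  have "((\<lambda>M::real. M powr a) \<longlongrightarrow> 0) at_top" using assms(1) by real_asymp
  then show ?thesis using assms(2) by (rule order_tendstoD)
qed

text \<open>In the variable x all bumps have the same half-width w = M^-(\<tau>+2\<epsilon>), which
  is at most M^-\<epsilon> \<psi>(q). A frequency l is divisible by at most a constant times 1 +
  w|l| of the primes; one of the three powers of decay of the bump pays for this number and the
  quadratic decay remains. Division by at least M^(1-\<epsilon>) primes gives the gain.\<close>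

lemma approximation_factor:
  fixes \<psi> :: "nat \<Rightarrow> real" and \<theta> \<tau> \<epsilon> :: real
  assumes \<epsilon>: "0 < \<epsilon>" "\<epsilon> \<le> 1/2" and \<tau>: "\<tau> > 1"
    and \<psi>: "\<forall>\<^sub>F q in sequentially. \<psi> q \<ge> real q powr - (\<tau> + \<epsilon>)"
  shows "\<forall>\<^sub>F M in at_top. \<exists>(F :: real \<Rightarrow> real) (c :: int \<Rightarrow> complex).
      F \<in> borel_measurable borel \<and> (\<forall>x. F x \<ge> 0) \<and>
      (\<lambda>l. norm (c l)) summable_on UNIV \<and>
      (\<forall>x. ((\<lambda>l. c l * ee (of_int l * x)) has_sum complex_of_real (F x)) UNIV) \<and> c 0 = 1 \<and>
      (\<forall>l. l \<noteq> 0 \<longrightarrow> norm (c l) \<le> M powr (-1 + 2 * \<epsilon>) / (1 + (M powr - (\<tau> + 2 * \<epsilon>) * of_int l)\<^sup>2)) \<and>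
      (\<forall>x. F x \<noteq> 0 \<longrightarrow> (\<exists>(q::nat) (r::int). prime q \<and> M powr (1 - \<epsilon>) \<le> real q \<and> real q \<le> M \<and>
          (1 - 2 * M powr - \<epsilon>) * \<psi> q \<le> x - (of_int r - \<theta>) / real q \<and> x - (of_int r - \<theta>) / real q \<le> \<psi> q))"
proof -
  obtain q0 where q0: "\<And>q. q \<ge> q0 \<Longrightarrow> \<psi> q \<ge> real q powr - (\<tau> + \<epsilon>)"
    using \<psi> by (auto simp: eventually_sequentially)
  have "\<forall>\<^sub>F M::real in at_top. M powr (1 - \<epsilon>) \<ge> real q0"
    using \<epsilon> by (intro eventually_ge_powr) simp
  moreover have "\<forall>\<^sub>F M::real in at_top. M powr (1 + - (\<tau> + 2 * \<epsilon>)) < 1/2"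
    using \<epsilon> \<tau> by (intro eventually_powr_less) simp_all
  moreover have "\<forall>\<^sub>F M::real in at_top. M powr \<epsilon> \<ge> 16 * (\<tau> + 2)"
    using \<epsilon> by (intro eventually_ge_powr)
  moreover have "\<forall>\<^sub>F M::real in at_top. ln M \<ge> 1" by real_asymp
  moreover have "\<forall>\<^sub>F M::real in at_top. real (card {p. prime p \<and> M powr (1 - \<epsilon>) \<le> real p \<and> real p \<le> M}) \<ge> M powr (1 - \<epsilon>)"
    using \<epsilon> by (intro eventually_many_primes) auto
  ultimately show ?thesis
    using eventually_gt_at_top[of 1]
  proof eventually_elim
    case (elim M)
    define P where "P = {p::nat. prime p \<and> M powr (1 - \<epsilon>) \<le> real p \<and> real p \<le> M}"
    define w where "w = M powr - (\<tau> + 2 * \<epsilon>)"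
    define N where "N = real (card P)"
    have finP: "finite P" unfolding P_def
      by (rule finite_subset[of _ "{..nat \<lfloor>M\<rfloor>}"]) (auto simp: le_nat_floor)
    have Mpos: "M powr (1 - \<epsilon>) > 1" using elim \<epsilon> by simp
    have N: "N \<ge> M powr (1 - \<epsilon>)" "N > 0" using elim Mpos by (auto simp: N_def P_def)
    have w: "0 < w" "w \<le> 1" using elim \<epsilon> \<tau> powr_mono[of "- (\<tau> + 2 * \<epsilon>)" 0 M] by (auto simp: w_def)
    have q_pos: "q > 0" if "q \<in> P" for q using that prime_gt_0_nat by (auto simp: P_def)
    have v: "0 < real q * w" "real q * w < 1/2" if "q \<in> P" for q
    proof -
      show "0 < real q * w" using q_pos[OF that] w by simp
      have "real q * w \<le> M * w" using that w by (intro mult_right_mono) (auto simp: P_def)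
      also have "\<dots> = M powr (1 + - (\<tau> + 2 * \<epsilon>))" unfolding powr_add w_def using elim by simp
      finally show "real q * w < 1/2" using elim(2) by linarith
    qed
    define Q where "Q q p \<longleftrightarrow> p 0 = 1 \<and> (\<forall>j. norm (p j) \<le> 8 / (1 + \<bar>(real q * w) * of_int j\<bar>) ^ 3) \<and>
      (\<forall>y. ((\<lambda>j. p j * ee (of_int j * y)) has_sum of_real (bump ((frac y - 1/2) / (real q * w)) / (real q * w))) UNIV)"
      for q :: nat and p :: "int \<Rightarrow> complex"
    have "\<exists>p. Q q p" if "q \<in> P" for q
    proof (rule periodic_bump_fourier[OF v[OF that]])
      fix p :: "int \<Rightarrow> complex"
      assume p: "p 0 = 1" "\<And>j. norm (p j) \<le> 8 / (1 + \<bar>(real q * w) * of_int j\<bar>) ^ 3"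
        "\<And>y. ((\<lambda>j. p j * ee (of_int j * y)) has_sum of_real (bump ((frac y - 1/2) / (real q * w)) / (real q * w))) UNIV"
      show "\<exists>p. Q q p" unfolding Q_def by (intro exI[of _ p] conjI allI p)
    qed
    then have "\<forall>q\<in>P. \<exists>p. Q q p" by blast
    from bchoice[OF this] obtain pp where "\<forall>q\<in>P. Q q (pp q)" by blast
    then have pp: "\<And>q. q \<in> P \<Longrightarrow> pp q 0 = 1"
      "\<And>q j. q \<in> P \<Longrightarrow> norm (pp q j) \<le> 8 / (1 + \<bar>(real q * w) * of_int j\<bar>) ^ 3"
      "\<And>q y. q \<in> P \<Longrightarrow> ((\<lambda>j. pp q j * ee (of_int j * y)) has_sum of_real (bump ((frac y - 1/2) / (real q * w)) / (real q * w))) UNIV"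
      by (simp_all only: Q_def)
    \<comment> \<open>With this shift the fractional part of q x + \<alpha> equals 1/2 when x = (r -
      \<theta>)/q + \<psi>(q) - w, so the bump occupies the window from \<psi>(q) - 2w to
      \<psi>(q).\<close>
    define \<alpha> where "\<alpha> q = \<theta> - real q * \<psi> q + real q * w + 1/2" for q
    define G where "G q x = bump ((frac (real q * x + \<alpha> q) - 1/2) / (real q * w)) / (real q * w)" for q x
    define F where "F x = (\<Sum>q\<in>P. G q x) / N" for x
    define c where "c l = (\<Sum>q\<in>P. if int q dvd l then pp q (l div int q) * ee (of_int (l div int q) * \<alpha> q) else 0) / complex_of_real N" for l
    have Fsum: "((\<lambda>l. c l * ee (of_int l * x)) has_sum complex_of_real (F x)) UNIV" for x
    proof -
      have "((\<lambda>l. (if int q dvd l then pp q (l div int q) * ee (of_int (l div int q) * \<alpha> q) else 0) * ee (of_int l * x))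
          has_sum complex_of_real (G q x)) UNIV" if "q \<in> P" for q
        unfolding G_def
        by (rule has_sum_multiples) (use pp(3)[OF that, of "real q * x + \<alpha> q"] q_pos[OF that] in auto)
      from has_sum_sum_finite[OF finP this]
      have "((\<lambda>l. \<Sum>q\<in>P. (if int q dvd l then pp q (l div int q) * ee (of_int (l div int q) * \<alpha> q) else 0) * ee (of_int l * x))
          has_sum (\<Sum>q\<in>P. complex_of_real (G q x))) UNIV" .
      from has_sum_cmult_right[OF this, of "1 / complex_of_real N"]
      show ?thesis by (simp add: F_def c_def sum_distrib_right)
    qed
    have c0: "c 0 = 1" using N pp(1) by (simp add: c_def N_def)
    have cl: "norm (c l) \<le> M powr (-1 + 2 * \<epsilon>) / (1 + (w * of_int l)\<^sup>2)" if l: "l \<noteq> 0" for l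
    proof -
      define u where "u = w * \<bar>real_of_int l\<bar>"
      have u: "u > 0" using l w by (simp add: u_def)
      let ?D = "{q \<in> P. int q dvd l}"
      \<comment> \<open>Here ln |l| = ln u + (\<tau> + 2\<epsilon>) ln M is compared with (1 -
        \<epsilon>) ln M, where 1 - \<epsilon> \<ge> 1/2; the inequality ln u \<le> u removes the
        logarithm.\<close>
      have cardD: "real (card ?D) \<le> 2 * (\<tau> + 2) * (1 + u)"
      proof -
        have "real (card ?D) * ln (M powr (1 - \<epsilon>)) \<le> ln \<bar>real_of_int l\<bar>"
          by (rule card_prime_divisors_le) (use finP Mpos l in \<open>auto simp: P_def\<close>)
        also have "\<bar>real_of_int l\<bar> = u * M powr (\<tau> + 2 * \<epsilon>)"
        proof -
          have "w * M powr (\<tau> + 2 * \<epsilon>) = M powr (- (\<tau> + 2 * \<epsilon>) + (\<tau> + 2 * \<epsilon>))"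
            unfolding powr_add w_def ..
          then have "w * M powr (\<tau> + 2 * \<epsilon>) = 1" using elim by simp
          then show ?thesis by (simp add: u_def mult.commute mult.left_commute)
        qed
        also have "ln \<dots> = ln u + (\<tau> + 2 * \<epsilon>) * ln M"
          using u elim by (subst ln_mult) (auto simp: ln_powr)
        also have "\<dots> \<le> u * ln M + (\<tau> + 2) * ln M"
        proof (intro add_mono mult_right_mono)
          have "ln u \<le> u * 1" using ln_le_minus_one[OF u] by simp
          also have "\<dots> \<le> u * ln M" using u elim by (intro mult_left_mono) auto
          finally show "ln u \<le> u * ln M" .
        qed (use elim \<epsilon> in auto)
        also have "ln (M powr (1 - \<epsilon>)) = (1 - \<epsilon>) * ln M" using elim by (simp add: ln_powr)
        finally have "(real (card ?D) * (1 - \<epsilon>)) * ln M \<le> (u + (\<tau> + 2)) * ln M"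
          by (simp add: algebra_simps)
        then have "real (card ?D) * (1 - \<epsilon>) \<le> u + (\<tau> + 2)" using elim by simp
        moreover have "real (card ?D) * (1/2) \<le> real (card ?D) * (1 - \<epsilon>)" using \<epsilon> by (intro mult_left_mono) auto
        ultimately have "real (card ?D) * (1/2) \<le> u + (\<tau> + 2)" by (rule order_trans[rotated])
        then have "real (card ?D) \<le> 2 * (u + (\<tau> + 2))" by simp
        also have "\<dots> \<le> 2 * (\<tau> + 2) * (1 + u)" using \<tau> u mult_right_mono[of 1 "\<tau> + 2" u] by (simp add: algebra_simps)
        finally show ?thesis .
      qed
      have "norm (\<Sum>q\<in>P. if int q dvd l then pp q (l div int q) * ee (of_int (l div int q) * \<alpha> q) else 0)
         \<le> (\<Sum>q\<in>P. if int q dvd l then 8 / (1 + u) ^ 3 else 0)"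
      proof (rule sum_norm_le)
        fix q assume q: "q \<in> P"
        show "norm (if int q dvd l then pp q (l div int q) * ee (of_int (l div int q) * \<alpha> q) else 0) \<le> (if int q dvd l then 8 / (1 + u) ^ 3 else 0)"
        proof (cases "int q dvd l")
          case True
          then have "real q * real_of_int (l div int q) = real_of_int l"
            by (metis dvd_mult_div_cancel of_int_mult of_int_of_nat_eq)
          from arg_cong[OF this, of "\<lambda>z. w * z"] have "(real q * w) * of_int (l div int q) = w * of_int l"
            by (simp only: mult_ac)
          then have "\<bar>(real q * w) * of_int (l div int q)\<bar> = u"
            unfolding u_def using w by (simp only: abs_mult abs_of_pos)
          then show ?thesis using pp(2)[OF q, of "l div int q"] True by (simp add: norm_mult)
        qed auto
      qed
      also have "\<dots> = real (card ?D) * (8 / (1 + u) ^ 3)"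
        using finP by (simp add: sum.If_cases Int_def)
      also have "\<dots> \<le> 2 * (\<tau> + 2) * (1 + u) * (8 / (1 + u) ^ 3)"
        using u by (intro mult_right_mono cardD) auto
      also have "\<dots> = 16 * (\<tau> + 2) / (1 + u)\<^sup>2"
      proof -
        have "2 * (\<tau> + 2) * y * (8 / y ^ 3) = 16 * (\<tau> + 2) / y\<^sup>2" if "y > 0" for y
          using that by (simp add: power2_eq_square power3_eq_cube)
        from this[of "1 + u"] show ?thesis using u by simp
      qed
      also have "\<dots> \<le> 16 * (\<tau> + 2) / (1 + u\<^sup>2)"
      proof (rule divide_left_mono)
        show "1 + u\<^sup>2 \<le> (1 + u)\<^sup>2" using u by (simp add: power2_sum)
        show "0 \<le> 16 * (\<tau> + 2)" using \<tau> by simp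
        show "0 < (1 + u)\<^sup>2 * (1 + u\<^sup>2)" using u by (intro mult_pos_pos add_pos_nonneg) auto
      qed
      also have "\<dots> \<le> M powr \<epsilon> / (1 + u\<^sup>2)" using elim by (intro divide_right_mono) auto
      finally have S: "norm (\<Sum>q\<in>P. if int q dvd l then pp q (l div int q) * ee (of_int (l div int q) * \<alpha> q) else 0) \<le> M powr \<epsilon> / (1 + u\<^sup>2)" .
      have "norm (c l) = norm (\<Sum>q\<in>P. if int q dvd l then pp q (l div int q) * ee (of_int (l div int q) * \<alpha> q) else 0) / N"
        unfolding c_def using N by (simp add: norm_divide)
      \<comment> \<open>The constant is already inside M^\<epsilon>; dividing by the number of
        primes produces the exponent -1 + 2\<epsilon>.\<close>
      also have "\<dots> \<le> (M powr \<epsilon> / (1 + u\<^sup>2)) / M powr (1 - \<epsilon>)"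
        using S N Mpos by (intro frac_le) auto
      also have "\<dots> = (M powr \<epsilon> / M powr (1 - \<epsilon>)) / (1 + u\<^sup>2)" by simp
      also have "M powr \<epsilon> / M powr (1 - \<epsilon>) = M powr (-1 + 2 * \<epsilon>)" by (simp add: powr_diff[symmetric])
      also have "u\<^sup>2 = (w * of_int l)\<^sup>2" by (simp add: u_def power_mult_distrib)
      finally show ?thesis .
    qed
    have csum: "(\<lambda>l. norm (c l)) summable_on UNIV"
    proof (rule Infinite_Sum.abs_summable_on_comparison_test')
      show "(\<lambda>l::int. (1 + M powr (-1 + 2 * \<epsilon>)) * (1 / (1 + (w * of_int l)\<^sup>2))) summable_on UNIV"
        using summable_on_inverse_quadratic[OF w] by (intro summable_on_cmult_right)
      show "norm (c l) \<le> (1 + M powr (-1 + 2 * \<epsilon>)) * (1 / (1 + (w * of_int l)\<^sup>2))" for l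
      proof (cases "l = 0")
        case False
        have "M powr (-1 + 2 * \<epsilon>) / (1 + (w * of_int l)\<^sup>2) \<le> (1 + M powr (-1 + 2 * \<epsilon>)) / (1 + (w * of_int l)\<^sup>2)"
          by (intro divide_right_mono) auto
        then show ?thesis using cl[OF False] by simp
      qed (simp add: c0)
    qed
    have supp: "\<exists>(q::nat) (r::int). prime q \<and> M powr (1 - \<epsilon>) \<le> real q \<and> real q \<le> M \<and>
          (1 - 2 * M powr - \<epsilon>) * \<psi> q \<le> x - (of_int r - \<theta>) / real q \<and> x - (of_int r - \<theta>) / real q \<le> \<psi> q" if "F x \<noteq> 0" for x
    proof -
      have "(\<Sum>q\<in>P. G q x) \<noteq> 0" using that unfolding F_def by auto
      then obtain q where q: "q \<in> P" "G q x \<noteq> 0"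
        using sum.neutral[of P "\<lambda>q. G q x"] by blast
      define y where "y = real q * x + \<alpha> q"
      define r where "r = \<lfloor>y\<rfloor>"
      have "\<bar>(frac y - 1/2) / (real q * w)\<bar> < 1"
      proof (rule ccontr)
        assume "\<not> ?thesis"
        then have "bump ((frac y - 1/2) / (real q * w)) = 0" by (intro bump_eq_0) (simp only: not_less)
        then show False using q(2) unfolding G_def y_def[symmetric] by simp
      qed
      then have "\<bar>frac y - 1/2\<bar> < real q * w" using v(1)[OF q(1)] by (simp add: abs_divide pos_divide_less_eq)
      moreover have "frac y - 1/2 = real q * (x - (of_int r - \<theta>) / real q - \<psi> q + w)"
      proof -
        have 1: "frac y = y - of_int r" by (simp add: frac_def r_def)
        have 2: "real q * (x - R / real q - \<psi> q + w) = real q * x - R - real q * \<psi> q + real q * w" for R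
          using q_pos[OF q(1)] by (simp add: distrib_left right_diff_distrib)
        show ?thesis unfolding 1 2 unfolding y_def \<alpha>_def by simp
      qed
      ultimately have "\<bar>real q * (x - (of_int r - \<theta>) / real q - \<psi> q + w)\<bar> < real q * w" by simp
      then have "\<bar>x - (of_int r - \<theta>) / real q - \<psi> q + w\<bar> < w"
        using q_pos[OF q(1)] by (simp add: abs_mult)
      then have x: "\<psi> q - 2 * w \<le> x - (of_int r - \<theta>) / real q" "x - (of_int r - \<theta>) / real q \<le> \<psi> q" by linarith+
      \<comment> \<open>As q \<le> M, the lower bound on \<psi> gives \<psi>(q) \<ge>
        M^-(\<tau>+\<epsilon>); the second \<epsilon> in w makes the window thin relative to
        \<psi>(q).\<close>
      have "w = M powr (- \<epsilon> + - (\<tau> + \<epsilon>))" unfolding w_def by (rule arg_cong[where f = "\<lambda>t. M powr t"]) simp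
      also have "\<dots> = M powr - \<epsilon> * M powr - (\<tau> + \<epsilon>)" by (rule powr_add)
      also have "\<dots> \<le> M powr - \<epsilon> * \<psi> q"
      proof (intro mult_left_mono)
        have "real q0 \<le> real q" using q(1) elim by (auto simp: P_def)
        then have "\<psi> q \<ge> real q powr - (\<tau> + \<epsilon>)" by (intro q0) simp
        moreover have "real q powr - (\<tau> + \<epsilon>) \<ge> M powr - (\<tau> + \<epsilon>)"
          using q(1) q_pos[OF q(1)] \<epsilon> \<tau> by (intro powr_mono2') (auto simp: P_def)
        ultimately show "M powr - (\<tau> + \<epsilon>) \<le> \<psi> q" by linarith
      qed auto
      finally have "(1 - 2 * M powr - \<epsilon>) * \<psi> q \<le> \<psi> q - 2 * w" by (simp add: algebra_simps)
      then show ?thesis using x q(1) unfolding P_def by (intro exI[of _ q] exI[of _ r]) auto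
    qed
    have meas: "F \<in> borel_measurable borel"
    proof -
      have [measurable]: "(\<lambda>x::real. frac x) \<in> borel_measurable borel"
        unfolding frac_def by measurable
      show ?thesis unfolding F_def G_def by measurable
    qed
    have nn: "F x \<ge> 0" for x
      unfolding F_def G_def using N w by (intro divide_nonneg_nonneg sum_nonneg bump_nonneg mult_nonneg_nonneg) auto
    show ?case
    proof (intro exI[of _ F] exI[of _ c] conjI allI impI)
      show "norm (c l) \<le> M powr (-1 + 2 * \<epsilon>) / (1 + (M powr - (\<tau> + 2 * \<epsilon>) * of_int l)\<^sup>2)" if "l \<noteq> 0" for l
        using cl[OF that] unfolding w_def .
    qed (fact meas nn csum Fsum c0 supp)+
  qed
qed

section \<open>The limit measure\<close>

text \<open>After normalisation the densities form a tight sequence of probability measures. Along a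
  weakly convergent subsequence the characteristic functions converge pointwise, so the decay
  survives; the factor 2 comes from normalising masses that are at least 1/2. Each closed
  \<open>K n\<close> keeps full mass, as a continuous test function vanishing on it shows.\<close>

lemma weak_limit_fourier_decay:
  fixes f :: "nat \<Rightarrow> real \<Rightarrow> real" and K :: "nat \<Rightarrow> real set" and a b B \<sigma> :: real
  assumes ab: "a < b"
    and nn: "\<And>n x. f n x \<ge> 0"
    and int: "\<And>n. integrable lborel (f n)"
    and mass: "\<And>n. (\<integral>x. f n x \<partial>lborel) \<ge> 1/2"
    and out: "\<And>n x. x \<notin> {a..b} \<Longrightarrow> f n x = 0"
    and K: "\<And>n. closed (K n)"
    and fK: "\<And>m n x. n \<le> m \<Longrightarrow> x \<notin> K n \<Longrightarrow> f m x = 0"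
    and decay: "\<And>n \<xi>. norm (FT (\<lambda>x. complex_of_real (f n x)) \<xi>) \<le> B * (1 + \<bar>\<xi>\<bar>) powr - \<sigma>"
  shows "\<exists>\<mu>. sets \<mu> = sets borel \<and> finite_measure \<mu> \<and> emeasure \<mu> (space \<mu>) \<noteq> 0 \<and>
     emeasure \<mu> (UNIV - (\<Inter>n. K n)) = 0 \<and> (\<forall>\<xi>. norm (fourier_transform \<mu> \<xi>) \<le> 2 * B * (1 + \<bar>\<xi>\<bar>) powr - \<sigma>)"
proof -
  define m where "m n = (\<integral>x. f n x \<partial>lborel)" for n
  define \<mu> where "\<mu> n = density lborel (\<lambda>x. ennreal (f n x / m n))" for n
  have m: "m n \<ge> 1/2" "m n > 0" for n using mass[of n] by (auto simp: m_def)
  have fm [measurable]: "f n \<in> borel_measurable borel" for n using int[of n] by auto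
  have tot: "(\<integral>\<^sup>+x. ennreal (f n x / m n) \<partial>lborel) = 1" for n
  proof -
    have "(\<integral>\<^sup>+x. ennreal (f n x / m n) \<partial>lborel) = ennreal (\<integral>x. f n x / m n \<partial>lborel)"
      using int[of n] nn m[of n] by (intro nn_integral_eq_integral) auto
    also have "(\<integral>x. f n x / m n \<partial>lborel) = 1" using m[of n] by (simp add: m_def)
    finally show ?thesis by simp
  qed
  have prob: "prob_space (\<mu> n)" for n
  proof
    show "emeasure (\<mu> n) (space (\<mu> n)) = 1"
      using tot[of n] by (simp add: \<mu>_def emeasure_density)
  qed
  have rd: "real_distribution (\<mu> n)" for n
    using prob[of n] by (simp add: real_distribution_def real_distribution_axioms_def \<mu>_def)
  have dens: "(\<integral>x. g x \<partial>\<mu> n) = (\<integral>x. (f n x / m n) *\<^sub>R g x \<partial>lborel)"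
    if [measurable]: "g \<in> borel_measurable borel" for g :: "real \<Rightarrow> 'b::{banach, second_countable_topology}" and n
    unfolding \<mu>_def using nn m[of n] by (intro integral_density) auto
  have "tight \<mu>"
    unfolding tight_def
  proof (intro conjI allI impI rd)
    fix e :: real assume e: "e > 0"
    \<comment> \<open>Tightness is formulated with half-open intervals, so the left end is moved to
      keep the point a.\<close>
    have "emeasure (\<mu> n) {a - 1<..b} = 1" for n
    proof -
      have "emeasure (\<mu> n) {a - 1<..b} = (\<integral>\<^sup>+x. ennreal (f n x / m n) * indicator {a - 1<..b} x \<partial>lborel)"
        unfolding \<mu>_def by (rule emeasure_density) auto
      also have "\<dots> = (\<integral>\<^sup>+x. ennreal (f n x / m n) \<partial>lborel)"
      proof (rule nn_integral_cong)
        fix x :: real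
        show "ennreal (f n x / m n) * indicator {a - 1<..b} x = ennreal (f n x / m n)"
          using out[of x n] by (cases "x \<in> {a..b}") (auto simp: indicator_def)
      qed
      finally show ?thesis by (simp add: tot)
    qed
    then have "measure (\<mu> n) {a - 1<..b} = 1" for n by (simp add: measure_def)
    then show "\<exists>a b. a < b \<and> (\<forall>n. 1 - e < measure (\<mu> n) {a<..b})"
      using ab e by (intro exI[of _ "a - 1"] exI[of _ b]) auto
  qed
  from tight_imp_convergent_subsubsequence[OF this strict_mono_id] obtain r M where
    r: "strict_mono r" and M: "real_distribution M" and conv: "weak_conv_m (\<mu> \<circ> id \<circ> r) M"
    by blast
  have conv: "weak_conv_m (\<lambda>k. \<mu> (r k)) M" using conv by (simp add: o_def)
  interpret M: real_distribution M by fact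
  have char_\<mu>: "char (\<mu> n) (- (2 * pi * \<xi>)) = FT (\<lambda>x. complex_of_real (f n x)) \<xi> / m n" for n \<xi>
  proof -
    have "char (\<mu> n) (- (2 * pi * \<xi>)) = (\<integral>x. (f n x / m n) *\<^sub>R iexp (- (2 * pi * \<xi>) * x) \<partial>lborel)"
      unfolding char_def by (rule dens) measurable
    also have "\<dots> = (\<integral>x. (complex_of_real (f n x) * ee (- (x * \<xi>))) / m n \<partial>lborel)"
      by (rule arg_cong[where f = "integral\<^sup>L lborel"])
         (auto simp: fun_eq_iff ee_def cis_conv_exp scaleR_conv_of_real algebra_simps)
    finally show ?thesis by (simp add: FT_def)
  qed
  have FTM: "fourier_transform M \<xi> = char M (- (2 * pi * \<xi>))" for \<xi>
    unfolding fourier_transform_def char_def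
    by (rule arg_cong[where f = "integral\<^sup>L M"]) (auto simp: fun_eq_iff algebra_simps)
  have bound: "norm (fourier_transform M \<xi>) \<le> 2 * B * (1 + \<bar>\<xi>\<bar>) powr - \<sigma>" for \<xi>
  proof (rule tendsto_upperbound)
    show "(\<lambda>k. norm (char (\<mu> (r k)) (- (2 * pi * \<xi>)))) \<longlonglongrightarrow> norm (fourier_transform M \<xi>)"
      unfolding FTM by (intro tendsto_norm levy_continuity1 rd M conv)
    show "\<forall>\<^sub>F k in sequentially. norm (char (\<mu> (r k)) (- (2 * pi * \<xi>))) \<le> 2 * B * (1 + \<bar>\<xi>\<bar>) powr - \<sigma>"
    proof (rule always_eventually, rule allI)
      fix k
      let ?N = "norm (FT (\<lambda>x. complex_of_real (f (r k) x)) \<xi>)"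
      have "norm (char (\<mu> (r k)) (- (2 * pi * \<xi>))) = ?N / m (r k)"
        unfolding char_\<mu> using m(2)[of "r k"] by (simp add: norm_divide)
      also have "\<dots> \<le> ?N / (1/2)" using m[of "r k"] by (intro divide_left_mono) auto
      also have "\<dots> \<le> 2 * B * (1 + \<bar>\<xi>\<bar>) powr - \<sigma>" using decay[of "r k" \<xi>] by simp
      finally show "norm (char (\<mu> (r k)) (- (2 * pi * \<xi>))) \<le> 2 * B * (1 + \<bar>\<xi>\<bar>) powr - \<sigma>" .
    qed
  qed simp
  have null: "UNIV - K n \<in> null_sets M" for n
  proof -
    \<comment> \<open>The distance \<open>infdist\<close> to the empty set is 0 by convention, so
      the test function below would not detect an empty \<open>K n\<close>.\<close>
    have ne: "K n \<noteq> {}"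
    proof
      assume "K n = {}"
      then have "f n = (\<lambda>x. 0)" using fK[of n n] by auto
      then show False using m[of n] by (simp add: m_def)
    qed
    \<comment> \<open>Bounded, continuous, and zero exactly on the closed set \<open>K n\<close>;
      its integral is 0 for all late densities, hence in the limit.\<close>
    define g where "g x = min 1 (infdist x (K n))" for x
    have gc: "isCont g x" for x unfolding g_def by (intro continuous_intros)
    have [measurable]: "g \<in> borel_measurable borel"
      by (intro borel_measurable_continuous_onI continuous_at_imp_continuous_on) (simp add: gc)
    have g01: "0 \<le> g x" "g x \<le> 1" for x by (auto simp: g_def infdist_nonneg)
    have "(\<lambda>k. \<integral>x. g x \<partial>\<mu> (r k)) \<longlonglongrightarrow> (\<integral>x. g x \<partial>M)"
      by (rule weak_conv_imp_integral_bdd_continuous_conv[OF rd M conv gc, of 1]) (use g01 in auto)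
    moreover have "(\<lambda>k. \<integral>x. g x \<partial>\<mu> (r k)) \<longlonglongrightarrow> 0"
    proof (rule tendsto_eventually)
      show "\<forall>\<^sub>F k in sequentially. (\<integral>x. g x \<partial>\<mu> (r k)) = 0"
        using eventually_ge_at_top[of n]
      proof eventually_elim
        case (elim k)
        have "n \<le> r k" using elim strict_mono_imp_increasing[OF r, of k] by linarith
        then have z: "(f (r k) x / m (r k)) *\<^sub>R g x = 0" for x
          using fK[of n "r k" x] by (cases "x \<in> K n") (auto simp: g_def)
        have "(\<integral>x. g x \<partial>\<mu> (r k)) = (\<integral>x. (f (r k) x / m (r k)) *\<^sub>R g x \<partial>lborel)"
          by (rule dens) measurable
        also have "\<dots> = 0" by (simp only: z Bochner_Integration.integral_zero)
        finally show ?case .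
      qed
    qed
    ultimately have "(\<integral>x. g x \<partial>M) = 0" by (rule LIMSEQ_unique)
    moreover have "integrable M g"
      by (rule M.integrable_const_bound[of _ 1]) (use g01 in auto)
    ultimately have "AE x in M. g x = 0"
      using g01 integral_nonneg_eq_0_iff_AE[of M g] by auto
    then have "AE x in M. x \<in> K n"
    proof eventually_elim
      case (elim x)
      then have "infdist x (K n) = 0" by (auto simp: g_def min_def split: if_splits)
      then show ?case using in_closed_iff_infdist_zero[OF K ne] by blast
    qed
    then have "AE x in M. x \<notin> UNIV - K n" by simp
    moreover have "UNIV - K n \<in> sets M" using K[of n] by (auto simp: borel_closed)
    ultimately show ?thesis by (simp add: AE_iff_null_sets)
  qed
  have "(\<Union>n. UNIV - K n) \<in> null_sets M" by (rule null_sets_UN) (rule null)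
  moreover have "(\<Union>n. UNIV - K n) = UNIV - (\<Inter>n. K n)" by auto
  ultimately have "emeasure M (UNIV - (\<Inter>n. K n)) = 0" by auto
  then show ?thesis
    using bound M.emeasure_space_1 M.finite_measure_axioms
    by (intro exI[of _ M]) auto
qed

section \<open>Exactness\<close>

lemma lambda_exp_upper:
  assumes "lambda_exp \<psi> \<tau>" "\<And>q. \<psi> q > 0" "t < \<tau>"
  shows "\<forall>\<^sub>F q in sequentially. \<psi> q \<le> real q powr - t"
proof -
  have "\<forall>\<^sub>F q in sequentially. - ln (\<psi> q) / ln (real q) > t"
    using order_tendstoD(1)[OF assms(1)[unfolded lambda_exp_def] assms(3)] .
  then show ?thesis using eventually_gt_at_top[of 1]
  proof eventually_elim
    case (elim q)
    then have "ln (\<psi> q) \<le> - t * ln (real q)" by (simp add: field_simps)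
    then have "exp (ln (\<psi> q)) \<le> exp (- t * ln (real q))" by simp
    then show ?case using assms(2)[of q] elim by (simp add: powr_def)
  qed
qed

lemma lambda_exp_lower:
  assumes "lambda_exp \<psi> \<tau>" "\<And>q. \<psi> q > 0" "\<tau> < t"
  shows "\<forall>\<^sub>F q in sequentially. \<psi> q \<ge> real q powr - t"
proof -
  have "\<forall>\<^sub>F q in sequentially. - ln (\<psi> q) / ln (real q) < t"
    using order_tendstoD(2)[OF assms(1)[unfolded lambda_exp_def] assms(3)] .
  then show ?thesis using eventually_gt_at_top[of 1]
  proof eventually_elim
    case (elim q)
    then have "ln (\<psi> q) \<ge> - t * ln (real q)" by (simp add: field_simps)
    then have "exp (ln (\<psi> q)) \<ge> exp (- t * ln (real q))" by simp
    then show ?case using assms(2)[of q] elim by (simp add: powr_def)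
  qed
qed

text \<open>For g < 1 the nearest integer to \<theta> q solves the inequality for every q, since its
  error is at most 1 / (2q). Pairs are counted whether reduced or not, so different q give different
  solutions.\<close>

lemma finite_good_approximations_imp_ge_1:
  fixes \<theta> g :: real
  assumes "finite {(p :: int, q :: int). q > 0 \<and> \<bar>\<theta> - of_int p / of_int q\<bar> \<le> of_int q powr - g}"
  shows "g \<ge> 1"
proof (rule ccontr)
  assume g: "\<not> g \<ge> 1"
  let ?S = "{(p :: int, q :: int). q > 0 \<and> \<bar>\<theta> - of_int p / of_int q\<bar> \<le> of_int q powr - g}"
  have "(round (\<theta> * real (Suc n)), int (Suc n)) \<in> ?S" for n
  proof -
    define N where "N = real (Suc n)"
    have N: "N \<ge> 1" by (simp add: N_def)
    have "\<bar>\<theta> - of_int (round (\<theta> * N)) / N\<bar> * N = \<bar>(\<theta> - of_int (round (\<theta> * N)) / N) * N\<bar>"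
      using N by (simp add: abs_mult)
    also have "\<dots> = \<bar>of_int (round (\<theta> * N)) - \<theta> * N\<bar>"
      using N by (simp add: left_diff_distrib abs_minus_commute)
    also have "\<dots> \<le> 1/2" by (rule of_int_round_abs_le)
    finally have "\<bar>\<theta> - of_int (round (\<theta> * N)) / N\<bar> \<le> 1 / N" using N by (simp add: pos_le_divide_eq)
    also have "\<dots> = N powr - 1" using N by (simp add: powr_minus divide_inverse)
    also have "\<dots> \<le> N powr - g" using g N by (intro powr_mono) auto
    finally show ?thesis by (simp add: N_def)
  qed
  then have "(\<lambda>n::nat. (round (\<theta> * real (Suc n)), int (Suc n))) ` UNIV \<subseteq> ?S" by blast
  moreover have "infinite ((\<lambda>n::nat. (round (\<theta> * real (Suc n)), int (Suc n))) ` UNIV)"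
    by (intro range_inj_infinite) (auto simp: inj_def)
  ultimately show False using assms finite_subset by blast
qed

lemma dioph_exponent_ge_1: "dioph_exponent \<theta> \<ge> 1"
  unfolding dioph_exponent_def
  by (rule Inf_greatest) (auto dest: finite_good_approximations_imp_ge_1)

text \<open>Outside a finite set of pairs the bound holds with constant 1. On that set \<theta> n -
  p is nonzero by irrationality, and c is the least absolute value occurring there.\<close>

lemma dioph_exponent_lower_bound:
  assumes irr: "\<theta> \<notin> \<rat>" and \<gamma>: "dioph_exponent \<theta> = ereal \<gamma>" and g: "\<gamma> < g"
  shows "\<exists>c>0. c \<le> 1 \<and> (\<forall>(n::int) (p::int). n > 0 \<longrightarrow> c * of_int n powr (1 - g) \<le> \<bar>\<theta> * of_int n - of_int p\<bar>)"
proof -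
  have "dioph_exponent \<theta> < ereal g" using \<gamma> g by simp
  then obtain g' where g': "g' < g" and
    fin: "finite {(p :: int, q :: int). q > 0 \<and> \<bar>\<theta> - of_int p / of_int q\<bar> \<le> of_int q powr - g'}"
    unfolding dioph_exponent_def Inf_less_iff by auto
  define S where "S = {(p :: int, q :: int). q > 0 \<and> \<bar>\<theta> - of_int p / of_int q\<bar> \<le> of_int q powr - g'}"
  have g1: "g' \<ge> 1" using finite_good_approximations_imp_ge_1[OF fin] .
  \<comment> \<open>Inserting 1 covers an empty exceptional set and ensures c \<le> 1.\<close>
  define c where "c = Min (insert 1 ((\<lambda>(p, q). \<bar>\<theta> * of_int q - of_int p\<bar>) ` S))"
  have finS: "finite S" using fin unfolding S_def .
  have nz: "\<theta> * of_int q - of_int p \<noteq> 0" if "q > 0" for p q :: int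
  proof
    assume "\<theta> * of_int q - of_int p = 0"
    then have "\<theta> = of_int p / of_int q" using that by (simp add: field_simps)
    then show False using irr by simp
  qed
  have c: "c > 0" "c \<le> 1"
    unfolding c_def using finS nz by (auto simp: S_def)
  have "c * of_int n powr (1 - g) \<le> \<bar>\<theta> * of_int n - of_int p\<bar>" if n: "n > 0" for n p :: int
  proof (cases "(p, n) \<in> S")
    case True
    have "c \<le> \<bar>\<theta> * of_int n - of_int p\<bar>"
      unfolding c_def using finS True by (intro Min_le) force+
    moreover have "of_int n powr (1 - g) \<le> (1::real)"
      using n g' g1 powr_mono[of "1 - g" 0 "real_of_int n"] by simp
    then have "c * of_int n powr (1 - g) \<le> c" using c by (simp add: mult_left_le)
    ultimately show ?thesis by linarith
  next
    case False
    then have "of_int n powr - g' < \<bar>\<theta> - of_int p / of_int n\<bar>" using n by (simp add: S_def)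
    then have "of_int n powr - g' * of_int n \<le> \<bar>\<theta> - of_int p / of_int n\<bar> * of_int n"
      using n by (intro mult_right_mono) auto
    also have "\<dots> = \<bar>\<theta> * of_int n - of_int p\<bar>"
      using n by (subst abs_mult_pos) (auto simp: left_diff_distrib)
    also have "of_int n powr - g' * of_int n = (of_int n :: real) powr (1 - g')"
      using n powr_add[of "of_int n" "- g'" 1] by (simp add: add.commute)
    finally have "of_int n powr (1 - g') \<le> \<bar>\<theta> * of_int n - of_int p\<bar>" .
    moreover have "c * of_int n powr (1 - g) \<le> 1 * of_int n powr (1 - g')"
      using c n g' by (intro mult_mono powr_mono) auto
    ultimately show ?thesis by simp
  qed
  then show ?thesis using c by blast
qed

text \<open>Clearing denominators leaves (r q' - r' q) - \<theta> (q' - q). If \<theta> = 0 or q =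
  q', this is a nonzero integer. Otherwise the Diophantine bound applies with n = q' - q.\<close>

lemma separation_of_shifted_fractions:
  fixes \<theta> \<gamma> g :: real
  assumes cases: "(\<theta> = 0 \<and> \<gamma> = 1) \<or> (\<theta> \<notin> \<rat> \<and> dioph_exponent \<theta> = ereal \<gamma>)" and g: "\<gamma> < g"
  shows "\<exists>c>0. \<forall>(r::int) (q::nat) (r'::int) (q'::nat). 0 < q \<longrightarrow> q \<le> q' \<longrightarrow>
     coprime r (int q) \<longrightarrow> coprime r' (int q') \<longrightarrow> (r, q) \<noteq> (r', q') \<longrightarrow>
     c * real q' powr (1 - g) \<le> \<bar>(of_int r - \<theta>) / real q - (of_int r' - \<theta>) / real q'\<bar> * (real q * real q')"
proof -
  have g1: "g \<ge> 1"
    using cases g dioph_exponent_ge_1[of \<theta>] by (auto simp: one_ereal_def)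
  have le1: "real q' powr (1 - g) \<le> 1" if "q' > 0" for q' :: nat
    using that g1 powr_mono[of "1 - g" 0 "real q'"] by simp
  have num: "\<bar>(of_int r - \<theta>) / real q - (of_int r' - \<theta>) / real q'\<bar> * (real q * real q')
      = \<bar>of_int (r * int q' - r' * int q) - \<theta> * of_int (int q' - int q)\<bar>" if "0 < q" "0 < q'" for r r' q q'
  proof -
    have "\<bar>(of_int r - \<theta>) / real q - (of_int r' - \<theta>) / real q'\<bar> * (real q * real q')
        = \<bar>((of_int r - \<theta>) / real q - (of_int r' - \<theta>) / real q') * (real q * real q')\<bar>"
      by (simp add: abs_mult)
    also have "((of_int r - \<theta>) / real q - (of_int r' - \<theta>) / real q') * (real q * real q')
        = of_int (r * int q' - r' * int q) - \<theta> * of_int (int q' - int q)"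
      using that by (simp add: field_simps)
    finally show ?thesis .
  qed
  obtain c where c: "c > 0" "c \<le> 1" and
    cb: "\<theta> = 0 \<or> (\<forall>(n::int) (p::int). n > 0 \<longrightarrow> c * of_int n powr (1 - g) \<le> \<bar>\<theta> * of_int n - of_int p\<bar>)"
    using cases dioph_exponent_lower_bound[of \<theta> \<gamma> g] g by (metis less_numeral_extra(1) order_refl)
  have "c * real q' powr (1 - g) \<le> \<bar>(of_int r - \<theta>) / real q - (of_int r' - \<theta>) / real q'\<bar> * (real q * real q')"
    if q: "0 < q" "q \<le> q'" and co: "coprime r (int q)" "coprime r' (int q')" and ne: "(r, q) \<noteq> (r', q')"
    for r r' :: int and q q' :: nat
  proof -
    have q': "q' > 0" using q by simp
    have c1: "c * real q' powr (1 - g) \<le> 1" using c le1[OF q'] by (simp add: mult_le_one)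
    have int1: "1 \<le> \<bar>real_of_int z\<bar>" if "z \<noteq> 0" for z :: int
      using that by (metis of_int_abs of_int_1_le_iff zero_less_abs_iff int_one_le_iff_zero_less)
    show ?thesis
    proof (cases "\<theta> = 0")
      case True
      \<comment> \<open>For \<theta> = 0, two different reduced fractions have different
        values.\<close>
      have "r * int q' - r' * int q \<noteq> 0"
      proof
        assume "r * int q' - r' * int q = 0"
        then have e: "r * int q' = r' * int q" by simp
        have "int q dvd int q'" using e co(1)
          by (metis coprime_commute coprime_dvd_mult_right_iff dvd_triv_right)
        moreover have "int q' dvd int q" using e co(2)
          by (metis coprime_commute coprime_dvd_mult_right_iff dvd_triv_right)
        ultimately have "q = q'" by (simp add: dvd_antisym)
        then show False using e ne q by simp
      qed
      from int1[OF this] show ?thesis using num[OF q(1) q', of r r'] True c1 by simp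
    next
      case False
      show ?thesis
      proof (cases "q = q'")
        case True
        then have "r * int q' - r' * int q \<noteq> 0" using ne q by (simp add: left_diff_distrib[symmetric])
        from int1[OF this] show ?thesis using num[OF q(1) q', of r r'] True c1 by simp
      next
        case neq: False
        define n where "n = int q' - int q"
        have n: "n > 0" "n \<le> int q'" using neq q by (auto simp: n_def)
        \<comment> \<open>Here n \<le> q' and the exponent 1 - g is not positive.\<close>
        have "real q' powr (1 - g) \<le> of_int n powr (1 - g)"
          using n g1 by (intro powr_mono2') auto
        then have "c * real q' powr (1 - g) \<le> c * of_int n powr (1 - g)" using c by (intro mult_left_mono) auto
        also have "\<dots> \<le> \<bar>\<theta> * of_int n - of_int (r * int q' - r' * int q)\<bar>"
          using cb False n(1) by blast
        also have "\<dots> = \<bar>of_int (r * int q' - r' * int q) - \<theta> * of_int n\<bar>" by (rule abs_minus_commute)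
        finally show ?thesis using num[OF q(1) q', of r r'] by (simp add: n_def)
      qed
    qed
  qed
  then show ?thesis using c by blast
qed

lemma finite_approximations_below:
  fixes \<psi> :: "nat \<Rightarrow> real"
  shows "finite {(r :: int, q :: nat). q < Q \<and> q > 0 \<and> \<bar>x - (of_int r - \<theta>) / real q\<bar> \<le> \<psi> q}"
proof (rule finite_subset)
  show "{(r :: int, q :: nat). q < Q \<and> q > 0 \<and> \<bar>x - (of_int r - \<theta>) / real q\<bar> \<le> \<psi> q}
    \<subseteq> (\<Union>q<Q. {\<lfloor>real q * (x - \<psi> q) + \<theta>\<rfloor>..\<lceil>real q * (x + \<psi> q) + \<theta>\<rceil>} \<times> {q})"
  proof clarify
    fix r :: int and q :: nat
    assume q: "q < Q" "q > 0" and a: "\<bar>x - (of_int r - \<theta>) / real q\<bar> \<le> \<psi> q"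
    have "(of_int r - \<theta>) / real q \<le> x + \<psi> q" "x - \<psi> q \<le> (of_int r - \<theta>) / real q" using a by linarith+
    then have "of_int r \<le> real q * (x + \<psi> q) + \<theta>" "real q * (x - \<psi> q) + \<theta> \<le> of_int r"
      using q by (simp_all add: field_simps)
    then have "r \<le> \<lceil>real q * (x + \<psi> q) + \<theta>\<rceil>" "\<lfloor>real q * (x - \<psi> q) + \<theta>\<rfloor> \<le> r" by linarith+
    then show "(r, q) \<in> (\<Union>q<Q. {\<lfloor>real q * (x - \<psi> q) + \<theta>\<rfloor>..\<lceil>real q * (x + \<psi> q) + \<theta>\<rceil>} \<times> {q})"
      using q by auto
  qed
qed auto

lemma tendsto_powr_neg_sequence:
  fixes M :: "nat \<Rightarrow> real"
  assumes "filterlim M at_top sequentially" "a < 0"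
  shows "(\<lambda>k. M k powr a) \<longlonglongrightarrow> 0"
  using tendsto_neg_powr[OF assms(2) assms(1)] .

text \<open>Between two consecutive prescribed denominators \<open>q\<close> and \<open>q''\<close>, a further approximation with
  denominator \<open>q'\<close> would be repelled by the first unless \<open>q'\<^sup>g \<ge> C q\<^bsup>t - 1\<^esup>\<close>, and by the second unless
  \<open>q'\<^bsup>t - 1\<^esup> \<le> C q''\<^sup>g\<close>; the growth condition makes the two incompatible.\<close>

lemma Exact_sequenceI:
  fixes \<psi> :: "nat \<Rightarrow> real" and M :: "nat \<Rightarrow> real" and \<theta> x t g b \<epsilon> c :: real
  assumes pos: "\<And>q. \<psi> q > 0"
    and upper: "\<forall>\<^sub>F q in sequentially. \<psi> q \<le> real q powr - t"
    and t: "t > 1" and \<epsilon>: "0 < \<epsilon>" "\<epsilon> < 1" and g: "g > 0" and b: "b * (1 - \<epsilon>) > 1"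
    and gap: "b * g\<^sup>2 < (1 - \<epsilon>) * (t - 1)\<^sup>2"
    and c: "c > 0"
    and sep: "\<And>(r::int) (q::nat) (r'::int) (q'::nat). 0 < q \<Longrightarrow> q \<le> q' \<Longrightarrow>
     coprime r (int q) \<Longrightarrow> coprime r' (int q') \<Longrightarrow> (r, q) \<noteq> (r', q') \<Longrightarrow>
     c * real q' powr (1 - g) \<le> \<bar>(of_int r - \<theta>) / real q - (of_int r' - \<theta>) / real q'\<bar> * (real q * real q')"
    and M1: "\<And>k. M k > 1" and Msuc: "\<And>k. M (Suc k) = M k powr b"
    and Mlim: "filterlim M at_top sequentially"
    and approx: "\<And>k. \<exists>(q::nat) (r::int). coprime r (int q) \<and> M k powr (1 - \<epsilon>) \<le> real q \<and> real q \<le> M k \<and>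
       (1 - 2 * M k powr - \<epsilon>) * \<psi> q \<le> x - (of_int r - \<theta>) / real q \<and> x - (of_int r - \<theta>) / real q \<le> \<psi> q"
  shows "x \<in> Exact \<psi> \<theta>"
proof -
  obtain qs :: "nat \<Rightarrow> nat" and rs :: "nat \<Rightarrow> int" where
    co: "\<And>k. coprime (rs k) (int (qs k))" and qlo: "\<And>k. M k powr (1 - \<epsilon>) \<le> real (qs k)" and qhi: "\<And>k. real (qs k) \<le> M k"
    and xlo: "\<And>k. (1 - 2 * M k powr - \<epsilon>) * \<psi> (qs k) \<le> x - (of_int (rs k) - \<theta>) / real (qs k)"
    and xhi: "\<And>k. x - (of_int (rs k) - \<theta>) / real (qs k) \<le> \<psi> (qs k)"
    using approx by metis
  have q1: "real (qs k) > 1" for k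
  proof -
    have "1 < M k powr (1 - \<epsilon>)" using M1[of k] \<epsilon> by simp
    then show ?thesis using qlo[of k] by linarith
  qed
  have qpos: "qs k > 0" for k using q1[of k] by (cases "qs k") auto
  \<comment> \<open>The condition b (1 - \<epsilon>) > 1 makes the windows of denominators at
    successive scales disjoint.\<close>
  have "qs k < qs (Suc k)" for k
  proof -
    have "real (qs k) \<le> M k powr 1" using qhi[of k] M1[of k] by simp
    also have "\<dots> < M k powr (b * (1 - \<epsilon>))" using M1[of k] b by (intro powr_less_mono)
    also have "\<dots> = M (Suc k) powr (1 - \<epsilon>)" by (simp add: Msuc powr_powr)
    also have "\<dots> \<le> real (qs (Suc k))" by (rule qlo)
    finally show ?thesis by simp
  qed
  then have mono: "strict_mono qs" by (simp add: strict_mono_Suc_iff)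
  have xabs: "\<bar>x - (of_int (rs k) - \<theta>) / real (qs k)\<bar> \<le> \<psi> (qs k)" for k
  proof -
    have "M k powr - \<epsilon> \<le> 1" using M1[of k] \<epsilon> powr_mono[of "- \<epsilon>" 0 "M k"] by simp
    then have "-1 * \<psi> (qs k) \<le> (1 - 2 * M k powr - \<epsilon>) * \<psi> (qs k)"
      using pos[of "qs k"] by (intro mult_right_mono) auto
    then show ?thesis using xlo[of k] xhi[of k] by linarith
  qed
  have inf: "infinite {(r :: int, q :: nat). q > 0 \<and> coprime r (int q) \<and>
          \<bar>x - (of_int r - \<theta>) / real q\<bar> \<le> \<psi> q}" (is "infinite ?S")
  proof
    assume "finite ?S"
    moreover have "(\<lambda>k. (rs k, qs k)) ` UNIV \<subseteq> ?S" using qpos co xabs by auto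
    moreover have "infinite ((\<lambda>k. (rs k, qs k)) ` UNIV)"
      using mono by (intro range_inj_infinite) (auto simp: inj_def dest: strict_mono_eq)
    ultimately show False using finite_subset by blast
  qed
  have fin: "finite {(r :: int, q :: nat). q > 0 \<and> coprime r (int q) \<and>
          \<bar>x - (of_int r - \<theta>) / real q\<bar> \<le> \<psi> q - d * \<psi> q}" (is "finite ?T") if d: "d > 0" for d
  proof -
    obtain Q0 where Q0: "\<And>q. q \<ge> Q0 \<Longrightarrow> \<psi> q \<le> real q powr - t"
      using upper by (auto simp: eventually_sequentially)
    \<comment> \<open>The slack in the growth condition, as an exponent of M k.\<close>
    define \<delta> where "\<delta> = (1 - \<epsilon>) * (t - 1)\<^sup>2 - b * g\<^sup>2"
    have \<delta>: "\<delta> > 0" using gap by (simp add: \<delta>_def)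
    \<comment> \<open>The constant left when the competitor's denominator is eliminated from the two
      repulsion inequalities.\<close>
    define H where "H = (2 / c) powr (t - 1) * (2 / c) powr g"
    have H: "H > 0" using c by (simp add: H_def)
    have "\<forall>\<^sub>F k in sequentially. M k powr - \<epsilon> < d / 2"
      using tendsto_powr_neg_sequence[OF Mlim, of "- \<epsilon>"] \<epsilon> d by (intro order_tendstoD) auto
    moreover have "\<forall>\<^sub>F k in sequentially. M k powr - \<delta> < 1 / H"
      using tendsto_powr_neg_sequence[OF Mlim, of "- \<delta>"] \<delta> H by (intro order_tendstoD) auto
    moreover have "\<forall>\<^sub>F k in sequentially. k \<ge> Q0" by (rule eventually_ge_at_top)
    ultimately have "\<forall>\<^sub>F k in sequentially. M k powr - \<epsilon> < d / 2 \<and> M k powr - \<delta> < 1 / H \<and> k \<ge> Q0"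
      by eventually_elim simp
    then obtain k0 where k0: "\<And>k. k \<ge> k0 \<Longrightarrow> M k powr - \<epsilon> < d / 2" "\<And>k. k \<ge> k0 \<Longrightarrow> M k powr - \<delta> < 1 / H" "k0 \<ge> Q0"
      by (auto simp: eventually_sequentially)
    have "?T \<subseteq> {(r :: int, q :: nat). q < qs k0 \<and> q > 0 \<and> \<bar>x - (of_int r - \<theta>) / real q\<bar> \<le> \<psi> q}"
    proof clarify
      fix r :: int and q :: nat
      assume q: "q > 0" "coprime r (int q)" and xq: "\<bar>x - (of_int r - \<theta>) / real q\<bar> \<le> \<psi> q - d * \<psi> q"
      have xq': "\<bar>x - (of_int r - \<theta>) / real q\<bar> \<le> \<psi> q"
        using xq mult_pos_pos[OF d pos[of q]] by linarith
      have "q < qs k0"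
      proof (rule ccontr)
        assume "\<not> q < qs k0"
        then have ge: "qs k0 \<le> q" by simp
        \<comment> \<open>Locates q between consecutive prescribed denominators: qs k \<le> q < qs
          (Suc k) with n = Suc k.\<close>
        define n where "n = (LEAST n. q < qs n)"
        have ex: "q < qs (Suc q)" using strict_mono_imp_increasing[OF mono, of "Suc q"] by simp
        have n: "q < qs n" unfolding n_def by (rule LeastI[of _ "Suc q"]) (rule ex)
        have nk: "n > k0"
        proof (rule ccontr)
          assume "\<not> n > k0"
          then have "qs n \<le> qs k0" using mono by (simp add: strict_mono_less_eq)
          then show False using n ge by simp
        qed
        then obtain k where k: "n = Suc k" "k \<ge> k0" by (cases n) auto
        have kq: "qs k \<le> q" using not_less_Least[of k "\<lambda>n. q < qs n"] k(1) unfolding n_def by simp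
        have kn: "q < qs (Suc k)" using n k by simp
        have kQ: "qs k \<ge> Q0" using strict_mono_imp_increasing[OF mono, of k] k k0(3) by linarith
        \<comment> \<open>A prescribed approximation has error at least (1 - 2 M^-\<epsilon>)
          \<psi>, too large for condition (ii) once 2 M^-\<epsilon> < d.\<close>
        have ne1: "(rs k, qs k) \<noteq> (r, q)"
        proof
          assume e: "(rs k, qs k) = (r, q)"
          have "2 * M k powr - \<epsilon> < d" using k0(1)[OF k(2)] by simp
          then have "(1 - d) * \<psi> q < (1 - 2 * M k powr - \<epsilon>) * \<psi> q"
            using pos[of q] by (intro mult_strict_right_mono) auto
          also have "\<dots> \<le> x - (of_int r - \<theta>) / real q" using xlo[of k] e by simp
          finally have "(1 - d) * \<psi> q < x - (of_int r - \<theta>) / real q" .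
          moreover have "(1 - d) * \<psi> q = \<psi> q - d * \<psi> q" by (simp add: algebra_simps)
          ultimately show False using xq by linarith
        qed
        have ne2: "(r, q) \<noteq> (rs (Suc k), qs (Suc k))" using kn by auto
        define u where "u = real (qs k)"
        define y where "y = real q"
        define v where "v = real (qs (Suc k))"
        have uyv: "1 < u" "u \<le> y" "y < v" using q1[of k] kq kn by (auto simp: u_def y_def v_def)
        have \<psi>y: "\<psi> q \<le> y powr - t" unfolding y_def using kq kQ by (intro Q0) simp
        have \<psi>u: "\<psi> (qs k) \<le> u powr - t" unfolding u_def using kQ by (intro Q0) simp
        have \<psi>v: "\<psi> (qs (Suc k)) \<le> v powr - t" unfolding v_def using kQ kq kn by (intro Q0) simp
        have yu: "y powr - t \<le> u powr - t" using uyv t by (intro powr_mono2') auto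
        have vy: "v powr - t \<le> y powr - t" using uyv t by (intro powr_mono2') auto
        have A: "c * y powr (1 - g) \<le> 2 * u powr - t * (u * y)"
        proof -
          have "c * y powr (1 - g) \<le> \<bar>(of_int (rs k) - \<theta>) / u - (of_int r - \<theta>) / y\<bar> * (u * y)"
            unfolding u_def y_def by (rule sep[OF qpos kq co q(2) ne1])
          also have "\<dots> \<le> (2 * u powr - t) * (u * y)"
          proof (rule mult_right_mono)
            show "\<bar>(of_int (rs k) - \<theta>) / u - (of_int r - \<theta>) / y\<bar> \<le> 2 * u powr - t"
              using xabs[of k] xq' \<psi>y \<psi>u yu unfolding u_def[symmetric] y_def[symmetric] by linarith
          qed (use uyv in auto)
          finally show ?thesis .
        qed
        have B: "c * v powr (1 - g) \<le> 2 * y powr - t * (y * v)"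
        proof -
          have "c * v powr (1 - g) \<le> \<bar>(of_int r - \<theta>) / y - (of_int (rs (Suc k)) - \<theta>) / v\<bar> * (y * v)"
            unfolding v_def y_def by (rule sep[OF q(1) less_imp_le[OF kn] q(2) co ne2])
          also have "\<dots> \<le> (2 * y powr - t) * (y * v)"
          proof (rule mult_right_mono)
            show "\<bar>(of_int r - \<theta>) / y - (of_int (rs (Suc k)) - \<theta>) / v\<bar> \<le> 2 * y powr - t"
              using xabs[of "Suc k"] xq' \<psi>y \<psi>v vy unfolding v_def[symmetric] y_def[symmetric] by linarith
          qed (use uyv in auto)
          finally show ?thesis .
        qed
        \<comment> \<open>Both repulsion inequalities have this form: the smaller denominator z to
          the power t - 1 is at most a constant times the larger one z' to the power g.\<close>
        have shape: "z powr (t - 1) \<le> 2 / c * z' powr g"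
          if h: "c * z' powr (1 - g) \<le> 2 * z powr - t * (z * z')" "z > 1" "z' > 0" for z z'
        proof -
          have e1: "z powr - t * z = z powr - (t - 1)" using h powr_add[of z "- t" 1] by simp
          have "c * (z' powr - g * z') \<le> 2 * (z powr - t * z) * z'"
            using h powr_add[of z' "- g" 1] by (simp add: mult_ac)
          then have "(c * z' powr - g) * z' \<le> (2 * z powr - (t - 1)) * z'"
            unfolding e1 by (simp add: mult_ac)
          then have "c * z' powr - g \<le> 2 * z powr - (t - 1)" using h by simp
          then have "c / z' powr g \<le> 2 / z powr (t - 1)" by (simp only: powr_minus divide_inverse)
          then show ?thesis using c h by (simp add: field_simps)
        qed
        have A': "u powr (t - 1) \<le> 2 / c * y powr g" using A uyv by (intro shape) auto
        have B': "y powr (t - 1) \<le> 2 / c * v powr g"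
          using B uyv by (intro shape) auto
        \<comment> \<open>Raise the first inequality to the power t - 1 and insert the second raised
          to the power g; this eliminates y. With u \<ge> M^(1-\<epsilon>) and v \<le> M^b the
          result contradicts the gap condition.\<close>
        have "(u powr (t - 1)) powr (t - 1) \<le> (2 / c * y powr g) powr (t - 1)"
          using A' t by (intro powr_mono2) auto
        also have "\<dots> = (2 / c) powr (t - 1) * (y powr (t - 1)) powr g"
          unfolding powr_mult powr_powr by (simp only: mult.commute[of g])
        also have "\<dots> \<le> (2 / c) powr (t - 1) * (2 / c * v powr g) powr g"
          using B' g by (intro mult_left_mono powr_mono2) auto
        also have "\<dots> = H * (v powr g) powr g"
          unfolding H_def powr_mult by (simp only: mult.assoc)
        finally have key: "(u powr (t - 1)) powr (t - 1) \<le> H * (v powr g) powr g" .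
        have "M k powr ((1 - \<epsilon>) * (t - 1)\<^sup>2) = ((M k powr (1 - \<epsilon>)) powr (t - 1)) powr (t - 1)"
          by (simp add: powr_powr power2_eq_square mult.assoc)
        also have "\<dots> \<le> (u powr (t - 1)) powr (t - 1)"
          using qlo[of k] t unfolding u_def by (intro powr_mono2) auto
        also note key
        also have "H * (v powr g) powr g \<le> H * (M (Suc k) powr g) powr g"
          using qhi[of "Suc k"] g H unfolding v_def by (intro mult_left_mono powr_mono2) auto
        also have "(M (Suc k) powr g) powr g = M k powr (b * g\<^sup>2)"
          by (simp add: Msuc powr_powr power2_eq_square mult.assoc)
        finally have le: "M k powr ((1 - \<epsilon>) * (t - 1)\<^sup>2) \<le> H * M k powr (b * g\<^sup>2)" .
        have "(1 - \<epsilon>) * (t - 1)\<^sup>2 = \<delta> + b * g\<^sup>2" by (simp add: \<delta>_def)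
        then have "M k powr \<delta> * M k powr (b * g\<^sup>2) \<le> H * M k powr (b * g\<^sup>2)"
          using le by (simp add: powr_add)
        then have le': "M k powr \<delta> \<le> H" using M1[of k] by simp
        have "inverse (M k powr \<delta>) < inverse H"
          using k0(2)[OF k(2)] by (simp add: powr_minus divide_inverse)
        then have "H < M k powr \<delta>" using H M1[of k] by simp
        then show False using le' by simp
      qed
      then show "q < qs k0 \<and> q > 0 \<and> \<bar>x - (of_int r - \<theta>) / real q\<bar> \<le> \<psi> q" using q xq' by simp
    qed
    then show ?thesis by (rule finite_subset) (rule finite_approximations_below)
  qed
  show ?thesis unfolding Exact_def using inf fin by simp
qed

section \<open>Iteration of the scales\<close>

text \<open>The uniform bound X is used up to frequency R and the bound Y / \<xi>^2 beyond it; both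
  are assumed to match E R^-\<sigma> at the crossover. The factor 2 absorbs the passage between 1 +
  |\<xi>| and |\<xi>| or R.\<close>

lemma interpolated_decay:
  fixes X Y R \<sigma> \<xi> d E :: real
  assumes R: "R \<ge> 1" and \<sigma>: "0 \<le> \<sigma>" "\<sigma> \<le> 1" and d: "d \<ge> 0"
    and X: "d \<le> X" "X * R powr \<sigma> \<le> E" and Y: "\<xi>\<^sup>2 * d \<le> Y" "Y * R powr (\<sigma> - 2) \<le> E"
  shows "d \<le> 2 * E * (1 + \<bar>\<xi>\<bar>) powr - \<sigma>"
proof -
  have two: "2 powr \<sigma> \<le> (2::real)" using \<sigma> powr_mono[of \<sigma> 1 "2::real"] by simp
  have "d * (1 + \<bar>\<xi>\<bar>) powr \<sigma> \<le> 2 * E"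
  proof (cases "\<bar>\<xi>\<bar> \<le> R")
    case True
    have "(1 + \<bar>\<xi>\<bar>) powr \<sigma> \<le> (2 * R) powr \<sigma>" using True R \<sigma> by (intro powr_mono2) auto
    also have "\<dots> = 2 powr \<sigma> * R powr \<sigma>" by (rule powr_mult)
    also have "\<dots> \<le> 2 * R powr \<sigma>" using two by (intro mult_right_mono) auto
    finally have "d * (1 + \<bar>\<xi>\<bar>) powr \<sigma> \<le> X * (2 * R powr \<sigma>)" using d X by (intro mult_mono) auto
    then show ?thesis using X(2) by linarith
  next
    case False
    define z where "z = \<bar>\<xi>\<bar>"
    have z: "z > R" "z \<ge> 1" using False R by (auto simp: z_def)
    have "(1 + z) powr \<sigma> \<le> (2 * z) powr \<sigma>" using z \<sigma> by (intro powr_mono2) auto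
    also have "\<dots> = 2 powr \<sigma> * z powr \<sigma>" by (rule powr_mult)
    also have "\<dots> \<le> 2 * z powr \<sigma>" using two by (intro mult_right_mono) auto
    finally have "d * (1 + z) powr \<sigma> \<le> d * (2 * z powr \<sigma>)" using d by (intro mult_left_mono) auto
    also have "z powr \<sigma> = z powr (\<sigma> - 2) * z\<^sup>2"
      using z by (simp add: powr_diff powr_numeral)
    also have "d * (2 * (z powr (\<sigma> - 2) * z\<^sup>2)) = 2 * (z\<^sup>2 * d) * z powr (\<sigma> - 2)" by (simp add: mult_ac)
    also have "\<dots> \<le> 2 * Y * R powr (\<sigma> - 2)"
    proof (intro mult_mono)
      show "z powr (\<sigma> - 2) \<le> R powr (\<sigma> - 2)" using z R \<sigma> by (intro powr_mono2') auto
      have "0 \<le> \<xi>\<^sup>2 * d" using d by simp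
      then show "0 \<le> 2 * Y" using Y(1) by linarith
      show "z\<^sup>2 * d \<le> Y" using Y(1) by (simp add: z_def)
    qed (use d in auto)
    finally show ?thesis using Y(2) by (simp add: z_def)
  qed
  moreover have "(1 + \<bar>\<xi>\<bar>) powr \<sigma> > 0" by simp
  ultimately show ?thesis by (simp add: powr_minus field_simps)
qed

text \<open>Both invariants of f at scale M are reproduced for g at scale M^b. \<Lambda> is the
  fixed point of the growth of the l^1 bound. \<zeta> is the largest exponent for which M^\<zeta> /
  \<xi>^2 is at most M^-\<epsilon> |\<xi>|^-\<sigma> at the crossover frequency
  M^(\<tau>+2\<epsilon>). Numerical constants are absorbed by M^\<epsilon> \<ge> 11.\<close>

lemma scale_step:
  fixes f F :: "real \<Rightarrow> complex" and c :: "int \<Rightarrow> complex" and M \<epsilon> \<tau> \<sigma> b \<Lambda> \<zeta> :: real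
  assumes M: "M > 1" "M powr \<epsilon> \<ge> 11" and \<epsilon>: "\<epsilon> > 0" and \<tau>: "\<tau> > 1" and \<sigma>: "0 \<le> \<sigma>" "\<sigma> \<le> 1" and b: "b > 1"
    and \<Lambda>: "\<Lambda> + (\<tau> + 2 * \<epsilon>) * \<sigma> \<le> 1 - 4 * \<epsilon>" "\<tau> - 1 + 5 * \<epsilon> + \<Lambda> = b * \<Lambda>"
    and \<zeta>: "\<zeta> = (\<tau> + 2 * \<epsilon>) * (2 - \<sigma>) - \<epsilon>" "\<tau> - 1 + 5 * \<epsilon> + \<zeta> / b + \<epsilon> \<le> \<zeta>"
    and f: "integrable lborel f"
    and c: "(\<lambda>l. norm (c l)) summable_on UNIV"
    and F: "\<And>x. ((\<lambda>l. c l * ee (of_int l * x)) has_sum F x) UNIV"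
    and c0: "c 0 = 1"
    and cD: "\<And>l. l \<noteq> 0 \<Longrightarrow> norm (c l) \<le> M powr (-1 + 2 * \<epsilon>) / (1 + (M powr - (\<tau> + 2 * \<epsilon>) * of_int l)\<^sup>2)"
    and L: "\<And>\<xi> S. finite S \<Longrightarrow> (\<Sum>l\<in>S. norm (FT f (\<xi> - of_int l))) \<le> M powr \<Lambda>"
    and C: "\<And>\<xi>. \<xi>\<^sup>2 * norm (FT f \<xi>) \<le> M powr (\<zeta> / b)"
  defines "g \<equiv> (\<lambda>x. f x * F x)"
  shows "finite S \<Longrightarrow> (\<Sum>l\<in>S. norm (FT g (\<xi> - of_int l))) \<le> (M powr b) powr \<Lambda>"
    and "\<xi>\<^sup>2 * norm (FT g \<xi>) \<le> (M powr b) powr (\<zeta> / b)"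
    and "norm (FT g \<xi> - FT f \<xi>) \<le> 2 * M powr - \<epsilon> * (1 + \<bar>\<xi>\<bar>) powr - \<sigma>"
proof -
  define D where "D = M powr (-1 + 2 * \<epsilon>)"
  define w where "w = M powr - (\<tau> + 2 * \<epsilon>)"
  define A where "A = 1 + 10 * D / w"
  have D: "D \<ge> 0" by (simp add: D_def)
  have w: "0 < w" "w \<le> 1" using M \<epsilon> \<tau> powr_mono[of "- (\<tau> + 2 * \<epsilon>)" 0 M] by (auto simp: w_def)
  note step = fourier_step[OF f c F c0 cD[folded D_def w_def] w D L C, folded g_def A_def]
  have iw: "1 / w = M powr (\<tau> + 2 * \<epsilon>)" unfolding w_def powr_minus by (simp add: divide_inverse)
  have Dw: "D / w = M powr (\<tau> - 1 + 4 * \<epsilon>)"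
  proof -
    have "D / w = D * (1 / w)" by simp
    also have "\<dots> = M powr ((-1 + 2 * \<epsilon>) + (\<tau> + 2 * \<epsilon>))" unfolding iw D_def powr_add ..
    also have "(-1 + 2 * \<epsilon>) + (\<tau> + 2 * \<epsilon>) = \<tau> - 1 + 4 * \<epsilon>" by simp
    finally show ?thesis .
  qed
  \<comment> \<open>The 11 arises here: 1 + 10 D / w is at most 11 times the power representing D /
    w.\<close>
  have A: "A \<le> M powr (\<tau> - 1 + 5 * \<epsilon>)"
  proof -
    have "1 \<le> M powr (\<tau> - 1 + 4 * \<epsilon>)" using M \<epsilon> \<tau> by (intro ge_one_powr_ge_zero) auto
    then have "A \<le> 11 * M powr (\<tau> - 1 + 4 * \<epsilon>)" using Dw by (simp add: A_def)
    also have "\<dots> \<le> M powr \<epsilon> * M powr (\<tau> - 1 + 4 * \<epsilon>)" using M by (intro mult_right_mono) auto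
    also have "\<dots> = M powr (\<epsilon> + (\<tau> - 1 + 4 * \<epsilon>))" by (rule powr_add[symmetric])
    also have "\<epsilon> + (\<tau> - 1 + 4 * \<epsilon>) = \<tau> - 1 + 5 * \<epsilon>" by simp
    finally show ?thesis .
  qed
  have A0: "A \<ge> 0" using D w by (simp add: A_def)
  have pb: "(M powr b) powr a = M powr (b * a)" for a by (rule powr_powr)
  show "(\<Sum>l\<in>S. norm (FT g (\<xi> - of_int l))) \<le> (M powr b) powr \<Lambda>" if "finite S"
  proof -
    have "(\<Sum>l\<in>S. norm (FT g (\<xi> - of_int l))) \<le> A * M powr \<Lambda>" by (rule step(1)[OF _ _ that])
    also have "\<dots> \<le> M powr (\<tau> - 1 + 5 * \<epsilon>) * M powr \<Lambda>" by (intro mult_right_mono A) auto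
    also have "\<dots> = M powr (\<tau> - 1 + 5 * \<epsilon> + \<Lambda>)" by (rule powr_add[symmetric])
    finally show ?thesis using \<Lambda>(2) by (simp add: pb)
  qed
  \<comment> \<open>Each summand is at most 2 M^(\<zeta>-\<epsilon>), and 4 \<le>
    M^\<epsilon>.\<close>
  have Y: "2 * D / w\<^sup>2 * M powr \<Lambda> + 2 * A * M powr (\<zeta> / b) \<le> M powr \<zeta>"
  proof -
    have "2 * D / w\<^sup>2 * M powr \<Lambda> = 2 * (D / w * (1 / w) * M powr \<Lambda>)" by (simp add: power2_eq_square)
    also have "D / w * (1 / w) * M powr \<Lambda> = M powr ((\<tau> - 1 + 4 * \<epsilon>) + (\<tau> + 2 * \<epsilon>) + \<Lambda>)"
      unfolding Dw iw powr_add ..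
    also have "\<dots> \<le> M powr (\<zeta> - \<epsilon>)"
    proof (rule powr_mono)
      have "(\<tau> - 1 + 4 * \<epsilon>) + (\<tau> + 2 * \<epsilon>) + \<Lambda> \<le> 2 * (\<tau> + 2 * \<epsilon>) - (\<tau> + 2 * \<epsilon>) * \<sigma> - 2 * \<epsilon>"
        using \<Lambda>(1) by simp
      then show "(\<tau> - 1 + 4 * \<epsilon>) + (\<tau> + 2 * \<epsilon>) + \<Lambda> \<le> \<zeta> - \<epsilon>"
        using \<zeta>(1) by (simp add: algebra_simps)
    qed (use M in auto)
    finally have 1: "2 * D / w\<^sup>2 * M powr \<Lambda> \<le> 2 * M powr (\<zeta> - \<epsilon>)" by simp
    have "A * M powr (\<zeta> / b) \<le> M powr (\<tau> - 1 + 5 * \<epsilon>) * M powr (\<zeta> / b)" by (intro mult_right_mono A) auto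
    also have "\<dots> = M powr (\<tau> - 1 + 5 * \<epsilon> + \<zeta> / b)" by (rule powr_add[symmetric])
    also have "\<dots> \<le> M powr (\<zeta> - \<epsilon>)" using \<zeta>(2) M by (intro powr_mono) auto
    finally have 2: "2 * A * M powr (\<zeta> / b) \<le> 2 * M powr (\<zeta> - \<epsilon>)" by simp
    have "4 * M powr (\<zeta> - \<epsilon>) \<le> M powr \<epsilon> * M powr (\<zeta> - \<epsilon>)" using M by (intro mult_right_mono) auto
    also have "\<dots> = M powr \<zeta>" by (simp add: powr_add[symmetric])
    finally show ?thesis using 1 2 by linarith
  qed
  show "\<xi>\<^sup>2 * norm (FT g \<xi>) \<le> (M powr b) powr (\<zeta> / b)"
  proof -
    have "\<xi>\<^sup>2 * norm (FT g \<xi>) \<le> 2 * D / w\<^sup>2 * M powr \<Lambda> + 2 * A * M powr (\<zeta> / b)" by (rule step(3))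
    also have "\<dots> \<le> M powr \<zeta>" by (rule Y)
    also have "\<dots> = (M powr b) powr (\<zeta> / b)" using b by (simp add: pb)
    finally show ?thesis .
  qed
  show "norm (FT g \<xi> - FT f \<xi>) \<le> 2 * M powr - \<epsilon> * (1 + \<bar>\<xi>\<bar>) powr - \<sigma>"
  proof (rule interpolated_decay)
    show "M powr (\<tau> + 2 * \<epsilon>) \<ge> 1" using M \<epsilon> \<tau> by (intro ge_one_powr_ge_zero) auto
    show "norm (FT g \<xi> - FT f \<xi>) \<le> D * M powr \<Lambda>" by (rule step(2))
    show "\<xi>\<^sup>2 * norm (FT g \<xi> - FT f \<xi>) \<le> M powr \<zeta>" by (rule order_trans[OF step(4) Y])
    have "D * M powr \<Lambda> * (M powr (\<tau> + 2 * \<epsilon>)) powr \<sigma> = M powr ((-1 + 2 * \<epsilon>) + \<Lambda> + (\<tau> + 2 * \<epsilon>) * \<sigma>)"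
      unfolding D_def powr_powr unfolding powr_add ..
    also have "\<dots> \<le> M powr - \<epsilon>" using \<Lambda>(1) M \<epsilon> by (intro powr_mono) auto
    finally show "D * M powr \<Lambda> * (M powr (\<tau> + 2 * \<epsilon>)) powr \<sigma> \<le> M powr - \<epsilon>" .
    have "M powr \<zeta> * (M powr (\<tau> + 2 * \<epsilon>)) powr (\<sigma> - 2) = M powr (\<zeta> + (\<tau> + 2 * \<epsilon>) * (\<sigma> - 2))"
      unfolding powr_powr unfolding powr_add ..
    also have "\<zeta> + (\<tau> + 2 * \<epsilon>) * (\<sigma> - 2) = - \<epsilon>" using \<zeta>(1) by (simp add: algebra_simps)
    finally show "M powr \<zeta> * (M powr (\<tau> + 2 * \<epsilon>)) powr (\<sigma> - 2) \<le> M powr - \<epsilon>" by simp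
  qed (use \<sigma> in auto)
qed

section \<open>Choice of the parameters\<close>

lemma eventually_at_right_0_pos:
  fixes h :: "real \<Rightarrow> real"
  assumes "(h \<longlongrightarrow> l) (at_right 0)" "l > 0"
  shows "\<forall>\<^sub>F \<epsilon> in at_right 0. h \<epsilon> > 0"
  using order_tendstoD(1)[OF assms] .

text \<open>At \<epsilon> = 0 every condition is a strict inequality, so all persist for small
  \<epsilon> > 0 once b is fixed. Decay needs b > b0 and exactness needs b < \<beta>; the assumption
  on \<sigma> says precisely that b0 < \<beta>.\<close>

lemma parameters_exist:
  fixes \<tau> \<gamma> \<sigma> :: real
  defines "\<beta> \<equiv> (\<tau> - 1)\<^sup>2 / \<gamma>\<^sup>2"
  assumes \<gamma>: "\<gamma> \<ge> 1" and \<tau>: "\<tau> > 1" and \<beta>: "\<beta> > \<tau>"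
    and \<sigma>: "0 \<le> \<sigma>" "\<sigma> < (\<beta> - \<tau>) / (\<tau> * (\<beta> - 1))"
  obtains b \<epsilon> where "b > 1" "0 < \<epsilon>" "\<epsilon> < 1/2" "b * (1 - \<epsilon>) > 1" "\<tau> - \<epsilon> > 1"
    "b * (\<gamma> + \<epsilon>)\<^sup>2 < (1 - \<epsilon>) * (\<tau> - \<epsilon> - 1)\<^sup>2"
    "(\<tau> - 1 + 5 * \<epsilon>) / (b - 1) + (\<tau> + 2 * \<epsilon>) * \<sigma> \<le> 1 - 4 * \<epsilon>"
    "\<tau> - 1 + 5 * \<epsilon> + ((\<tau> + 2 * \<epsilon>) * (2 - \<sigma>) - \<epsilon>) / b + \<epsilon> \<le> (\<tau> + 2 * \<epsilon>) * (2 - \<sigma>) - \<epsilon>"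
proof -
  have \<beta>1: "\<beta> > 1" using \<beta> \<tau> by simp
  have "\<tau> * \<sigma> < (\<beta> - \<tau>) / (\<beta> - 1)"
  proof -
    have "\<tau> * \<sigma> < \<tau> * ((\<beta> - \<tau>) / (\<tau> * (\<beta> - 1)))" using \<sigma> \<tau> by (intro mult_strict_left_mono) auto
    then show ?thesis using \<tau> by simp
  qed
  then have "\<tau> * \<sigma> * (\<beta> - 1) < \<beta> - \<tau>" using \<beta>1 by (simp add: pos_less_divide_eq)
  then have key: "\<tau> - 1 < (1 - \<tau> * \<sigma>) * (\<beta> - 1)" by (simp add: algebra_simps)
  then have pos: "1 - \<tau> * \<sigma> > 0" 
  proof -
    have "(1 - \<tau> * \<sigma>) * (\<beta> - 1) > 0" using key \<tau> by linarith
    then show ?thesis using \<beta>1 by (simp add: zero_less_mult_iff)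
  qed
  \<comment> \<open>The solution b of (\<tau> - 1) / (b - 1) + \<tau>\<sigma> = 1.\<close>
  define b0 where "b0 = 1 + (\<tau> - 1) / (1 - \<tau> * \<sigma>)"
  have "(\<tau> - 1) / (1 - \<tau> * \<sigma>) < \<beta> - 1"
    using key pos by (simp add: pos_divide_less_eq mult.commute)
  then have b0: "b0 < \<beta>" by (simp add: b0_def)
  define b where "b = (b0 + \<beta>) / 2"
  have b: "b0 < b" "b < \<beta>" using b0 by (auto simp: b_def)
  have "\<tau> - 1 \<le> (\<tau> - 1) / (1 - \<tau> * \<sigma>)"
    using pos \<tau> \<sigma> mult_left_mono[of "1 - \<tau> * \<sigma>" 1 "\<tau> - 1"] by (simp add: pos_le_divide_eq)
  then have b\<tau>: "b > \<tau>" using b by (simp add: b0_def)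
  have b1: "b > 1" using b\<tau> \<tau> by simp
  have c3: "1 - ((\<tau> - 1) / (b - 1) + \<tau> * \<sigma>) > 0"
  proof -
    have "(\<tau> - 1) / (1 - \<tau> * \<sigma>) < b - 1" using b by (simp add: b0_def)
    then have "(\<tau> - 1) < (b - 1) * (1 - \<tau> * \<sigma>)" using pos by (simp add: pos_divide_less_eq)
    then have "(\<tau> - 1) / (b - 1) < 1 - \<tau> * \<sigma>" using b1 by (simp add: pos_divide_less_eq mult.commute)
    then show ?thesis by simp
  qed
  have c2: "(\<tau> - 1)\<^sup>2 - b * \<gamma>\<^sup>2 > 0"
  proof -
    have "b * \<gamma>\<^sup>2 < \<beta> * \<gamma>\<^sup>2" using b \<gamma> by (intro mult_strict_right_mono) auto
    then show ?thesis using \<gamma> by (simp add: \<beta>_def)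
  qed
  \<comment> \<open>Because \<tau>\<sigma> < 1, the quantity \<tau>(2 - \<sigma>) exceeds 2\<tau> -
    1, and b > \<tau> then suffices: (2\<tau> - 1)(b - 1) - (\<tau> - 1) b = \<tau>(b - \<tau>) +
    (\<tau> - 1)^2.\<close>
  have c5: "\<tau> * (2 - \<sigma>) - (\<tau> - 1 + \<tau> * (2 - \<sigma>) / b) > 0"
  proof -
    have z: "\<tau> * (2 - \<sigma>) > 2 * \<tau> - 1" using pos by (simp add: algebra_simps)
    have "(\<tau> - 1) * b < (2 * \<tau> - 1) * (b - 1)"
    proof -
      have "0 < \<tau> * (b - \<tau>) + (\<tau> - 1) * (\<tau> - 1)" using \<tau> b\<tau> by (intro add_pos_pos mult_pos_pos) auto
      then show ?thesis by (simp add: algebra_simps)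
    qed
    also have "\<dots> < \<tau> * (2 - \<sigma>) * (b - 1)" using z b1 by (intro mult_strict_right_mono) auto
    finally have "(\<tau> - 1) * b + \<tau> * (2 - \<sigma>) < \<tau> * (2 - \<sigma>) * b" by (simp add: algebra_simps)
    then have "((\<tau> - 1) * b + \<tau> * (2 - \<sigma>)) / b < \<tau> * (2 - \<sigma>)" using b1 by (simp add: pos_divide_less_eq)
    then show ?thesis using b1 by (simp add: add_divide_distrib)
  qed
  have "\<forall>\<^sub>F \<epsilon> in at_right 0. \<epsilon> > (0::real)" by (rule eventually_at_right_less)
  moreover have "\<forall>\<^sub>F \<epsilon> in at_right 0. 1/2 - \<epsilon> > (0::real)"
    by (rule eventually_at_right_0_pos[where l = "1/2"]) (auto intro!: tendsto_eq_intros)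
  moreover have "\<forall>\<^sub>F \<epsilon> in at_right 0. b * (1 - \<epsilon>) - 1 > 0"
    by (rule eventually_at_right_0_pos[where l = "b * (1 - 0) - 1"], intro tendsto_intros) (use b1 in auto)
  moreover have "\<forall>\<^sub>F \<epsilon> in at_right 0. \<tau> - \<epsilon> - 1 > 0"
    by (rule eventually_at_right_0_pos[where l = "\<tau> - 0 - 1"], intro tendsto_intros) (use \<tau> in auto)
  moreover have "\<forall>\<^sub>F \<epsilon> in at_right 0. (1 - \<epsilon>) * (\<tau> - \<epsilon> - 1)\<^sup>2 - b * (\<gamma> + \<epsilon>)\<^sup>2 > 0"
    by (rule eventually_at_right_0_pos[where l = "(1 - 0) * (\<tau> - 0 - 1)\<^sup>2 - b * (\<gamma> + 0)\<^sup>2"], intro tendsto_intros)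
       (use c2 in auto)
  moreover have "\<forall>\<^sub>F \<epsilon> in at_right 0. (1 - 4 * \<epsilon>) - ((\<tau> - 1 + 5 * \<epsilon>) / (b - 1) + (\<tau> + 2 * \<epsilon>) * \<sigma>) > 0"
    by (rule eventually_at_right_0_pos[where l = "(1 - 4 * 0) - ((\<tau> - 1 + 5 * 0) / (b - 1) + (\<tau> + 2 * 0) * \<sigma>)"], intro tendsto_intros)
       (use c3 b1 in auto)
  moreover have "\<forall>\<^sub>F \<epsilon> in at_right 0. ((\<tau> + 2 * \<epsilon>) * (2 - \<sigma>) - \<epsilon>)
      - (\<tau> - 1 + 5 * \<epsilon> + ((\<tau> + 2 * \<epsilon>) * (2 - \<sigma>) - \<epsilon>) / b + \<epsilon>) > 0"
    by (rule eventually_at_right_0_pos[where l = "((\<tau> + 2 * 0) * (2 - \<sigma>) - 0)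
      - (\<tau> - 1 + 5 * 0 + ((\<tau> + 2 * 0) * (2 - \<sigma>) - 0) / b + 0)"], intro tendsto_intros)
       (use c5 b1 in auto)
  ultimately have ev: "\<forall>\<^sub>F \<epsilon> in at_right 0. 0 < \<epsilon> \<and> \<epsilon> < 1/2 \<and> b * (1 - \<epsilon>) > 1 \<and> \<tau> - \<epsilon> > 1 \<and>
    b * (\<gamma> + \<epsilon>)\<^sup>2 < (1 - \<epsilon>) * (\<tau> - \<epsilon> - 1)\<^sup>2 \<and>
    (\<tau> - 1 + 5 * \<epsilon>) / (b - 1) + (\<tau> + 2 * \<epsilon>) * \<sigma> \<le> 1 - 4 * \<epsilon> \<and>
    \<tau> - 1 + 5 * \<epsilon> + ((\<tau> + 2 * \<epsilon>) * (2 - \<sigma>) - \<epsilon>) / b + \<epsilon> \<le> (\<tau> + 2 * \<epsilon>) * (2 - \<sigma>) - \<epsilon>"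
    by eventually_elim (intro conjI; linarith)
  from eventually_happens'[OF trivial_limit_at_right_real ev] show ?thesis
    using that b1 by blast
qed

text \<open>The fraction lies in [1/8, 7/8]. With q \<ge> 8 the two margins of q/8 leave room for
  the shift \<theta> < 1, so 0 < r < q, and a prime q cannot divide such an r.\<close>

lemma shifted_fraction_coprime:
  fixes q :: nat and r :: int and \<theta> x :: real
  assumes q: "prime q" "q \<ge> 8" and \<theta>: "0 \<le> \<theta>" "\<theta> < 1" and x: "x \<in> {1/4..3/4}"
    and d: "\<bar>x - (of_int r - \<theta>) / real q\<bar> \<le> 1/8"
  shows "0 < r" "r < int q" "coprime r (int q)"
proof -
  have q8: "real q \<ge> 8" using q(2) by simp
  have "(of_int r - \<theta>) / real q \<ge> 1/8" "(of_int r - \<theta>) / real q \<le> 7/8" 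
    using x d unfolding atLeastAtMost_iff by linarith+
  then have "of_int r - \<theta> \<ge> real q / 8" "of_int r - \<theta> \<le> real q * 7 / 8" using q8 by (simp_all add: field_simps)
  then have "real_of_int r > 0" "real_of_int r < real q" using q8 \<theta> by linarith+
  then show r: "0 < r" "r < int q" by linarith+
  have "\<not> int q dvd r" using r zdvd_not_zless by blast
  then have "coprime (int q) r" using q(1) by (intro prime_imp_coprime) auto
  then show "coprime r (int q)" by (simp add: coprime_commute)
qed

text \<open>The start of the induction over scales. The constants come from the cubic bound 8 / (1 +
  |\<xi>|/4)^3: 320 = 8 * 10 * 4, 128 = 8 * 4^2, 512 = 8 * 4^3.\<close>

lemma base_bump_bounds:
  defines "f \<equiv> (\<lambda>x. complex_of_real (bump ((x - 1/2) / (1/4)) / (1/4)))"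
  shows "integrable lborel f" "FT f 0 = 1"
    and "finite S \<Longrightarrow> (\<Sum>l\<in>S. norm (FT f (\<xi> - of_int l))) \<le> 320"
    and "\<xi>\<^sup>2 * norm (FT f \<xi>) \<le> 128"
    and "0 \<le> \<sigma> \<Longrightarrow> \<sigma> \<le> 1 \<Longrightarrow> norm (FT f \<xi>) \<le> 512 * (1 + \<bar>\<xi>\<bar>) powr - \<sigma>"
proof -
  show "integrable lborel f" unfolding f_def by (rule integrable_bump_scaled) simp
  have eq: "FT f \<xi> = ee (- (1/2 * \<xi>)) * FT (\<lambda>x. bump x) (1/4 * \<xi>)" for \<xi>
    unfolding f_def by (rule FT_bump_scaled) simp
  show "FT f 0 = 1" unfolding eq using FT_bump_0 by simp
  have cub: "norm (FT f \<xi>) \<le> 8 / (1 + \<bar>1/4 * \<xi>\<bar>) ^ 3" for \<xi>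
    unfolding eq using FT_bump_le[of "1/4 * \<xi>"] by (simp only: norm_mult norm_ee mult_1_left)
  have quad: "norm (FT f \<xi>) \<le> 8 * (1 / (1 + (1/4 * \<xi>)\<^sup>2))" for \<xi>
    using cub[of \<xi>] cubic_le_quadratic[of "1/4 * \<xi>"] by (rule order_trans)
  show "(\<Sum>l\<in>S. norm (FT f (\<xi> - of_int l))) \<le> 320" if "finite S"
  proof -
    have "(\<Sum>l\<in>S. norm (FT f (\<xi> - of_int l))) \<le> (\<Sum>l\<in>S. 8 * (1 / (1 + (1/4 * (\<xi> - of_int l))\<^sup>2)))"
      by (intro sum_mono quad)
    also have "\<dots> = 8 * (\<Sum>l\<in>S. 1 / (1 + (1/4 * (\<xi> - of_int l))\<^sup>2))" by (simp only: sum_distrib_left)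
    also have "\<dots> \<le> 8 * (10 / (1/4))" using that by (intro mult_left_mono sum_inverse_quadratic_le) auto
    finally show ?thesis by simp
  qed
  show "\<xi>\<^sup>2 * norm (FT f \<xi>) \<le> 128"
  proof -
    have "\<xi>\<^sup>2 * norm (FT f \<xi>) \<le> \<xi>\<^sup>2 * (8 * (1 / (1 + (1/4 * \<xi>)\<^sup>2)))" by (intro mult_left_mono quad) auto
    also have "\<dots> \<le> 128"
    proof -
      have "1 + (1/4 * \<xi>)\<^sup>2 > 0" by (simp add: add_pos_nonneg)
      moreover have "8 * \<xi>\<^sup>2 \<le> 128 * (1 + (1/4 * \<xi>)\<^sup>2)" by (simp add: power_mult_distrib power2_eq_square)
      ultimately have "8 * \<xi>\<^sup>2 / (1 + (1/4 * \<xi>)\<^sup>2) \<le> 128" by (simp only: pos_divide_le_eq)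
      then show ?thesis by (simp add: mult.commute)
    qed
    finally show ?thesis .
  qed
  show "norm (FT f \<xi>) \<le> 512 * (1 + \<bar>\<xi>\<bar>) powr - \<sigma>" if "0 \<le> \<sigma>" "\<sigma> \<le> 1"
  proof -
    define z where "z = 1 + \<bar>\<xi>\<bar>"
    have z: "z \<ge> 1" by (simp add: z_def)
    have "(1/4 * z) ^ 3 \<le> (1 + \<bar>1/4 * \<xi>\<bar>) ^ 3" by (intro power_mono) (auto simp: z_def)
    then have "8 / (1 + \<bar>1/4 * \<xi>\<bar>) ^ 3 \<le> 8 / (1/4 * z) ^ 3"
      using z by (intro divide_left_mono mult_pos_pos zero_less_power) (auto simp: add_pos_nonneg)
    also have "\<dots> = 512 / z ^ 3" by (simp add: power_mult_distrib power_divide)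
    also have "\<dots> = 512 * z powr - 3" using z by (simp add: powr_minus powr_numeral divide_inverse)
    also have "\<dots> \<le> 512 * z powr - \<sigma>" using z that by (intro mult_left_mono powr_mono) auto
    finally show ?thesis using cub[of \<xi>] by (simp add: z_def)
  qed
qed

text \<open>The iteration at one \<sigma> strictly below the target. A rapidly growing sequence of
  scales makes the total change of the transform at most half of (1 + |\<xi>|)^-\<sigma>, which
  preserves both mass and decay, and the limit measure lives on a compact set of points fitting
  every scale.\<close>

lemma fourier_admissible_Exact:
  fixes \<theta> \<gamma> \<tau> \<sigma> :: real and \<psi> :: "nat \<Rightarrow> real"
  defines "\<beta> \<equiv> (\<tau> - 1)\<^sup>2 / \<gamma>\<^sup>2"
  assumes \<theta>: "0 \<le> \<theta>" "\<theta> < 1"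
    and cases: "(\<theta> = 0 \<and> \<gamma> = 1) \<or> (\<theta> \<notin> \<rat> \<and> dioph_exponent \<theta> = ereal \<gamma>)"
    and pos: "\<And>q. \<psi> q > 0" and lam: "lambda_exp \<psi> \<tau>"
    and \<gamma>: "\<gamma> \<ge> 1" and \<tau>: "\<tau> > 1" and \<beta>: "\<beta> > \<tau>"
    and \<sigma>: "0 \<le> \<sigma>" "\<sigma> \<le> 1/2" "\<sigma> < (\<beta> - \<tau>) / (\<tau> * (\<beta> - 1))"
  shows "fourier_admissible (Exact \<psi> \<theta>) (2 * \<sigma>)"
proof -
  obtain b \<epsilon> where par: "b > 1" "0 < \<epsilon>" "\<epsilon> < 1/2" "b * (1 - \<epsilon>) > 1" "\<tau> - \<epsilon> > 1"
    "b * (\<gamma> + \<epsilon>)\<^sup>2 < (1 - \<epsilon>) * (\<tau> - \<epsilon> - 1)\<^sup>2"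
    "(\<tau> - 1 + 5 * \<epsilon>) / (b - 1) + (\<tau> + 2 * \<epsilon>) * \<sigma> \<le> 1 - 4 * \<epsilon>"
    "\<tau> - 1 + 5 * \<epsilon> + ((\<tau> + 2 * \<epsilon>) * (2 - \<sigma>) - \<epsilon>) / b + \<epsilon> \<le> (\<tau> + 2 * \<epsilon>) * (2 - \<sigma>) - \<epsilon>"
    using parameters_exist[OF \<gamma> \<tau> \<beta>[unfolded \<beta>_def] \<sigma>(1) \<sigma>(3)[unfolded \<beta>_def]] by metis
  define \<Lambda> where "\<Lambda> = (\<tau> - 1 + 5 * \<epsilon>) / (b - 1)"
  define \<zeta> where "\<zeta> = (\<tau> + 2 * \<epsilon>) * (2 - \<sigma>) - \<epsilon>"
  have \<Lambda>1: "\<Lambda> + (\<tau> + 2 * \<epsilon>) * \<sigma> \<le> 1 - 4 * \<epsilon>" using par(7) by (simp add: \<Lambda>_def)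
  have \<Lambda>2: "\<tau> - 1 + 5 * \<epsilon> + \<Lambda> = b * \<Lambda>"
  proof -
    have "\<Lambda> * (b - 1) = \<tau> - 1 + 5 * \<epsilon>" using par(1) by (simp add: \<Lambda>_def)
    then show ?thesis by (simp add: algebra_simps)
  qed
  have \<Lambda>0: "\<Lambda> > 0" using par \<tau> by (simp add: \<Lambda>_def)
  have \<zeta>2: "\<tau> - 1 + 5 * \<epsilon> + \<zeta> / b + \<epsilon> \<le> \<zeta>" using par(8) by (simp add: \<zeta>_def)
  have \<zeta>0: "\<zeta> > 0"
  proof -
    have "1 * 1 \<le> (\<tau> + 2 * \<epsilon>) * (2 - \<sigma>)" using \<tau> par \<sigma> by (intro mult_mono) auto
    then show ?thesis using par by (simp add: \<zeta>_def)
  qed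
  \<comment> \<open>The conclusion of \<open>approximation_factor\<close> packed into one predicate,
    so that one factor per scale can be chosen at once.\<close>
  define G where "G M F c \<longleftrightarrow> F \<in> borel_measurable borel \<and> (\<forall>x. F x \<ge> 0) \<and>
      (\<lambda>l. norm (c l)) summable_on UNIV \<and>
      (\<forall>x. ((\<lambda>l. c l * ee (of_int l * x)) has_sum complex_of_real (F x)) UNIV) \<and> c 0 = 1 \<and>
      (\<forall>l. l \<noteq> 0 \<longrightarrow> norm (c l) \<le> M powr (-1 + 2 * \<epsilon>) / (1 + (M powr - (\<tau> + 2 * \<epsilon>) * of_int l)\<^sup>2)) \<and>
      (\<forall>x. F x \<noteq> 0 \<longrightarrow> (\<exists>(q::nat) (r::int). prime q \<and> M powr (1 - \<epsilon>) \<le> real q \<and> real q \<le> M \<and>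
          (1 - 2 * M powr - \<epsilon>) * \<psi> q \<le> x - (of_int r - \<theta>) / real q \<and> x - (of_int r - \<theta>) / real q \<le> \<psi> q))"
    for M :: real and F :: "real \<Rightarrow> real" and c :: "int \<Rightarrow> complex"
  have ev1: "\<forall>\<^sub>F M in at_top. \<exists>F c. G M F c"
    unfolding G_def using par \<tau>
    by (intro approximation_factor lambda_exp_lower[OF lam pos]) auto
  have up: "\<forall>\<^sub>F q in sequentially. \<psi> q \<le> real q powr - (\<tau> - \<epsilon>)"
    by (rule lambda_exp_upper[OF lam pos]) (use par in simp)
  obtain q1 where q1: "\<And>q. q \<ge> q1 \<Longrightarrow> \<psi> q \<le> 1/8"
  proof -
    have "\<forall>\<^sub>F q in sequentially. real q powr - (\<tau> - \<epsilon>) < 1/8"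
      using tendsto_powr_neg_sequence[OF filterlim_real_sequentially, of "- (\<tau> - \<epsilon>)"] par
      by (intro order_tendstoD) auto
    then have "\<forall>\<^sub>F q in sequentially. \<psi> q \<le> 1/8" using up by eventually_elim linarith
    then show ?thesis using that by (auto simp: eventually_sequentially)
  qed
  \<comment> \<open>The thresholds: 11 for \<open>scale_step\<close>, \<open>q1\<close> and 8 for
    \<psi>(q) \<le> 1/8 and coprimality, 320 and 128 for the starting bump, and 2 for geometric
    decay of M^-\<epsilon> along the scales.\<close>
  have "\<forall>\<^sub>F M in at_top. (\<exists>F c. G M F c) \<and> 11 \<le> M powr \<epsilon> \<and> max (real q1) 8 \<le> M powr (1 - \<epsilon>)
      \<and> 320 \<le> M powr \<Lambda> \<and> 128 \<le> M powr (\<zeta> / b) \<and> 2 \<le> M powr (\<epsilon> * (b - 1)) \<and> 1 < M"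
    using par \<Lambda>0 \<zeta>0
    by (intro eventually_conj ev1 eventually_ge_powr eventually_gt_at_top) auto
  then obtain M0' where M0': "\<And>M. M \<ge> M0' \<Longrightarrow> (\<exists>F c. G M F c) \<and> 11 \<le> M powr \<epsilon> \<and> max (real q1) 8 \<le> M powr (1 - \<epsilon>)
      \<and> 320 \<le> M powr \<Lambda> \<and> 128 \<le> M powr (\<zeta> / b) \<and> 2 \<le> M powr (\<epsilon> * (b - 1)) \<and> 1 < M"
    by (auto simp: eventually_at_top_linorder)
  define M where "M k = M0' powr (b ^ k)" for k :: nat
  have M0'1: "M0' > 1" using M0'[of M0'] by simp
  have Mge: "M k \<ge> M0'" for k
  proof -
    have "M0' powr 1 \<le> M0' powr (b ^ k)" using M0'1 par(1) by (intro powr_mono) auto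
    then show ?thesis using M0'1 by (simp add: M_def)
  qed
  note Mk = M0'[OF Mge]
  have Msuc: "M (Suc k) = M k powr b" for k by (simp add: M_def powr_powr mult.commute)
  \<comment> \<open>Passing to the next scale multiplies M^-\<epsilon> by M^-(\<epsilon>(b-1)) \<le>
    1/2. Starting at 1/8, the changes 2 M^-\<epsilon> of all steps add up to at most 1/2.\<close>
  have Meps: "M k powr - \<epsilon> \<le> 1/8 * (1/2) ^ k" for k
  proof (induction k)
    case 0
    have "11 \<le> M 0 powr \<epsilon>" using Mk by blast
    then have "inverse (M 0 powr \<epsilon>) \<le> inverse 11" by (intro le_imp_inverse_le) auto
    then show ?case by (simp add: powr_minus)
  next
    case (Suc k)
    have "M (Suc k) powr - \<epsilon> = M k powr (- \<epsilon> + - (\<epsilon> * (b - 1)))"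
      unfolding Msuc powr_powr by (simp add: algebra_simps)
    also have "\<dots> = M k powr - \<epsilon> * M k powr - (\<epsilon> * (b - 1))" by (rule powr_add)
    also have "\<dots> \<le> (1/8 * (1/2) ^ k) * (1/2)"
    proof (intro mult_mono Suc)
      have "2 \<le> M k powr (\<epsilon> * (b - 1))" using Mk by blast
      then have "inverse (M k powr (\<epsilon> * (b - 1))) \<le> inverse 2" by (intro le_imp_inverse_le) auto
      then show "M k powr - (\<epsilon> * (b - 1)) \<le> 1/2" by (simp add: powr_minus)
    qed auto
    finally show ?case by simp
  qed
  have Mlim: "filterlim M at_top sequentially"
  proof -
    have "(\<lambda>k. M k powr - \<epsilon>) \<longlonglongrightarrow> 0"
    proof (rule Lim_null_comparison)
      show "\<forall>\<^sub>F k in sequentially. norm (M k powr - \<epsilon>) \<le> 1/8 * (1/2) ^ k"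
        using Meps by (intro always_eventually allI) simp
      show "(\<lambda>k. 1/8 * (1/2) ^ k :: real) \<longlonglongrightarrow> 0"
        by (intro tendsto_mult_right_zero LIMSEQ_power_zero) simp
    qed
    moreover have "\<forall>\<^sub>F k in sequentially. M k powr - \<epsilon> > 0"
      using M0'1 by (auto simp: M_def)
    ultimately have "filterlim (\<lambda>k. inverse (M k powr - \<epsilon>)) at_top sequentially"
      by (rule filterlim_inverse_at_top)
    then have l1: "filterlim (\<lambda>k. M k powr \<epsilon>) at_top sequentially" by (simp add: powr_minus)
    show ?thesis unfolding filterlim_at_top
    proof
      fix Z :: real
      from l1 have "\<forall>\<^sub>F k in sequentially. M k powr \<epsilon> \<ge> (max Z 1) powr \<epsilon>"
        by (simp add: filterlim_at_top)
      then show "\<forall>\<^sub>F k in sequentially. Z \<le> M k"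
      proof eventually_elim
        case (elim k)
        show ?case
        proof (rule ccontr)
          assume "\<not> Z \<le> M k"
          then have "M k < max Z 1" by simp
          then have "M k powr \<epsilon> < max Z 1 powr \<epsilon>" using Mk[of k] par by (intro powr_less_mono2) auto
          then show False using elim by simp
        qed
      qed
    qed
  qed
  obtain FF cc where FF: "\<And>k. G (M k) (FF k) (cc k)"
    using Mk by metis
  define base where "base x = bump ((x - 1/2) / (1/4)) / (1/4)" for x :: real
  define f where "f n x = base x * (\<Prod>k<n. FF k x)" for n x
  note b0 = base_bump_bounds[folded base_def]
  have f_Suc: "(\<lambda>x. complex_of_real (f (Suc n) x)) = (\<lambda>x. complex_of_real (f n x) * complex_of_real (FF n x))" for n
    by (auto simp: f_def fun_eq_iff)
  have f_0: "(\<lambda>x. complex_of_real (f 0 x)) = (\<lambda>x. complex_of_real (base x))" by (simp add: f_def)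
  let ?f = "\<lambda>n x. complex_of_real (f n x)"
  have inv: "integrable lborel (?f n) \<and> (\<forall>\<xi> S. finite S \<longrightarrow> (\<Sum>l\<in>S. norm (FT (?f n) (\<xi> - of_int l))) \<le> M n powr \<Lambda>)
      \<and> (\<forall>\<xi>. \<xi>\<^sup>2 * norm (FT (?f n) \<xi>) \<le> M n powr (\<zeta> / b))" for n
  proof (induction n)
    case 0
    have "320 \<le> M 0 powr \<Lambda>" "128 \<le> M 0 powr (\<zeta> / b)" using Mk by blast+
    then show ?case unfolding f_0
      using b0(1) order_trans[OF b0(3)] order_trans[OF b0(4)] by blast
  next
    case (Suc n)
    note F = FF[of n, unfolded G_def]
    have csum: "(\<lambda>l. norm (cc n l)) summable_on UNIV" and hs: "\<And>x. ((\<lambda>l. cc n l * ee (of_int l * x)) has_sum complex_of_real (FF n x)) UNIV"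
      and c0: "cc n 0 = 1"
      and cD: "\<And>l. l \<noteq> 0 \<Longrightarrow> norm (cc n l) \<le> M n powr (-1 + 2 * \<epsilon>) / (1 + (M n powr - (\<tau> + 2 * \<epsilon>) * of_int l)\<^sup>2)"
      using F by blast+
    have M: "M n > 1" "11 \<le> M n powr \<epsilon>" using Mk by blast+
    have \<sigma>1: "\<sigma> \<le> 1" using \<sigma> by simp
    have i: "integrable lborel (?f n)" using Suc by blast
    note st = scale_step[OF M par(2) \<tau> \<sigma>(1) \<sigma>1 par(1) \<Lambda>1 \<Lambda>2 \<zeta>_def \<zeta>2 i csum hs c0 cD]
    show ?case unfolding f_Suc Msuc
      using FT_mult_has_sum(2)[OF i csum hs] st(1,2) Suc by blast
  qed
  have diff: "norm (FT (?f (Suc n)) \<xi> - FT (?f n) \<xi>) \<le> 1/4 * (1/2) ^ n * (1 + \<bar>\<xi>\<bar>) powr - \<sigma>" for n \<xi>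
  proof -
    note F = FF[of n, unfolded G_def]
    have csum: "(\<lambda>l. norm (cc n l)) summable_on UNIV" and hs: "\<And>x. ((\<lambda>l. cc n l * ee (of_int l * x)) has_sum complex_of_real (FF n x)) UNIV"
      and c0: "cc n 0 = 1"
      and cD: "\<And>l. l \<noteq> 0 \<Longrightarrow> norm (cc n l) \<le> M n powr (-1 + 2 * \<epsilon>) / (1 + (M n powr - (\<tau> + 2 * \<epsilon>) * of_int l)\<^sup>2)"
      using F by blast+
    have M: "M n > 1" "11 \<le> M n powr \<epsilon>" using Mk by blast+
    have \<sigma>1: "\<sigma> \<le> 1" using \<sigma> by simp
    have i: "integrable lborel (?f n)" using inv by blast
    have "norm (FT (?f (Suc n)) \<xi> - FT (?f n) \<xi>) \<le> 2 * M n powr - \<epsilon> * (1 + \<bar>\<xi>\<bar>) powr - \<sigma>"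
      unfolding f_Suc
      by (rule scale_step(3)[OF M par(2) \<tau> \<sigma>(1) \<sigma>1 par(1) \<Lambda>1 \<Lambda>2 \<zeta>_def \<zeta>2 i csum hs c0 cD]) (use inv in blast)+
    also have "\<dots> \<le> 2 * (1/8 * (1/2) ^ n) * (1 + \<bar>\<xi>\<bar>) powr - \<sigma>"
      by (intro mult_right_mono mult_left_mono Meps) auto
    finally show ?thesis by simp
  qed
  \<comment> \<open>The closed form of the geometric sum is what the induction can carry.\<close>
  have total: "norm (FT (?f n) \<xi> - FT (?f 0) \<xi>) \<le> (1/2 - 1/2 * (1/2) ^ n) * (1 + \<bar>\<xi>\<bar>) powr - \<sigma>" for n \<xi>
  proof (induction n)
    case (Suc n)
    have "norm (FT (?f (Suc n)) \<xi> - FT (?f 0) \<xi>) \<le> norm (FT (?f (Suc n)) \<xi> - FT (?f n) \<xi>) + norm (FT (?f n) \<xi> - FT (?f 0) \<xi>)"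
      by (rule norm_diff_triangle_ineq[of "FT (?f (Suc n)) \<xi>" "FT (?f n) \<xi>" "FT (?f n) \<xi>" "FT (?f 0) \<xi>", simplified])
    also have "\<dots> \<le> 1/4 * (1/2) ^ n * (1 + \<bar>\<xi>\<bar>) powr - \<sigma> + (1/2 - 1/2 * (1/2) ^ n) * (1 + \<bar>\<xi>\<bar>) powr - \<sigma>"
      by (intro add_mono diff Suc)
    also have "\<dots> = (1/2 - 1/2 * (1/2) ^ Suc n) * (1 + \<bar>\<xi>\<bar>) powr - \<sigma>"
      by (simp add: algebra_simps)
    finally show ?case .
  qed simp
  have total': "norm (FT (?f n) \<xi> - FT (?f 0) \<xi>) \<le> 1/2 * (1 + \<bar>\<xi>\<bar>) powr - \<sigma>" for n \<xi>
    by (rule order_trans[OF total]) (intro mult_right_mono, auto)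
  have decay: "norm (FT (?f n) \<xi>) \<le> 513 * (1 + \<bar>\<xi>\<bar>) powr - \<sigma>" for n \<xi>
  proof -
    have "norm (FT (?f n) \<xi>) \<le> norm (FT (?f n) \<xi> - FT (?f 0) \<xi>) + norm (FT (?f 0) \<xi>)"
      using norm_triangle_ineq[of "FT (?f n) \<xi> - FT (?f 0) \<xi>" "FT (?f 0) \<xi>"] by simp
    also have "\<dots> \<le> 1/2 * (1 + \<bar>\<xi>\<bar>) powr - \<sigma> + 512 * (1 + \<bar>\<xi>\<bar>) powr - \<sigma>"
    proof (rule add_mono[OF total'])
      show "norm (FT (?f 0) \<xi>) \<le> 512 * (1 + \<bar>\<xi>\<bar>) powr - \<sigma>"
        unfolding f_0 using \<sigma> by (intro b0(5)) auto
    qed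
    also have "\<dots> \<le> 513 * (1 + \<bar>\<xi>\<bar>) powr - \<sigma>" by simp
    finally show ?thesis .
  qed
  \<comment> \<open>At frequency 0 the transform is the mass: it starts at 1 and moves by at most
    1/2 in total.\<close>
  have mass: "(\<integral>x. f n x \<partial>lborel) \<ge> 1/2" for n
  proof -
    have "FT (?f n) 0 = complex_of_real (\<integral>x. f n x \<partial>lborel)"
      unfolding FT_def by (simp add: integral_complex_of_real)
    then have "norm (complex_of_real (\<integral>x. f n x \<partial>lborel) - 1) \<le> 1/2"
      using total'[of n 0] b0(2) unfolding f_0 by simp
    then have "norm (complex_of_real ((\<integral>x. f n x \<partial>lborel) - 1)) \<le> 1/2" by simp
    then show ?thesis unfolding norm_of_real by linarith
  qed
  have fnn: "f n x \<ge> 0" for n x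
    unfolding f_def base_def using FF bump_nonneg by (intro mult_nonneg_nonneg prod_nonneg) (auto simp: G_def)
  have fint: "integrable lborel (f n)" for n
  proof -
    have "integrable lborel (\<lambda>x. Re (?f n x))" by (rule integrable_Re) (use inv in blast)
    then show ?thesis by simp
  qed
  have base_out: "base x = 0" if "x \<notin> {1/4..3/4}" for x
  proof -
    have "\<bar>(x - 1/2) / (1/4)\<bar> \<ge> 1" using that by (auto simp: abs_if)
    then show ?thesis unfolding base_def by (simp add: bump_eq_0)
  qed
  \<comment> \<open>Weak limits respect closed sets only, so the set where a factor is nonzero is
    enclosed in a closed one. The bounds on q and r make the index set finite, hence the union of
    intervals \<open>Z k\<close> closed.\<close>
  define Idx where "Idx k = {(q::nat, r::int). real q \<le> M k \<and> M k powr (1 - \<epsilon>) \<le> real q \<and> coprime r (int q) \<and> 0 < r \<and> r < int q}" for k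
  define Z where "Z k = (\<Union>(q, r)\<in>Idx k. {1/4..3/4} \<inter>
      {(1 - 2 * M k powr - \<epsilon>) * \<psi> q + (of_int r - \<theta>) / real q..\<psi> q + (of_int r - \<theta>) / real q})" for k
  \<comment> \<open>The index is shifted because f m contains the factors k < m: it vanishes off
    \<open>K n\<close> for every n \<le> m, with \<open>K 0\<close> enclosing the base
    support.\<close>
  define K where "K n = (case n of 0 \<Rightarrow> {1/4..3/4} | Suc k \<Rightarrow> Z k)" for n
  have finI: "finite (Idx k)" for k
  proof (rule finite_subset)
    show "Idx k \<subseteq> {..nat \<lfloor>M k\<rfloor>} \<times> {0..\<lfloor>M k\<rfloor>}"
      by (auto simp: Idx_def le_nat_floor le_floor_iff)
  qed auto
  have clZ: "closed (Z k)" for k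
    unfolding Z_def using finI by (intro closed_UN) auto
  have clK: "closed (K n)" for n unfolding K_def using clZ by (cases n) auto
  have Zmem: "x \<in> Z k" if x: "x \<in> {1/4..3/4}" "FF k x \<noteq> 0" for x k
  proof -
    from FF[of k] x(2) obtain q r where qr: "prime q" "M k powr (1 - \<epsilon>) \<le> real q" "real q \<le> M k"
       "(1 - 2 * M k powr - \<epsilon>) * \<psi> q \<le> x - (of_int r - \<theta>) / real q" "x - (of_int r - \<theta>) / real q \<le> \<psi> q"
      unfolding G_def by blast
    have "max (real q1) 8 \<le> M k powr (1 - \<epsilon>)" using Mk by blast
    then have q: "real q1 \<le> real q" "8 \<le> real q" using qr(2) by auto
    have "M k powr - \<epsilon> \<le> 1" using Meps[of k] power_le_one[of "1/2::real" k] by simp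
    then have "-1 * \<psi> q \<le> (1 - 2 * M k powr - \<epsilon>) * \<psi> q"
      using pos[of q] by (intro mult_right_mono) auto
    moreover have "\<psi> q \<le> 1/8" using q1[of q] q by simp
    ultimately have "\<bar>x - (of_int r - \<theta>) / real q\<bar> \<le> 1/8" using qr(4,5) by linarith
    from shifted_fraction_coprime[OF qr(1) _ \<theta> x(1) this] q
    have "(q, r) \<in> Idx k" using qr by (simp add: Idx_def)
    moreover have "x \<in> {1/4..3/4} \<inter> {(1 - 2 * M k powr - \<epsilon>) * \<psi> q + (of_int r - \<theta>) / real q..\<psi> q + (of_int r - \<theta>) / real q}"
      using x qr by auto
    ultimately show ?thesis unfolding Z_def by blast
  qed
  have fK: "f m x = 0" if "n \<le> m" "x \<notin> K n" for m n x
  proof (cases n)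
    case 0
    then show ?thesis using that base_out[of x] by (simp add: K_def f_def)
  next
    case (Suc k)
    show ?thesis
    proof (cases "x \<in> {1/4..3/4}")
      case True
      then have "FF k x = 0" using Zmem[of x k] that Suc by (auto simp: K_def)
      moreover have "k < m" using Suc that by simp
      ultimately have "(\<Prod>k<m. FF k x) = 0" by (intro prod_zero) auto
      then show ?thesis by (simp add: f_def)
    next
      case False
      then show ?thesis using base_out[of x] by (simp add: f_def)
    qed
  qed
  have fout: "f n x = 0" if "x \<notin> {1/4..3/4}" for n x
    using base_out[OF that] by (simp add: f_def)
  have "\<exists>\<mu>. sets \<mu> = sets borel \<and> finite_measure \<mu> \<and> emeasure \<mu> (space \<mu>) \<noteq> 0 \<and>
     emeasure \<mu> (UNIV - (\<Inter>n. K n)) = 0 \<and> (\<forall>\<xi>. norm (fourier_transform \<mu> \<xi>) \<le> 2 * 513 * (1 + \<bar>\<xi>\<bar>) powr - \<sigma>)"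
  proof (rule weak_limit_fourier_decay)
    show "(1/4 :: real) < 3/4" by simp
    show "f m x = 0" if "n \<le> m" "x \<notin> K n" for m n x by (rule fK[OF that])
  qed (fact fnn fint mass fout clK decay)+
  then obtain \<mu> where \<mu>: "sets \<mu> = sets borel" "finite_measure \<mu>" "emeasure \<mu> (space \<mu>) \<noteq> 0"
     "emeasure \<mu> (UNIV - (\<Inter>n. K n)) = 0" "\<And>\<xi>. norm (fourier_transform \<mu> \<xi>) \<le> 2 * 513 * (1 + \<bar>\<xi>\<bar>) powr - \<sigma>"
    by blast
  have comp: "compact (\<Inter>n. K n)"
  proof -
    have "closed (\<Inter>n. K n)" using clK by auto
    moreover have "(\<Inter>n. K n) \<subseteq> {1/4..3/4}" by (force simp: K_def split: nat.splits)
    ultimately show ?thesis by (metis compact_Icc compact_Int_closed inf.absorb_iff2 inf_commute)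
  qed
  obtain c where c: "c > 0" and sep: "\<And>(r::int) (q::nat) (r'::int) (q'::nat). 0 < q \<Longrightarrow> q \<le> q' \<Longrightarrow>
     coprime r (int q) \<Longrightarrow> coprime r' (int q') \<Longrightarrow> (r, q) \<noteq> (r', q') \<Longrightarrow>
     c * real q' powr (1 - (\<gamma> + \<epsilon>)) \<le> \<bar>(of_int r - \<theta>) / real q - (of_int r' - \<theta>) / real q'\<bar> * (real q * real q')"
    using separation_of_shifted_fractions[OF cases, of "\<gamma> + \<epsilon>"] par(2) by auto
  have sub: "(\<Inter>n. K n) \<subseteq> Exact \<psi> \<theta>"
  proof
    fix x assume x: "x \<in> (\<Inter>n. K n)"
    have ap: "\<exists>(q::nat) (r::int). coprime r (int q) \<and> M k powr (1 - \<epsilon>) \<le> real q \<and> real q \<le> M k \<and>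
       (1 - 2 * M k powr - \<epsilon>) * \<psi> q \<le> x - (of_int r - \<theta>) / real q \<and> x - (of_int r - \<theta>) / real q \<le> \<psi> q" for k
    proof -
      have "x \<in> K (Suc k)" using x by blast
      then have "x \<in> Z k" by (simp add: K_def)
      then obtain q r where "(q, r) \<in> Idx k"
        "x \<in> {(1 - 2 * M k powr - \<epsilon>) * \<psi> q + (of_int r - \<theta>) / real q..\<psi> q + (of_int r - \<theta>) / real q}"
        unfolding Z_def by blast
      then show ?thesis by (intro exI[of _ q] exI[of _ r]) (auto simp: Idx_def)
    qed
    show "x \<in> Exact \<psi> \<theta>"
    proof (rule Exact_sequenceI[OF pos up])
      show "M k > 1" for k using Mk by blast
      show "\<epsilon> < 1" "\<gamma> + \<epsilon> > 0" using par \<gamma> by simp_all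
    qed (fact par c sep Msuc Mlim ap)+
  qed
  show ?thesis
    unfolding fourier_admissible_def
  proof (intro conjI exI[of _ \<mu>] exI[of _ "\<Inter>n. K n"] exI[of _ "2 * 513"])
    show "\<forall>\<xi>. norm (fourier_transform \<mu> \<xi>) \<le> 2 * 513 * (1 + \<bar>\<xi>\<bar>) powr (- (2 * \<sigma>) / 2)"
      using \<mu>(5) by simp
  qed (use \<mu> comp sub \<sigma> in auto)
qed

theorem theorem1:
  fixes \<theta> \<gamma> \<tau> :: real and \<psi> :: "nat \<Rightarrow> real"
  assumes theta_range: "0 \<le> \<theta>" "\<theta> < 1"
    and theta_cases: "(\<theta> = 0 \<and> \<gamma> = 1) \<or> (\<theta> \<notin> \<rat> \<and> dioph_exponent \<theta> = ereal \<gamma>)"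
    and psi_pos: "\<And>q. \<psi> q > 0"
    and psi_decr: "antimono \<psi>"
    and tau: "lambda_exp \<psi> \<tau>"
    and tau_big: "\<tau> > (2 + \<gamma>\<^sup>2 + sqrt ((2 + \<gamma>\<^sup>2)\<^sup>2 - 4)) / 2"
  shows "fourier_dim (Exact \<psi> \<theta>) > 0
     \<and> fourier_dim (Exact \<psi> \<theta>) \<ge>
         (let \<beta> = (\<tau> - 1)\<^sup>2 / \<gamma>\<^sup>2 in 2 * (\<beta> - \<tau>) / (\<tau> * (\<beta> - 1)))"
proof -
  define \<beta> where "\<beta> = (\<tau> - 1)\<^sup>2 / \<gamma>\<^sup>2"
  define \<sigma>0 where "\<sigma>0 = (\<beta> - \<tau>) / (\<tau> * (\<beta> - 1))"
  have \<gamma>: "\<gamma> \<ge> 1"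
    using theta_cases dioph_exponent_ge_1[of \<theta>] by (auto simp: one_ereal_def)
  have \<gamma>2: "\<gamma>\<^sup>2 \<ge> 1" using \<gamma> by simp
  define h where "h = 2 + \<gamma>\<^sup>2"
  have h: "h \<ge> 3" using \<gamma>2 by (simp add: h_def)
  have disc: "h\<^sup>2 - 4 \<ge> 0" using power_mono[of 3 h 2] h by simp
  \<comment> \<open>The threshold is the larger root of t^2 - (2 + \<gamma>^2) t + 1, that is, of (t
    - 1)^2 = \<gamma>^2 t; hence exceeding it gives \<beta> > \<tau>.\<close>
  have big: "2 * \<tau> - h > sqrt (h\<^sup>2 - 4)" using tau_big by (simp add: h_def field_simps)
  \<comment> \<open>Used for \<sigma>0 \<le> 1/2, which keeps 2\<sigma> within the range [0, 1] of
    admissible exponents.\<close>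
  have \<tau>2: "\<tau> \<ge> 2"
  proof -
    have "1 \<le> sqrt (h\<^sup>2 - 4)" using power_mono[of 3 h 2] h by (intro real_le_rsqrt) simp
    then show ?thesis using big h by linarith
  qed
  have "(sqrt (h\<^sup>2 - 4))\<^sup>2 < (2 * \<tau> - h)\<^sup>2"
    using big disc by (intro power_strict_mono) auto
  then have "h\<^sup>2 - 4 < (2 * \<tau> - h)\<^sup>2" using disc by simp
  then have "\<gamma>\<^sup>2 * \<tau> < (\<tau> - 1)\<^sup>2" by (simp add: h_def power2_eq_square algebra_simps)
  then have \<beta>: "\<tau> < \<beta>"
    unfolding \<beta>_def using \<gamma> by (subst pos_less_divide_eq) (auto simp: mult.commute)
  have \<sigma>0: "0 < \<sigma>0" "\<sigma>0 \<le> 1/2"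
  proof -
    show "0 < \<sigma>0" using \<beta> \<tau>2 by (simp add: \<sigma>0_def)
    have "\<tau> * (\<beta> - 1) \<ge> 2 * (\<beta> - 1)" using \<tau>2 \<beta> by (intro mult_right_mono) auto
    moreover have "(\<beta> - \<tau>) * 2 \<le> 2 * (\<beta> - 1)" using \<tau>2 by simp
    ultimately have "(\<beta> - \<tau>) * 2 \<le> \<tau> * (\<beta> - 1)" by (rule order_trans[rotated])
    then show "\<sigma>0 \<le> 1/2" using \<beta> \<tau>2 by (simp add: \<sigma>0_def pos_divide_le_eq)
  qed
  have bdd: "bdd_above (insert 0 {s. fourier_admissible (Exact \<psi> \<theta>) s})"
    by (rule bdd_aboveI[of _ 1]) (auto simp: fourier_admissible_def)
  have ge: "2 * \<sigma> \<le> fourier_dim (Exact \<psi> \<theta>)" if "0 \<le> \<sigma>" "\<sigma> < \<sigma>0" for \<sigma>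
  proof -
    have "fourier_admissible (Exact \<psi> \<theta>) (2 * \<sigma>)"
    proof (rule fourier_admissible_Exact[OF theta_range theta_cases psi_pos tau \<gamma>])
      show "\<tau> > 1" using \<tau>2 by simp
      show "(\<tau> - 1)\<^sup>2 / \<gamma>\<^sup>2 > \<tau>" using \<beta> by (simp add: \<beta>_def)
      show "\<sigma> < ((\<tau> - 1)\<^sup>2 / \<gamma>\<^sup>2 - \<tau>) / (\<tau> * ((\<tau> - 1)\<^sup>2 / \<gamma>\<^sup>2 - 1))"
        using that by (simp add: \<sigma>0_def \<beta>_def)
    qed (use that \<sigma>0 in auto)
    then show ?thesis unfolding fourier_dim_def by (intro cSup_upper bdd) auto
  qed
  \<comment> \<open>Only exponents strictly below the target are known to be admissible; density
    carries the supremum to the endpoint. The maximum with 0 handles negative y.\<close>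
  have "2 * \<sigma>0 \<le> fourier_dim (Exact \<psi> \<theta>)"
  proof (rule dense_le)
    fix y assume y: "y < 2 * \<sigma>0"
    have "2 * max 0 (y / 2) \<le> fourier_dim (Exact \<psi> \<theta>)" using y \<sigma>0 by (intro ge) auto
    then show "y \<le> fourier_dim (Exact \<psi> \<theta>)" by simp
  qed
  moreover have "2 * \<sigma>0 = 2 * (\<beta> - \<tau>) / (\<tau> * (\<beta> - 1))" by (simp add: \<sigma>0_def)
  ultimately show ?thesis using \<sigma>0(1) unfolding \<beta>_def[symmetric] Let_def by linarith
qed

end
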